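(* Let $A,\Sigma\in\mathbb{R}^{d\times d}$, $H\in\mathbb{R}^{k\times d}$, $\Gamma\in\mathbb{R}^{k\times k}$, where $(H,A)$ is a d-detectable pair, $A$ is invertible, and $\Sigma,\Gamma$ are symmetric positive definite. Let $\mu,\nu\in\mathcal{P}_2(\mathbb{R}^d)$ with $\mathrm{Cov}(\mu)=\mathrm{Cov}(\nu)$, fix an observation sequence $(y_n^\dagger)_{n\ge1}$ in $\mathbb{R}^k$, and let $\hat\pi_n^\mu,\hat\pi_n^\nu$ ($n\ge 1$) be the laws of the forecast variables $\hat X_n^\mu,\hat X_n^\nu$ of the discrete-time mean-field ensemble Kalman filter (defined in the context) with initial data $X_0^\mu\sim\mu$, $X_0^\nu\sim\nu$, both driven by the same observation sequence. Write $\hat C_n^\mu:=\mathrm{Cov}(\hat\pi_n^\mu)=\mathrm{Cov}(\hat\pi_n^\nu)$, which is independent of the observation sequence. Then for all $n\ge1$ $$W_2^2(\hat\pi_{n+1}^\mu,\hat\pi_{n+1}^\nu;\hat C_{n+1}^\mu)\le (1-\beta_d(\hat C_n^\mu))\,W_2^2(\hat\pi_n^\mu,\hat\pi_n^\nu;\hat C_n^\mu),$$ where $\beta_d$, mapping symmetric positive definite $d\times d$ matrices to strictly positive reals, is given by $$\beta_d(\hat C)=\lambda_{\min}\Big(\hat C^{1/2}H^T(H\hat CH^T+\Gamma)^{-1}H\hat C^{1/2}+\hat C^{-1/2}(\hat C^{-1}+H^T\Gamma^{-1}H+A^T\Sigma^{-1}A)^{-1}\hat C^{-1/2}\Big).$$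 In particular, at the stable covariance matrix $\hat C_\infty\succ0$ it simplifies to $$\beta_d(\hat C_\infty)=\lambda_{\min}\Big(\hat C_\infty^{-1/2}\big(\Sigma+K_d(\hat C_\infty)\Gamma K_d(\hat C_\infty)^T\big)\hat C_\infty^{-1/2}\Big).$$ Moreover, there is $\beta_d^0>0$, which may depend on $\mathrm{Cov}(\mu)$, such that $\beta_d(\hat C_n^\mu)\ge\beta_d^0$ for all $n\geq 1$, and $$W_2^2(\hat\pi_{n+1}^\mu,\hat\pi_{n+1}^\nu;\hat C_{n+1}^\mu)\le(1-\beta_d^0)^n\,W_2^2(\hat\pi_1^\mu,\hat\pi_1^\nu;\hat C_1^\mu).$$
   Context: $\mathcal{P}_2(\mathbb{R}^d)$: Borel probability measures on $\mathbb{R}^d$ with finite second moments; $\mathrm{Cov}$ denotes the covariance matrix; $\lambda_{\min}(S)$ is the smallest eigenvalue of a symmetric matrix $S$. For $M$ symmetric positive definite, $|v|_M^2:=v^TM^{-1}v$ and $W_2(\mu,\nu;M):=\inf_{\gamma\in\Pi(\mu,\nu)}\left(\iint|x-y|_M^2\,d\gamma(x,y)\right)^{1/2}$, where $\Pi(\mu,\nu)$ is the set of couplings of $\mu,\nu$. A pair $(H,A)$ is d-detectable if there exists $K\in\mathbb{R}^{d\times k}$ such that $A-KH$ has spectral radius strictly less than $1$. Discrete-time mean-field ensemble Kalman filter (MFEnKF): given $X_0\sim\mu$ and a fixed (deterministic) observation sequence $(y_n^\dagger)_{n\ge1}$, for $n\ge0$, $$\hat X_{n+1}=AX_n+\xi_{n+1},\qquad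 X_{n+1}=\hat X_{n+1}-\mathrm{Cov}(\hat X_{n+1})H^T\big(H\mathrm{Cov}(\hat X_{n+1})H^T+\Gamma\big)^{-1}(H\hat X_{n+1}+\eta_{n+1}-y_{n+1}^\dagger),$$ where $\xi_n\sim N(0,\Sigma)$ and $\eta_n\sim N(0,\Gamma)$ are i.i.d. sequences independent of each other and of $X_0$. The superscript in $\hat X_n^\mu$ indicates the law of $X_0$. The covariances satisfy $\hat C_{n+1}^\mu=\mathrm{Ricc}_d(\hat C_n^\mu)$ with $\mathrm{Ricc}_d(C):=ACA^T+\Sigma-ACH^T(HCH^T+\Gamma)^{-1}HCA^T$. The discrete Kalman gain is $K_d(C):=ACH^T(HCH^T+\Gamma)^{-1}$. The stable covariance matrix $\hat C_\infty$ is the unique positive semi-definite solution of $\mathrm{Ricc}_d(C)=C$; under the stated assumptions it is positive definite and is the limit of $\hat C_n^\mu$ as $n\to\infty$. *)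

theory Defs
  imports "HOL-Probability.Probability"
begin

section \<open>Matrices\<close>

definition pos_semidef :: "real^'n^'n \<Rightarrow> bool" where
  "pos_semidef S \<longleftrightarrow> transpose S = S \<and> (\<forall>v. 0 \<le> v \<bullet> (S *v v))"

definition pos_def :: "real^'n^'n \<Rightarrow> bool" where
  "pos_def S \<longleftrightarrow> transpose S = S \<and> (\<forall>v. v \<noteq> 0 \<longrightarrow> 0 < v \<bullet> (S *v v))"

text \<open>For positive semi-definite \<open>S\<close>, where such a root exists and is unique.\<close>

definition psd_sqrt :: "real^'n^'n \<Rightarrow> real^'n^'n" where
  "psd_sqrt S = (THE R. pos_semidef R \<and> R ** R = S)"

text \<open>Used for symmetric \<open>S\<close> only, whose eigenvalues are all real.\<close>

definition lambda_min :: "real^'n^'n \<Rightarrow> real" where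
  "lambda_min S = Min {l. \<exists>v. v \<noteq> 0 \<and> S *v v = l *\<^sub>R v}"

text \<open>For the spectral radius of a real matrix the complex eigenvalues count.\<close>

definition complex_eigenvalues :: "real^'n^'n \<Rightarrow> complex set" where
  "complex_eigenvalues B =
    {l. \<exists>v :: complex^'n. v \<noteq> 0 \<and> (\<chi> i j. complex_of_real (B $ i $ j)) *v v = l *s v}"

definition spec_radius :: "real^'n^'n \<Rightarrow> real" where
  "spec_radius B = Max (cmod ` complex_eigenvalues B)"

definition d_detectable :: "real^'d^'k \<Rightarrow> real^'d^'d \<Rightarrow> bool" where
  "d_detectable H A \<longleftrightarrow> (\<exists>K :: real^'k^'d. spec_radius (A - K ** H) < 1)"

section \<open>The Riccati map, the Kalman gain and the contraction rate\<close>

definition ricc_d ::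
    "real^'d^'d \<Rightarrow> real^'d^'k \<Rightarrow> real^'d^'d \<Rightarrow> real^'k^'k \<Rightarrow> real^'d^'d \<Rightarrow> real^'d^'d" where
  "ricc_d A H \<Sigma> \<Gamma> C =
    A ** C ** transpose A + \<Sigma>
      - A ** C ** transpose H ** matrix_inv (H ** C ** transpose H + \<Gamma>) ** H ** C ** transpose A"

definition gain_d ::
    "real^'d^'d \<Rightarrow> real^'d^'k \<Rightarrow> real^'k^'k \<Rightarrow> real^'d^'d \<Rightarrow> real^'k^'d" where
  "gain_d A H \<Gamma> C = A ** C ** transpose H ** matrix_inv (H ** C ** transpose H + \<Gamma>)"

definition is_stable_cov ::
    "real^'d^'d \<Rightarrow> real^'d^'k \<Rightarrow> real^'d^'d \<Rightarrow> real^'k^'k \<Rightarrow> real^'d^'d \<Rightarrow> bool" where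
  "is_stable_cov A H \<Sigma> \<Gamma> C \<longleftrightarrow> pos_semidef C \<and> ricc_d A H \<Sigma> \<Gamma> C = C"

definition stable_cov ::
    "real^'d^'d \<Rightarrow> real^'d^'k \<Rightarrow> real^'d^'d \<Rightarrow> real^'k^'k \<Rightarrow> real^'d^'d" where
  "stable_cov A H \<Sigma> \<Gamma> = (THE C. is_stable_cov A H \<Sigma> \<Gamma> C)"

definition beta_d ::
    "real^'d^'d \<Rightarrow> real^'d^'k \<Rightarrow> real^'d^'d \<Rightarrow> real^'k^'k \<Rightarrow> real^'d^'d \<Rightarrow> real" where
  "beta_d A H \<Sigma> \<Gamma> C = lambda_min
    (psd_sqrt C ** transpose H ** matrix_inv (H ** C ** transpose H + \<Gamma>) ** H ** psd_sqrt C
     + matrix_inv (psd_sqrt C)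
       ** matrix_inv (matrix_inv C + transpose H ** matrix_inv \<Gamma> ** H
                      + transpose A ** matrix_inv \<Sigma> ** A)
       ** matrix_inv (psd_sqrt C))"

section \<open>Probability measures on Euclidean space\<close>

definition P2 :: "(real^'n) measure set" where
  "P2 = {\<mu>. prob_space \<mu> \<and> sets \<mu> = sets borel \<and> integrable \<mu> (\<lambda>x. (norm x)\<^sup>2)}"

definition Cov :: "(real^'n) measure \<Rightarrow> real^'n^'n" where
  "Cov \<mu> = (\<chi> i j. \<integral>x. (x $ i - (\<integral>z. z $ i \<partial>\<mu>)) * (x $ j - (\<integral>z. z $ j \<partial>\<mu>)) \<partial>\<mu>)"

abbreviation law :: "'w measure \<Rightarrow> ('w \<Rightarrow> real^'n) \<Rightarrow> (real^'n) measure" where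
  "law M X \<equiv> distr M borel X"

definition couplings ::
    "(real^'n) measure \<Rightarrow> (real^'n) measure \<Rightarrow> ((real^'n) \<times> (real^'n)) measure set" where
  "couplings \<mu> \<nu> = {\<gamma>. prob_space \<gamma> \<and> sets \<gamma> = sets (borel \<Otimes>\<^sub>M borel) \<and>
     distr \<gamma> borel fst = \<mu> \<and> distr \<gamma> borel snd = \<nu>}"

definition weighted_norm_sq :: "real^'n^'n \<Rightarrow> real^'n \<Rightarrow> real" where
  "weighted_norm_sq S v = v \<bullet> (matrix_inv S *v v)"

text \<open>
  Real-valued, hence meant for \<open>\<mu>\<close> and \<open>\<nu>\<close> in \<open>P2\<close> and positive definite \<open>S\<close>: then the integrand is
  integrable with respect to every coupling, and the infimum is over a non-empty set that is
  bounded below.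
\<close>

definition W2 :: "(real^'n) measure \<Rightarrow> (real^'n) measure \<Rightarrow> real^'n^'n \<Rightarrow> real" where
  "W2 \<mu> \<nu> S = (INF \<gamma> \<in> couplings \<mu> \<nu>. sqrt (\<integral>(x, y). weighted_norm_sq S (x - y) \<partial>\<gamma>))"

text \<open>The Lebesgue density of \<open>N(0, S)\<close> for positive definite \<open>S\<close>.\<close>

definition gaussian_density :: "real^'n^'n \<Rightarrow> real^'n \<Rightarrow> ennreal" where
  "gaussian_density S x =
    ennreal (exp (- (x \<bullet> (matrix_inv S *v x)) / 2) / sqrt ((2 * pi) ^ CARD('n) * det S))"

section \<open>The mean-field ensemble Kalman filter\<close>

text \<open>
  The initial value, the signal noises and the observation noises have three different types, so
  their joint independence is expressed through the families of events they generate. The noises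
  are used from index \<open>1\<close> on.
\<close>

datatype driver = Initial | Signal nat | Observation nat

definition generated_events :: "'w measure \<Rightarrow> ('w \<Rightarrow> 'b::topological_space) \<Rightarrow> 'w set set" where
  "generated_events M Z = {Z -` B \<inter> space M | B. B \<in> sets borel}"

fun driver_events :: "'w measure \<Rightarrow> ('w \<Rightarrow> real^'d) \<Rightarrow> (nat \<Rightarrow> 'w \<Rightarrow> real^'d) \<Rightarrow>
    (nat \<Rightarrow> 'w \<Rightarrow> real^'k) \<Rightarrow> driver \<Rightarrow> 'w set set" where
  "driver_events M X0 \<xi> \<eta> Initial = generated_events M X0"
| "driver_events M X0 \<xi> \<eta> (Signal n) = generated_events M (\<xi> (Suc n))"
| "driver_events M X0 \<xi> \<eta> (Observation n) = generated_events M (\<eta> (Suc n))"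

text \<open>
  \<open>Xh\<close> is the forecast process and is used from index \<open>1\<close> on; \<open>X\<close> is the analysis process.
\<close>

locale mfenkf = prob_space M
  for A :: "real^'d^'d" and H :: "real^'d^'k" and \<Sigma> :: "real^'d^'d" and \<Gamma> :: "real^'k^'k"
    and \<mu> :: "(real^'d) measure" and y :: "nat \<Rightarrow> real^'k"
    and M :: "'w measure"
    and \<xi> :: "nat \<Rightarrow> 'w \<Rightarrow> real^'d" and \<eta> :: "nat \<Rightarrow> 'w \<Rightarrow> real^'k"
    and X :: "nat \<Rightarrow> 'w \<Rightarrow> real^'d" and Xh :: "nat \<Rightarrow> 'w \<Rightarrow> real^'d" +
  assumes init_measurable: "X 0 \<in> borel_measurable M"
    and init_law: "law M (X 0) = \<mu>"
    and signal_noise: "n \<ge> 1 \<Longrightarrow> distributed M lborel (\<xi> n) (gaussian_density \<Sigma>)"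
    and observation_noise: "n \<ge> 1 \<Longrightarrow> distributed M lborel (\<eta> n) (gaussian_density \<Gamma>)"
    and independent: "indep_sets (driver_events M (X 0) \<xi> \<eta>) UNIV"
    and forecast: "\<omega> \<in> space M \<Longrightarrow> Xh (Suc n) \<omega> = A *v X n \<omega> + \<xi> (Suc n) \<omega>"
    and analysis: "\<omega> \<in> space M \<Longrightarrow> X (Suc n) \<omega> = Xh (Suc n) \<omega>
      - (Cov (law M (Xh (Suc n))) ** transpose H
         ** matrix_inv (H ** Cov (law M (Xh (Suc n))) ** transpose H + \<Gamma>))
        *v (H *v Xh (Suc n) \<omega> + \<eta> (Suc n) \<omega> - y (Suc n))"

end

theory Submission
  imports Defs "HOL-Complex_Analysis.Laurent_Convergence" "HOL-Real_Asymp.Real_Asymp"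
begin

text \<open>
  Conditionally on its past, the forecast moves by an affine map with linear part
  \<open>B = A - K H\<close>, where the gain \<open>K\<close> depends only on the forecast covariance \<open>C\<close>, plus
  independent Gaussian noise with covariance \<open>K \<Gamma> K\<^sup>T + \<Sigma>\<close>. Equal covariances therefore stay
  equal and follow the Riccati recursion, and coupling two copies synchronously reduces the
  contraction to \<open>B\<^sup>T Ricc(C)\<^sup>-\<^sup>1 B \<le> (1 - \<beta>(C)) C\<^sup>-\<^sup>1\<close>. With \<open>R = C\<^sup>1\<^sup>/\<^sup>2\<close>, Woodbury's identity
  shows that the matrix whose smallest eigenvalue is \<open>\<beta>(C)\<close> equals
  \<open>I - R B\<^sup>T Ricc(C)\<^sup>-\<^sup>1 B R\<close>, so the rate is exact.

  Detectability bounds the Riccati iterates, since the fixed gain \<open>K\<close> for which \<open>A - K H\<close> is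
  stable is suboptimal at every step; a bound \<open>s \<le> C \<le> c\<close> bounds \<open>\<beta>(C)\<close> away from 0.
  From \<open>Ricc(C) - Ricc(D) = B\<^sub>C (C - D) B\<^sub>D\<^sup>T\<close> and \<open>B\<^sub>C C B\<^sub>C\<^sup>T \<le> (1 - s / c) Ricc(C)\<close> the
  difference of two bounded Riccati orbits decays geometrically, which gives both existence and
  uniqueness of the stable covariance.
\<close>

unbundle no Formal_Power_Series.fps_syntax

section \<open>Symmetric and positive definite matrices\<close>

text \<open>Only laws of forecasts are compared, so the two filters may live on different
  probability spaces. Equal covariances give both the same closed loop, gain and noise law, and the
  observation enters through a common shift; shift and shared noise cancel in the difference of two
  coupled copies. Of the Gaussian noises only second moments are used, and these are extracted from
  the normalisation of the density, which the existence of the noises guarantees. Three points shape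
  the proof. A spectral radius below 1 gives no norm bound below 1 for a single step, so the decay
  of powers comes from analyticity of the resolvent. The identity for the difference of two Riccati
  images has different closed loops on its two sides and is not a congruence; the induction
  therefore estimates bilinear forms, weighting each argument by its own covariance. The infimum in
  \<open>W2\<close> is never assumed to be attained: every coupling is moved one step and the
  infimum is taken afterwards.\<close>

lemma inner_matrix_vector_mult:
  fixes A :: "real^'n^'m"
  shows "x \<bullet> (A *v y) = (transpose A *v x) \<bullet> y"
  by (simp add: dot_lmul_matrix)

lemma matrix_diff_ldistrib: "A ** (B - C) = A ** B - A ** C"
  for A :: "'a::ring_1^'m^'k" and B C :: "'a^'n^'m"
  by (simp add: matrix_matrix_mult_def vec_eq_iff algebra_simps sum_subtractf)

lemma matrix_diff_rdistrib: "(B - C) ** A = B ** A - C ** A"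
  for A :: "'a::ring_1^'m^'k" and B C :: "'a^'k^'n"
  by (simp add: matrix_matrix_mult_def vec_eq_iff algebra_simps sum_subtractf)

lemma matrix_add_rdistrib: "(B + C) ** A = B ** A + C ** A"
  for A :: "'a::ring_1^'m^'k" and B C :: "'a^'k^'n"
  by (simp add: matrix_matrix_mult_def vec_eq_iff algebra_simps sum.distrib)

lemma transpose_add: "transpose (A + B) = transpose A + transpose B"
  by (simp add: transpose_def vec_eq_iff)

lemma transpose_diff: "transpose (A - B) = transpose A - transpose B"
  by (simp add: transpose_def vec_eq_iff)

lemmas matrix_ring_simps = matrix_add_ldistrib matrix_add_rdistrib
  matrix_diff_ldistrib matrix_diff_rdistrib matrix_mul_assoc

lemma matrix_inv_right: "invertible A \<Longrightarrow> A ** matrix_inv A = mat 1"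
  and matrix_inv_left: "invertible A \<Longrightarrow> matrix_inv A ** A = mat 1"
  for A :: "real^'n^'n"
  unfolding invertible_def matrix_inv_def
  by (metis (mono_tags, lifting) someI_ex)+

lemma matrix_inv_unique:
  fixes A B :: "real^'n^'n"
  assumes "A ** B = mat 1"
  shows "invertible A" "matrix_inv A = B"
proof -
  show inv: "invertible A"
    using assms invertible_right_inverse by blast
  show "matrix_inv A = B"
    by (metis assms inv matrix_inv_left matrix_mul_assoc matrix_mul_lid matrix_mul_rid)
qed

lemma invertible_matrix_inv: "invertible A \<Longrightarrow> invertible (matrix_inv A)"
  for A :: "real^'n^'n"
  by (rule matrix_inv_unique(1)[OF matrix_inv_left])

lemma matrix_inv_matrix_inv: "invertible A \<Longrightarrow> matrix_inv (matrix_inv A) = A"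
  for A :: "real^'n^'n"
  by (rule matrix_inv_unique(2)[OF matrix_inv_left])

lemma transpose_matrix_inv:
  fixes A :: "real^'n^'n"
  assumes "invertible A"
  shows "transpose (matrix_inv A) = matrix_inv (transpose A)"
proof -
  have "transpose A ** transpose (matrix_inv A) = mat 1"
    using assms by (simp add: matrix_transpose_mul[symmetric] matrix_inv_left)
  then show ?thesis by (rule matrix_inv_unique(2)[symmetric])
qed

lemma matrix_vector_inv: "invertible A \<Longrightarrow> A *v (matrix_inv A *v x) = x"
  "invertible A \<Longrightarrow> matrix_inv A *v (A *v x) = x"
  for A :: "real^'n^'n"
  by (simp_all add: matrix_vector_mul_assoc matrix_inv_left matrix_inv_right)

lemma invertible_ker: "(\<forall>x. A *v x = 0 \<longrightarrow> x = 0) \<Longrightarrow> invertible A"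
  for A :: "real^'n^'n"
  using invertible_left_inverse matrix_left_invertible_ker by blast

text \<open>Polarisation. It lets covariance matrices be identified by testing one direction at a
  time.\<close>

lemma symmetric_eqI:
  fixes A B :: "real^'n^'n"
  assumes "transpose A = A" "transpose B = B" "\<And>v. v \<bullet> (A *v v) = v \<bullet> (B *v v)"
  shows "A = B"
proof -
  let ?D = "A - B"
  have sym: "transpose ?D = ?D" using assms by (simp add: transpose_diff)
  have q: "v \<bullet> (?D *v v) = 0" for v
    using assms(3)[of v] by (simp add: algebra_simps)
  have "u \<bullet> (?D *v v) = 0" for u v
  proof -
    have "v \<bullet> (?D *v u) = u \<bullet> (?D *v v)"
      using inner_matrix_vector_mult[of v ?D u] sym by (metis inner_commute)
    moreover have "(u + v) \<bullet> (?D *v (u + v)) = 0" by (rule q)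
    ultimately show ?thesis
      using q[of u] q[of v]
      by (simp add: matrix_vector_right_distrib inner_add_left inner_add_right)
  qed
  then have "?D *v v = 0" for v
    by (metis inner_eq_zero_iff)
  then have "A *v v = B *v v" for v by (simp add: algebra_simps)
  then show ?thesis by (simp add: matrix_eq)
qed

section \<open>Positive definite matrices and bounds for quadratic forms\<close>

lemma pos_def_imp_pos_semidef: "pos_def S \<Longrightarrow> pos_semidef S"
  unfolding pos_def_def pos_semidef_def by (metis inner_zero_left less_eq_real_def)

lemma pos_defD: "pos_def S \<Longrightarrow> transpose S = S" "pos_def S \<Longrightarrow> v \<noteq> 0 \<Longrightarrow> 0 < v \<bullet> (S *v v)"
  by (auto simp: pos_def_def)

lemma pos_semidefD: "pos_semidef S \<Longrightarrow> transpose S = S" "pos_semidef S \<Longrightarrow> 0 \<le> v \<bullet> (S *v v)"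
  by (auto simp: pos_semidef_def)

lemma pos_def_invertible: "pos_def S \<Longrightarrow> invertible S"
  by (rule invertible_ker) (metis inner_zero_right less_irrefl pos_defD(2))

lemma pos_def_matrix_inv:
  assumes "pos_def S" shows "pos_def (matrix_inv S)"
proof -
  have inv: "invertible S" by (rule pos_def_invertible[OF assms])
  have "0 < v \<bullet> (matrix_inv S *v v)" if "v \<noteq> 0" for v
  proof -
    let ?w = "matrix_inv S *v v"
    have v: "S *v ?w = v" using inv by (rule matrix_vector_inv)
    then have "?w \<noteq> 0" using that by auto
    then have "0 < ?w \<bullet> (S *v ?w)" by (rule pos_defD(2)[OF assms])
    then show ?thesis by (simp only: v inner_commute)
  qed
  then show ?thesis
    unfolding pos_def_def using transpose_matrix_inv[OF inv] pos_defD(1)[OF assms] by auto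
qed

lemma pos_def_add: "pos_def S \<Longrightarrow> pos_semidef T \<Longrightarrow> pos_def (S + T)"
  unfolding pos_def_def pos_semidef_def
  by (simp add: transpose_add matrix_vector_mult_add_rdistrib inner_add_right add_pos_nonneg)

lemma pos_semidef_add: "pos_semidef S \<Longrightarrow> pos_semidef T \<Longrightarrow> pos_semidef (S + T)"
  unfolding pos_semidef_def
  by (simp add: transpose_add matrix_vector_mult_add_rdistrib inner_add_right)

lemma congruence_quadratic:
  fixes B :: "real^'m^'n" and S :: "real^'m^'m"
  shows "v \<bullet> ((B ** S ** transpose B) *v v) = (transpose B *v v) \<bullet> (S *v (transpose B *v v))"
proof -
  have "(B ** S ** transpose B) *v v = B *v (S *v (transpose B *v v))"
    by (simp add: matrix_vector_mul_assoc matrix_mul_assoc del: transpose_matrix_vector)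
  then show ?thesis by (simp only: inner_matrix_vector_mult[of v B])
qed

lemma pos_semidef_congruence:
  fixes B :: "real^'m^'n"
  assumes "pos_semidef S" shows "pos_semidef (B ** S ** transpose B)"
  using assms unfolding pos_semidef_def congruence_quadratic
  by (simp add: matrix_transpose_mul matrix_mul_assoc del: transpose_matrix_vector)

lemma pos_semidef_congruence':
  fixes B :: "real^'n^'m"
  assumes "pos_semidef S" shows "pos_semidef (transpose B ** S ** B)"
  using pos_semidef_congruence[OF assms, of "transpose B"] by simp

lemma pos_def_congruence:
  fixes B :: "real^'n^'n"
  assumes "pos_def S" "invertible B" shows "pos_def (B ** S ** transpose B)"
proof -
  have "transpose B *v v \<noteq> 0" if "v \<noteq> 0" for v
    using that matrix_vector_inv(2)[of "transpose B" v] transpose_invertible[OF assms(2)]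
    by (metis matrix_vector_mult_0_right)
  then show ?thesis
    using assms(1) unfolding pos_def_def congruence_quadratic
    by (simp add: matrix_transpose_mul matrix_mul_assoc del: transpose_matrix_vector)
qed

lemma matrix_inv_quadratic_ge:
  fixes T :: "real^'n^'n"
  assumes "pos_def T" and le: "\<And>v. v \<bullet> (T *v v) \<le> m * (norm v)\<^sup>2" and "0 < m"
  shows "(norm u)\<^sup>2 / m \<le> u \<bullet> (matrix_inv T *v u)"
proof -
  define w where "w = matrix_inv T *v u"
  have u: "T *v w = u"
    unfolding w_def by (rule matrix_vector_inv[OF pos_def_invertible[OF assms(1)]])
  have wTu: "w \<bullet> (T *v u) = (norm u)\<^sup>2"
    using inner_matrix_vector_mult[of w T u] pos_defD(1)[OF assms(1)] u
    by (simp add: power2_norm_eq_inner del: transpose_matrix_vector)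
  \<comment> \<open>The subtracted vector is what \<open>w\<close> would be if \<open>T\<close> were
    \<open>m\<close> times the identity, the extremal case.\<close>
  have "0 \<le> (w - (1/m) *\<^sub>R u) \<bullet> (T *v (w - (1/m) *\<^sub>R u))"
    using pos_semidefD(2)[OF pos_def_imp_pos_semidef[OF assms(1)]] .
  also have "\<dots> = w \<bullet> u - 2 * (norm u)\<^sup>2 / m + (u \<bullet> (T *v u)) / m\<^sup>2"
    by (simp add: matrix_vector_mult_diff_distrib matrix_vector_mult_scaleR u inner_diff_left
        inner_diff_right wTu power2_norm_eq_inner[symmetric])
      (simp add: power2_eq_square diff_divide_distrib)
  also have "(u \<bullet> (T *v u)) / m\<^sup>2 \<le> (m * (norm u)\<^sup>2) / m\<^sup>2"
    using le by (simp add: divide_right_mono)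
  also have "\<dots> = (norm u)\<^sup>2 / m"
    using \<open>0 < m\<close> by (simp add: power2_eq_square)
  finally show ?thesis by (simp add: w_def inner_commute)
qed

lemma matrix_inv_quadratic_le:
  fixes T :: "real^'n^'n"
  assumes "pos_def T" and ge: "\<And>v. s * (norm v)\<^sup>2 \<le> v \<bullet> (T *v v)" and "0 < s"
  shows "u \<bullet> (matrix_inv T *v u) \<le> (norm u)\<^sup>2 / s"
proof -
  define w where "w = matrix_inv T *v u"
  have u: "T *v w = u"
    unfolding w_def by (rule matrix_vector_inv[OF pos_def_invertible[OF assms(1)]])
  have "s * (norm w)\<^sup>2 \<le> norm w * norm u"
    using ge[of w] u norm_cauchy_schwarz[of w u] by simp
  then have "s * norm w \<le> norm u"
    by (cases "norm w = 0") (auto simp: power2_eq_square mult_ac)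
  then have "norm w \<le> norm u / s" using \<open>0 < s\<close> by (simp add: field_simps)
  then have "norm u * norm w \<le> norm u * (norm u / s)" by (rule mult_left_mono) (rule norm_ge_zero)
  with norm_cauchy_schwarz[of u w] have "u \<bullet> w \<le> norm u * (norm u / s)" by (rule order_trans)
  then show ?thesis by (simp add: w_def power2_eq_square)
qed

lemma quadratic_upper_bound:
  fixes S :: "real^'n^'n"
  obtains c where "0 < c" "\<And>v. \<bar>v \<bullet> (S *v v)\<bar> \<le> c * (norm v)\<^sup>2"
proof -
  obtain c where c: "0 < c" "\<And>v. norm (S *v v) \<le> norm v * c"
    using bounded_linear.pos_bounded[OF matrix_vector_mul_bounded_linear[of S]] by blast
  have "\<bar>v \<bullet> (S *v v)\<bar> \<le> c * (norm v)\<^sup>2" for v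
  proof -
    have "\<bar>v \<bullet> (S *v v)\<bar> \<le> norm v * norm (S *v v)" by (rule Cauchy_Schwarz_ineq2)
    also have "\<dots> \<le> norm v * (norm v * c)" by (intro mult_left_mono c) simp
    finally show ?thesis by (simp add: power2_eq_square mult_ac)
  qed
  with c(1) show ?thesis by (rule that)
qed

text \<open>A minimiser of the quadratic form on the unit sphere of \<open>U\<close> is an
  eigenvector. An invariant subspace is allowed so that an eigenbasis can be extended inside an
  orthogonal complement.\<close>

lemma symmetric_eigenvector:
  fixes S :: "real^'n^'n"
  assumes sym: "transpose S = S" and U: "subspace U" "U \<noteq> {0}"
    and inv: "\<And>v. v \<in> U \<Longrightarrow> S *v v \<in> U"
  obtains u m where "u \<in> U" "norm u = 1" "S *v u = m *\<^sub>R u"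
    "\<And>v. v \<in> U \<Longrightarrow> m * (norm v)\<^sup>2 \<le> v \<bullet> (S *v v)"
proof -
  let ?K = "U \<inter> sphere 0 1"
  have "compact ?K"
    by (intro closed_Int_compact closed_subspace U compact_sphere)
  moreover obtain z where z: "z \<in> U" "z \<noteq> 0"
    using U subspace_0 by blast
  then have "(1 / norm z) *\<^sub>R z \<in> ?K"
    using U(1) by (simp add: subspace_scale)
  moreover have "continuous_on ?K (\<lambda>v. v \<bullet> (S *v v))"
    by (intro continuous_intros linear_continuous_on matrix_vector_mul_bounded_linear)
  ultimately obtain u where u: "u \<in> ?K" and
    min: "\<And>v. v \<in> ?K \<Longrightarrow> u \<bullet> (S *v u) \<le> v \<bullet> (S *v v)"
    using continuous_attains_inf[of ?K] by blast
  define m where "m = u \<bullet> (S *v u)"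
  have nu: "norm u = 1" "u \<in> U" using u by auto
  have q: "m * (norm v)\<^sup>2 \<le> v \<bullet> (S *v v)" if "v \<in> U" for v
  proof (cases "v = 0")
    case False
    have "(1 / norm v) *\<^sub>R v \<in> ?K"
      using U(1) that False by (simp add: subspace_scale)
    from min[OF this] show ?thesis
      using False by (simp add: m_def matrix_vector_mult_scaleR field_simps power2_eq_square)
  qed simp
  define w where "w = S *v u - m *\<^sub>R u"
  have wU: "w \<in> U" unfolding w_def using inv nu U(1) by (simp add: subspace_diff subspace_scale)
  have uSw: "u \<bullet> (S *v w) = w \<bullet> (S *v u)"
    using inner_matrix_vector_mult[of u S w] sym by (metis inner_commute)
  have wn: "w \<bullet> (S *v u) - m * (u \<bullet> w) = (norm w)\<^sup>2"
    by (simp add: w_def power2_norm_eq_inner inner_diff_left inner_diff_right inner_commute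
        right_diff_distrib)
  \<comment> \<open>The first variation of the Rayleigh quotient at its minimiser \<open>u\<close> in the direction \<open>-w\<close>.\<close>
  have "w = 0"
  proof (rule ccontr)
    assume "w \<noteq> 0"
    define k where "k = w \<bullet> (S *v w) - m * (norm w)\<^sup>2"
    have le: "2 * t * (norm w)\<^sup>2 \<le> t\<^sup>2 * k" for t
    proof -
      have "u - t *\<^sub>R w \<in> U" using wU nu U(1) by (simp add: subspace_diff subspace_scale)
      note q[OF this]
      moreover have "(u - t *\<^sub>R w) \<bullet> (S *v (u - t *\<^sub>R w))
          = m - 2 * t * (w \<bullet> (S *v u)) + t\<^sup>2 * (w \<bullet> (S *v w))"
        by (simp add: matrix_vector_mult_diff_distrib matrix_vector_mult_scaleR inner_diff_left
            inner_diff_right uSw m_def power2_eq_square right_diff_distrib)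
      moreover have "(norm (u - t *\<^sub>R w))\<^sup>2 = 1 - 2 * t * (u \<bullet> w) + t\<^sup>2 * (norm w)\<^sup>2"
        using nu unfolding power2_norm_eq_inner
        by (simp add: inner_diff_left inner_diff_right inner_commute power2_eq_square norm_eq_1
            right_diff_distrib)
      ultimately have "m * (1 - 2 * t * (u \<bullet> w) + t\<^sup>2 * (norm w)\<^sup>2)
          \<le> m - 2 * t * (w \<bullet> (S *v u)) + t\<^sup>2 * (w \<bullet> (S *v w))" by metis
      then have "2 * t * (w \<bullet> (S *v u) - m * (u \<bullet> w)) \<le> t\<^sup>2 * k"
        by (simp add: k_def algebra_simps)
      then show ?thesis by (simp add: wn)
    qed
    have p: "0 < (norm w)\<^sup>2" using \<open>w \<noteq> 0\<close> by simp
    have "2 * (norm w)\<^sup>2 \<le> k" using le[of 1] by simp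
    with p have "0 < k" by linarith
    \<comment> \<open>This \<open>t\<close> maximises
      \<open>2 * t * (norm w)\<^sup>2 - t\<^sup>2 * k\<close>, where the violation is
      largest.\<close>
    have "2 * ((norm w)\<^sup>2 / k) * (norm w)\<^sup>2 \<le> ((norm w)\<^sup>2 / k)\<^sup>2 * k" by (rule le)
    then have "2 * ((norm w)\<^sup>2)\<^sup>2 / k \<le> ((norm w)\<^sup>2)\<^sup>2 / k"
      using \<open>0 < k\<close> by (simp add: power2_eq_square)
    then have "2 * ((norm w)\<^sup>2)\<^sup>2 \<le> ((norm w)\<^sup>2)\<^sup>2"
      using \<open>0 < k\<close> by (simp add: divide_le_cancel)
    then show False using p by simp
  qed
  then have "S *v u = m *\<^sub>R u" by (simp add: w_def)
  with that nu q show ?thesis by blast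
qed

lemma symmetric_eigenvectors_orthogonal:
  fixes S :: "real^'n^'n"
  assumes "transpose S = S" "S *v u = a *\<^sub>R u" "S *v v = b *\<^sub>R v" "a \<noteq> b"
  shows "u \<bullet> v = 0"
proof -
  have "a * (u \<bullet> v) = (S *v u) \<bullet> v" using assms by simp
  also have "\<dots> = u \<bullet> (S *v v)" using inner_matrix_vector_mult[of u S v] assms(1) by simp
  also have "\<dots> = b * (u \<bullet> v)" using assms by simp
  finally show ?thesis using assms(4) by simp
qed

text \<open>Eigenvectors of distinct eigenvalues are orthogonal, hence independent. Finiteness is
  what makes the \<open>Min\<close> in \<open>lambda_min\<close> a true minimum.\<close>

lemma finite_symmetric_eigenvalues:
  fixes S :: "real^'n^'n"
  assumes "transpose S = S"
  shows "finite {l. \<exists>v. v \<noteq> 0 \<and> S *v v = l *\<^sub>R v}" (is "finite ?E")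
proof -
  define f where "f l = (SOME v. v \<noteq> 0 \<and> S *v v = l *\<^sub>R v)" for l
  have f: "f l \<noteq> 0" "S *v f l = l *\<^sub>R f l" if "l \<in> ?E" for l
    using that someI_ex[of "\<lambda>v. v \<noteq> 0 \<and> S *v v = l *\<^sub>R v"] unfolding f_def by auto
  have orth: "f a \<bullet> f b = 0" if "a \<in> ?E" "b \<in> ?E" "a \<noteq> b" for a b
    using symmetric_eigenvectors_orthogonal[OF assms f(2)[OF that(1)] f(2)[OF that(2)] that(3)] .
  have "inj_on f ?E"
  proof (rule inj_onI, rule ccontr)
    fix a b assume "a \<in> ?E" "b \<in> ?E" "f a = f b" "a \<noteq> b"
    with orth[of a b] f(1)[of a] show False by simp
  qed
  moreover have "pairwise orthogonal (f ` ?E)" "0 \<notin> f ` ?E"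
    using orth f(1) by (auto simp: pairwise_def orthogonal_def, metis)
  then have "independent (f ` ?E)" by (rule pairwise_orthogonal_independent)
  then have "finite (f ` ?E)" by (rule independent_imp_finite)
  ultimately show ?thesis using finite_imageD by blast
qed

text \<open>The Rayleigh minimum is itself an eigenvalue, so the smallest eigenvalue lies below it
  and bounds the quadratic form.\<close>

lemma lambda_min_symmetric:
  fixes S :: "real^'n^'n"
  assumes "transpose S = S"
  shows "\<exists>v. v \<noteq> 0 \<and> S *v v = lambda_min S *\<^sub>R v"
    and "lambda_min S * (norm v)\<^sup>2 \<le> v \<bullet> (S *v v)"
proof -
  let ?E = "{l. \<exists>v. v \<noteq> 0 \<and> S *v v = l *\<^sub>R v}"
  have "axis undefined 1 \<noteq> (0::real^'n)" by (simp add: axis_eq_0_iff)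
  then have "(UNIV :: (real^'n) set) \<noteq> {0}" by blast
  from symmetric_eigenvector[OF assms subspace_UNIV this]
  obtain u m where u: "norm u = 1" "S *v u = m *\<^sub>R u" "\<And>v. m * (norm v)\<^sup>2 \<le> v \<bullet> (S *v v)"
    by (metis UNIV_I)
  then have mE: "m \<in> ?E" by (auto intro!: exI[of _ u])
  have fin: "finite ?E" by (rule finite_symmetric_eigenvalues[OF assms])
  have "Min ?E \<in> ?E" using Min_in fin mE by blast
  then show "\<exists>v. v \<noteq> 0 \<and> S *v v = lambda_min S *\<^sub>R v" by (simp add: lambda_min_def)
  have "lambda_min S \<le> m" unfolding lambda_min_def using fin mE by simp
  then show "lambda_min S * (norm v)\<^sup>2 \<le> v \<bullet> (S *v v)"
    using u(3)[of v] by (meson mult_right_mono order_trans zero_le_power2)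
qed

lemma lambda_min_ge:
  fixes S :: "real^'n^'n"
  assumes "transpose S = S" "\<And>v. a * (norm v)\<^sup>2 \<le> v \<bullet> (S *v v)"
  shows "a \<le> lambda_min S"
proof -
  obtain v where v: "v \<noteq> 0" "S *v v = lambda_min S *\<^sub>R v"
    using lambda_min_symmetric(1)[OF assms(1)] by blast
  then have "v \<bullet> (S *v v) = lambda_min S * (norm v)\<^sup>2" by (simp add: power2_norm_eq_inner)
  with assms(2)[of v] v(1) show ?thesis by (simp add: mult_le_cancel_right)
qed

lemma lambda_min_pos:
  assumes "pos_def S" shows "0 < lambda_min S"
proof -
  obtain v where v: "v \<noteq> 0" "S *v v = lambda_min S *\<^sub>R v"
    using lambda_min_symmetric(1)[OF pos_defD(1)[OF assms]] by blast
  then have "0 < lambda_min S * (v \<bullet> v)" using pos_defD(2)[OF assms, of v] by simp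
  moreover have "0 < v \<bullet> v" using v(1) by simp
  ultimately show ?thesis by (simp only: zero_less_mult_pos2)
qed

lemma pos_def_lower_bound:
  assumes "pos_def S"
  obtains s where "0 < s" "\<And>v. s * (norm v)\<^sup>2 \<le> v \<bullet> (S *v v)"
  using that[OF lambda_min_pos[OF assms] lambda_min_symmetric(2)[OF pos_defD(1)[OF assms]]] .

text \<open>Take an orthonormal set of eigenvectors of largest cardinality. If it did not span, its
  orthogonal complement would be a nonzero invariant subspace and would contribute a further
  eigenvector.\<close>

lemma orthonormal_eigenbasis:
  fixes S :: "real^'n^'n"
  assumes sym: "transpose S = S"
  obtains B l where "finite B" "pairwise orthogonal B" "\<And>b. b \<in> B \<Longrightarrow> norm b = 1"
    "span B = UNIV" "\<And>b. b \<in> B \<Longrightarrow> S *v b = l b *\<^sub>R b"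
proof -
  define Q where "Q B \<longleftrightarrow> pairwise orthogonal B \<and> (\<forall>b\<in>B. norm b = 1 \<and> (\<exists>l. S *v b = l *\<^sub>R b))"
    for B
  have fin: "finite B \<and> card B \<le> DIM(real^'n)" if "Q B" for B
  proof -
    have "independent B"
      using that by (intro pairwise_orthogonal_independent) (auto simp: Q_def)
    then show ?thesis using independent_bound[of B] by simp
  qed
  have "Q {}" by (simp add: Q_def)
  then obtain B where B: "Q B" and max: "\<And>B'. Q B' \<Longrightarrow> card B' \<le> card B"
    using ex_has_greatest_nat[of Q "{}" card "Suc (DIM(real^'n))"] fin by (metis le_imp_less_Suc)
  have "span B = UNIV"
  proof (rule ccontr)
    let ?U = "orthogonal_comp (span B)"
    assume "span B \<noteq> UNIV"
    moreover have "span B = UNIV" if "?U = {0}"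
      using orthogonal_comp_self[OF subspace_span[of B]] unfolding that
      by (simp add: orthogonal_comp_null)
    ultimately have "?U \<noteq> {0}" by blast
    moreover have "S *v u \<in> ?U" if "u \<in> ?U" for u
    proof -
      have "x \<bullet> (S *v u) = 0" if "x \<in> span B" for x
        using that
      proof (induction rule: span_induct)
        case base
        show ?case using subspace_hyperplane[of "S *v u"] by (simp only: inner_commute)
      next
        case (step x)
        then obtain l where l: "S *v x = l *\<^sub>R x" using B by (auto simp: Q_def)
        have "x \<bullet> u = 0"
          using \<open>u \<in> ?U\<close> step span_base[of x B]
          by (auto simp: orthogonal_comp_def orthogonal_def inner_commute)
        then show ?case
          using inner_matrix_vector_mult[of x S u] sym l by simp
      qed
      then show ?thesis by (auto simp: orthogonal_comp_def orthogonal_def)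
    qed
    ultimately obtain u m where u: "u \<in> ?U" "norm u = 1" "S *v u = m *\<^sub>R u"
      by (rule symmetric_eigenvector[OF sym subspace_orthogonal_comp])
    have orth: "orthogonal b u" "orthogonal u b" if "b \<in> B" for b
      using u(1) span_base[OF that] by (auto simp: orthogonal_comp_def orthogonal_commute)
    have "u \<notin> B" using orth(1)[of u] u(2) by (auto simp: orthogonal_def norm_eq_1)
    moreover have "Q (insert u B)"
      using B orth u by (auto simp: Q_def pairwise_insert)
    ultimately show False using max[of "insert u B"] fin[OF B] by simp
  qed
  moreover obtain l where "\<And>b. b \<in> B \<Longrightarrow> S *v b = l b *\<^sub>R b"
    using B unfolding Q_def by metis
  ultimately show ?thesis using that[of B l] fin[OF B] B by (auto simp: Q_def)
qed

section \<open>Square roots of positive semidefinite matrices\<close>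

lemma symmetricI:
  fixes R :: "real^'n^'n"
  assumes "\<And>x y. x \<bullet> (R *v y) = (R *v x) \<bullet> y"
  shows "transpose R = R"
proof -
  have "(transpose R *v x) \<bullet> y = (R *v x) \<bullet> y" for x y
    using assms[of x y] inner_matrix_vector_mult[of x R y] by simp
  then have "transpose R *v x = R *v x" for x by (metis vector_eq_rdot)
  then show ?thesis by (simp only: matrix_eq) blast
qed

lemma pos_semidef_root_exists:
  fixes S :: "real^'n^'n"
  assumes "pos_semidef S"
  obtains R where "pos_semidef R" "R ** R = S"
proof -
  obtain B l where B: "finite B" "pairwise orthogonal B" "\<And>b. b \<in> B \<Longrightarrow> norm b = 1"
    "span B = UNIV" and l: "\<And>b. b \<in> B \<Longrightarrow> S *v b = l b *\<^sub>R b"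
    using orthonormal_eigenbasis[OF pos_semidefD(1)[OF assms]] by metis
  have l0: "0 \<le> l b" if "b \<in> B" for b
    using pos_semidefD(2)[OF assms, of b] l[OF that] B(3)[OF that] by (simp add: norm_eq_1)
  \<comment> \<open>The root acts on the eigenbasis of \<open>S\<close> by the square roots of the
    eigenvalues.\<close>
  define f where "f x = (\<Sum>b\<in>B. (sqrt (l b) * (b \<bullet> x)) *\<^sub>R b)" for x
  have "linear f"
    by (rule linearI) (simp_all add: f_def inner_add_right algebra_simps sum.distrib scaleR_sum_right)
  then have R: "matrix f *v x = f x" for x by (simp add: matrix_works)
  have inner_f: "x \<bullet> f y = (\<Sum>b\<in>B. sqrt (l b) * (b \<bullet> x) * (b \<bullet> y))" for x y
    by (simp add: f_def inner_sum_right inner_commute mult_ac)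
  have sym: "transpose (matrix f) = matrix f"
    by (rule symmetricI) (simp add: R inner_f inner_commute[of "f _"] mult_ac)
  have psd: "pos_semidef (matrix f)"
    unfolding pos_semidef_def using sym l0
    by (auto simp: R inner_f mult.assoc intro!: sum_nonneg mult_nonneg_nonneg[OF _ zero_le_square])
  have b_f: "b \<bullet> f x = sqrt (l b) * (b \<bullet> x)" if "b \<in> B" for b x
  proof -
    have "b' \<bullet> b = (if b' = b then 1 else 0)" if "b' \<in> B" for b'
      using B(2) \<open>b \<in> B\<close> that B(3)[OF that]
      by (auto simp: pairwise_def orthogonal_def norm_eq_1)
    then have "b \<bullet> f x = (\<Sum>b'\<in>B. if b' = b then sqrt (l b) * (b \<bullet> x) else 0)"
      unfolding inner_f by (intro sum.cong) auto
    then show ?thesis using that B(1) by simp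
  qed
  have "f (f x) = S *v x" for x
  proof -
    have "x = (\<Sum>b\<in>B. (x \<bullet> b) *\<^sub>R b)"
      using orthonormal_basis_expand[OF B(2,3) _ B(1), of x] B(4) by simp
    then have "S *v x = (\<Sum>b\<in>B. S *v ((x \<bullet> b) *\<^sub>R b))"
      by (metis matrix_vector_mul_linear linear_sum)
    also have "\<dots> = (\<Sum>b\<in>B. (l b * (b \<bullet> x)) *\<^sub>R b)"
      by (intro sum.cong) (simp_all add: matrix_vector_mult_scaleR l inner_commute mult.commute)
    also have "\<dots> = f (f x)"
      unfolding f_def[of "f x"] using l0 by (intro sum.cong) (simp_all add: b_f mult.assoc[symmetric])
    finally show ?thesis by simp
  qed
  then have "matrix f ** matrix f = S"
    by (simp add: matrix_eq matrix_vector_mul_assoc[symmetric] R)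
  with psd that show ?thesis by blast
qed

text \<open>On an eigenvector \<open>b\<close> of \<open>R\<close> with eigenvalue
  \<open>r b\<close>, the defect \<open>w = T b - r b\<close> satisfies \<open>T w = - r w\<close>.
  Positivity of \<open>T\<close> forces \<open>w = 0\<close> if \<open>r b > 0\<close>; if
  \<open>r b = 0\<close>, then \<open>T b\<close> has norm zero. Uniqueness gives meaning to the
  description operator in \<open>psd_sqrt\<close>.\<close>

lemma pos_semidef_root_unique:
  fixes R T :: "real^'n^'n"
  assumes R: "pos_semidef R" and T: "pos_semidef T" and eq: "R ** R = T ** T"
  shows "R = T"
proof -
  obtain B r where B: "span B = UNIV" and r: "\<And>b. b \<in> B \<Longrightarrow> R *v b = r b *\<^sub>R b"
    and norm: "\<And>b. b \<in> B \<Longrightarrow> norm b = 1"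
    using orthonormal_eigenbasis[OF pos_semidefD(1)[OF R]] by metis
  have "T *v b = R *v b" if b: "b \<in> B" for b
  proof -
    have r0: "0 \<le> r b"
      using pos_semidefD(2)[OF R, of b] r[OF b] norm[OF b] by (simp add: norm_eq_1)
    have TT: "T *v (T *v b) = (r b)\<^sup>2 *\<^sub>R b"
      using eq r[OF b]
      by (metis matrix_vector_mul_assoc matrix_vector_mult_scaleR scaleR_scaleR power2_eq_square)
    define w where "w = T *v b - r b *\<^sub>R b"
    have Tw: "T *v w = - (r b *\<^sub>R w)"
      by (simp add: w_def matrix_vector_mult_diff_distrib matrix_vector_mult_scaleR TT
          scaleR_diff_right power2_eq_square)
    have "w = 0"
    proof (cases "r b = 0")
      case True
      have "(T *v b) \<bullet> (T *v b) = b \<bullet> (T *v (T *v b))"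
        using inner_matrix_vector_mult[of b T "T *v b"] pos_semidefD(1)[OF T] by simp
      then show ?thesis using TT True by (simp add: w_def)
    next
      case False
      have "0 \<le> - (r b * (w \<bullet> w))" using pos_semidefD(2)[OF T, of w] Tw by simp
      moreover have "0 \<le> w \<bullet> w" by simp
      moreover have "0 < r b" using False r0 by simp
      ultimately have "w \<bullet> w = 0" by (simp add: mult_le_0_iff)
      then show ?thesis by simp
    qed
    then show ?thesis by (simp add: w_def r[OF b])
  qed
  then have "T *v x = R *v x" for x
    using linear_eq_on_span[of "(*v) T" "(*v) R" B x] B by simp
  then show ?thesis by (simp add: matrix_eq)
qed

lemma psd_sqrt:
  assumes "pos_semidef S"
  shows pos_semidef_psd_sqrt: "pos_semidef (psd_sqrt S)"
    and psd_sqrt_mult_self: "psd_sqrt S ** psd_sqrt S = S"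
proof -
  have "\<exists>!R. pos_semidef R \<and> R ** R = S"
    using pos_semidef_root_exists[OF assms] pos_semidef_root_unique by (metis (no_types))
  from theI'[OF this] show "pos_semidef (psd_sqrt S)" "psd_sqrt S ** psd_sqrt S = S"
    by (simp_all add: psd_sqrt_def)
qed

lemma transpose_psd_sqrt: "pos_semidef S \<Longrightarrow> transpose (psd_sqrt S) = psd_sqrt S"
  using pos_semidef_psd_sqrt pos_semidefD(1) by blast

lemma invertible_psd_sqrt:
  fixes S :: "real^'n^'n"
  assumes "pos_def S" shows "invertible (psd_sqrt S)"
proof -
  have "psd_sqrt S ** (psd_sqrt S ** matrix_inv S) = mat 1"
    using psd_sqrt_mult_self[OF pos_def_imp_pos_semidef[OF assms]]
      matrix_inv_right[OF pos_def_invertible[OF assms]] by (simp add: matrix_mul_assoc)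
  then show ?thesis by (rule matrix_inv_unique(1))
qed

text \<open>The second fact turns the norm weighted by \<open>C\<close> into a Euclidean norm, so
  contraction in weighted norms becomes an eigenvalue question.\<close>

lemma psd_sqrt_inv_facts:
  assumes "pos_def C"
  shows "transpose (matrix_inv (psd_sqrt C)) = matrix_inv (psd_sqrt C)"
    "(norm (matrix_inv (psd_sqrt C) *v v))\<^sup>2 = v \<bullet> (matrix_inv C *v v)"
proof -
  let ?R = "psd_sqrt C" and ?R' = "matrix_inv (psd_sqrt C)"
  have psd: "pos_semidef C" by (rule pos_def_imp_pos_semidef[OF assms])
  have inv: "invertible ?R" by (rule invertible_psd_sqrt[OF assms])
  show sym: "transpose ?R' = ?R'"
    by (simp add: transpose_matrix_inv[OF inv] transpose_psd_sqrt[OF psd])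
  have "C ** (?R' ** ?R') = ?R ** (?R ** ?R') ** ?R'"
    by (simp add: psd_sqrt_mult_self[OF psd] matrix_mul_assoc)
  then have "C ** (?R' ** ?R') = mat 1" by (simp add: matrix_inv_right[OF inv])
  then have "matrix_inv C = ?R' ** ?R'" by (rule matrix_inv_unique(2))
  moreover have "(?R' *v v) \<bullet> (?R' *v v) = v \<bullet> (?R' *v (?R' *v v))"
    using inner_matrix_vector_mult[of v ?R' "?R' *v v"] unfolding sym by simp
  ultimately show "(norm (?R' *v v))\<^sup>2 = v \<bullet> (matrix_inv C *v v)"
    by (simp add: power2_norm_eq_inner matrix_vector_mul_assoc)
qed

section \<open>Powers of matrices of spectral radius less than one\<close>

lemma poly_det: "poly (det M) z = det (\<chi> i j. poly (M $ i $ j) z)"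
  for M :: "'a::comm_ring_1 poly^'n^'n"
  by (simp add: det_def poly_sum poly_prod)

abbreviation complex_matrix :: "real^'n^'m \<Rightarrow> complex^'n^'m" where
  "complex_matrix F \<equiv> \<chi> i j. complex_of_real (F $ i $ j)"

text \<open>This is \<open>I - z F\<close> with polynomial entries in \<open>z\<close>, so that its
  determinant is a polynomial and has finitely many zeros. The zeros are the reciprocals of the
  nonzero eigenvalues.\<close>

definition resolvent_poly :: "complex^'n^'n \<Rightarrow> complex poly^'n^'n" where
  "resolvent_poly F = (\<chi> i j. [:(if i = j then 1 else 0), - F $ i $ j:])"

lemma poly_resolvent_poly:
  "(\<chi> i j. poly (resolvent_poly F $ i $ j) z) *v x = x - z *s (F *v x)"
  by (simp add: resolvent_poly_def vec_eq_iff matrix_vector_mult_def algebra_simps sum_subtractf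
      sum_distrib_left if_distrib[of "\<lambda>c. _ * c"] cong: if_cong)

lemma det_resolvent_zero_iff:
  "poly (det (resolvent_poly F)) z = 0 \<longleftrightarrow> (\<exists>v. v \<noteq> 0 \<and> v = z *s (F *v v))"
proof -
  let ?M = "\<chi> i j. poly (resolvent_poly F $ i $ j) z"
  have "poly (det (resolvent_poly F)) z = 0 \<longleftrightarrow> \<not> invertible ?M"
    by (simp add: poly_det invertible_det_nz)
  also have "\<dots> \<longleftrightarrow> (\<exists>v. v \<noteq> 0 \<and> ?M *v v = 0)"
    using matrix_left_invertible_ker[of ?M] invertible_left_inverse[of ?M] by blast
  finally show ?thesis by (simp add: poly_resolvent_poly)
qed

lemma det_resolvent_nonzero: "det (resolvent_poly F) \<noteq> 0"
proof
  assume "det (resolvent_poly F) = 0"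
  then have "poly (det (resolvent_poly F)) 0 = 0" by simp
  then show False unfolding det_resolvent_zero_iff by simp
qed

text \<open>Needed because \<open>spec_radius\<close> is a \<open>Max\<close> over this set.\<close>

lemma finite_complex_eigenvalues: "finite (complex_eigenvalues F)"
proof -
  let ?q = "det (resolvent_poly (complex_matrix F))"
  have "complex_eigenvalues F \<subseteq> insert 0 (inverse ` {z. poly ?q z = 0})"
  proof
    fix l assume "l \<in> complex_eigenvalues F"
    then obtain v where v: "v \<noteq> 0" "complex_matrix F *v v = l *s v"
      by (auto simp: complex_eigenvalues_def)
    show "l \<in> insert 0 (inverse ` {z. poly ?q z = 0})"
    proof (cases "l = 0")
      case False
      then have "v = inverse l *s (complex_matrix F *v v)" by (simp add: v(2))
      with v(1) have "poly ?q (inverse l) = 0" unfolding det_resolvent_zero_iff by blast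
      then show ?thesis by (auto intro!: image_eqI[of _ _ "inverse l"])
    qed simp
  qed
  then show ?thesis
    by (rule finite_subset) (simp add: poly_roots_finite[OF det_resolvent_nonzero])
qed

text \<open>Every zero of the determinant lies outside the closed unit disc; as there are finitely
  many, a whole disc of radius above 1 is free of them.\<close>

lemma spec_radius_less_one_imp_resolvent:
  assumes "spec_radius F < 1"
  obtains R where "1 < R" "\<And>z. norm z < R \<Longrightarrow> poly (det (resolvent_poly (complex_matrix F))) z \<noteq> 0"
proof -
  let ?q = "det (resolvent_poly (complex_matrix F))"
  have big: "1 < norm z" if "poly ?q z = 0" for z
  proof -
    from that have "\<exists>v. v \<noteq> 0 \<and> v = z *s (complex_matrix F *v v)"
      unfolding det_resolvent_zero_iff .
    then obtain v where v: "v \<noteq> 0" "v = z *s (complex_matrix F *v v)"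
      by (elim exE conjE)
    then have z: "z \<noteq> 0" by (metis vector_smult_lzero)
    have "complex_matrix F *v v = inverse z *s (z *s (complex_matrix F *v v))" using z by simp
    also have "\<dots> = inverse z *s v" using v(2) by simp
    finally have "inverse z \<in> complex_eigenvalues F" using v(1) by (auto simp: complex_eigenvalues_def)
    then have "norm (inverse z) \<le> spec_radius F"
      unfolding spec_radius_def using finite_complex_eigenvalues by (intro Max_ge) auto
    then have "inverse (norm z) < 1" using assms by (simp add: norm_inverse)
    then show ?thesis using z one_less_inverse[of "inverse (norm z)"] by simp
  qed
  \<comment> \<open>The 2 keeps the set nonempty when the determinant has no zeros, as for nilpotent
    matrices; any number above 1 would do.\<close>
  let ?N = "insert 2 (norm ` {z. poly ?q z = 0})"
  have fin: "finite ?N"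
    by (intro finite.insertI finite_imageI poly_roots_finite det_resolvent_nonzero)
  show ?thesis
  proof (rule that)
    show "1 < Min ?N" using fin big by (subst Min_gr_iff) auto
    fix z :: complex assume "norm z < Min ?N"
    then have "\<not> Min ?N \<le> norm z" by simp
    then show "poly ?q z \<noteq> 0" using Min_le[OF fin, of "norm z"] by auto
  qed
qed

text \<open>
  The iterates of \<open>F\<close> on \<open>v\<close> are the Taylor coefficients of \<open>(I - z F)\<^sup>-\<^sup>1 v\<close>, which by Cramer's rule
  is holomorphic on a disc of radius \<open>R > 1\<close>.
\<close>

lemma spec_radius_less_one_component_decay:
  fixes F :: "real^'n^'n"
  assumes R: "1 < R" "\<And>z. norm z < R \<Longrightarrow> poly (det (resolvent_poly (complex_matrix F))) z \<noteq> 0"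
    and r: "0 < r" "r < R"
  shows "Bseq (\<lambda>n. ((((*v) F ^^ n) v) $ k) * r ^ n)"
proof -
  let ?F = "complex_matrix F"
  define b where "b = (\<chi> i. complex_of_real (v $ i))"
  define q where "q = det (resolvent_poly ?F)"
  \<comment> \<open>The numerator in Cramer's rule: column \<open>k\<close> is replaced by the
    right-hand side.\<close>
  define p where "p k = det (\<chi> i j. if j = k then [:b $ i:] else resolvent_poly ?F $ i $ j)" for k
  define g where "g k z = poly (p k) z / poly q z" for k z
  have sol: "g k z - z * (\<Sum>j\<in>UNIV. ?F $ k $ j * g j z) = b $ k" if "norm z < R" for z k
  proof -
    let ?M = "\<chi> i j. poly (resolvent_poly ?F $ i $ j) z"
    have det: "det ?M \<noteq> 0" using R(2)[OF that] by (simp add: poly_det)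
    have if_poly: "poly (if c then x else y) z = (if c then poly x z else poly y z)" for c x y
      by simp
    have "?M *v (\<chi> k. g k z) = b"
      unfolding cramer[OF det]
      by (simp add: vec_eq_iff g_def p_def q_def poly_det if_poly cong: if_cong)
    then have "(\<chi> k. g k z) - z *s (?F *v (\<chi> k. g k z)) = b" by (simp only: poly_resolvent_poly)
    from arg_cong[OF this, of "\<lambda>x. x $ k"] show ?thesis
      by (simp add: matrix_vector_mult_def)
  qed
  have holo: "g k holomorphic_on eball 0 (ereal R)" for k
    unfolding g_def q_def using R(2) by (intro holomorphic_intros) (auto simp: eball_def)
  define G where "G k = fps_expansion (g k) 0" for k
  have G: "g k has_fps_expansion G k" for k
    unfolding G_def using holo R(1) by (intro has_fps_expansion_fps_expansion[of "ball 0 R"]) auto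
  \<comment> \<open>The linear system near 0, read as an identity of power series, is a recursion
    for the coefficients that the iterates of \<open>F\<close> also satisfy.\<close>
  have *: "G k - fps_X * (\<Sum>j\<in>UNIV. fps_const (?F $ k $ j) * G j) = fps_const (b $ k)" for k
  proof (rule fps_expansion_unique_complex)
    show "(\<lambda>z. g k z - z * (\<Sum>j\<in>UNIV. ?F $ k $ j * g j z)) has_fps_expansion
        G k - fps_X * (\<Sum>j\<in>UNIV. fps_const (?F $ k $ j) * G j)"
      by (intro fps_expansion_intros G)
    have "eventually (\<lambda>z. z \<in> ball 0 R) (nhds (0::complex))"
      using R(1) by (intro eventually_nhds_in_open) auto
    then have ev: "eventually (\<lambda>z. g k z - z * (\<Sum>j\<in>UNIV. ?F $ k $ j * g j z) = b $ k) (nhds 0)"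
      by eventually_elim (rule sol, simp)
    show "(\<lambda>z. g k z - z * (\<Sum>j\<in>UNIV. ?F $ k $ j * g j z)) has_fps_expansion fps_const (b $ k)"
      using has_fps_expansion_cong[OF ev refl] by simp
  qed
  have G_eq: "G k = fps_const (b $ k) + fps_X * (\<Sum>j\<in>UNIV. fps_const (?F $ k $ j) * G j)" for k
    using *[of k] unfolding diff_eq_eq .
  have coeff: "fps_nth (G k) n = complex_of_real ((((*v) F ^^ n) v) $ k)" for k n
  proof (induction n arbitrary: k)
    case 0
    show ?case by (subst G_eq) (simp add: b_def)
  next
    case (Suc n)
    show ?case
      by (subst G_eq) (simp add: fps_sum_nth Suc matrix_vector_mul_component inner_vec_def)
  qed
  \<comment> \<open>The expansion converges on the whole disc of holomorphy, so its terms at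
    \<open>r\<close> are bounded.\<close>
  have "ereal r < fps_conv_radius (G k)"
    using conv_radius_fps_expansion[OF holo[of k]] r(2) unfolding G_def
    by (meson less_ereal.simps(1) less_le_trans)
  then have "summable (\<lambda>n. fps_nth (G k) n * complex_of_real r ^ n)"
    using r(1) by (intro summable_fps) simp
  then have "Bseq (\<lambda>n. fps_nth (G k) n * complex_of_real r ^ n)"
    by (rule summable_imp_Bseq)
  then show ?thesis
    by (simp add: coeff Bseq_def norm_mult norm_power abs_mult power_abs)
qed

text \<open>Boundedness of the coordinates times \<open>r ^ n\<close>, with \<open>r > 1\<close>,
  gives decay at rate \<open>1 / r\<close> on each basis vector, hence on all vectors by
  linearity.\<close>

lemma spec_radius_less_one_decay:
  fixes F :: "real^'n^'n"
  assumes "spec_radius F < 1"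
  obtains M q where "0 < M" "0 < q" "q < 1"
    "\<And>n v. norm (((*v) F ^^ n) v) \<le> M * q ^ n * norm v"
proof -
  obtain R where R: "1 < R" "\<And>z. norm z < R \<Longrightarrow> poly (det (resolvent_poly (complex_matrix F))) z \<noteq> 0"
    using spec_radius_less_one_imp_resolvent[OF assms] by blast
  define r where "r = (1 + R) / 2"
  have r: "0 < r" "1 < r" "r < R" using R(1) by (auto simp: r_def)
  have "\<forall>j k. \<exists>K. 0 < K \<and> (\<forall>n. \<bar>((((*v) F ^^ n) (axis j 1)) $ k) * r ^ n\<bar> \<le> K)"
    using spec_radius_less_one_component_decay[OF R r(1,3)] by (simp add: Bseq_def)
  then obtain K where K: "\<And>j k. 0 < K j k"
    "\<And>j k n. \<bar>((((*v) F ^^ n) (axis j 1)) $ k) * r ^ n\<bar> \<le> K j k" by metis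
  define M where "M = (\<Sum>j\<in>UNIV. \<Sum>k\<in>UNIV. K j k)"
  have lin: "linear ((*v) F ^^ n)" for n
  proof (induction n)
    case (Suc n)
    show ?case unfolding funpow.simps by (rule linear_compose[OF Suc matrix_vector_mul_linear])
  qed (simp add: linear_ident id_def)
  show ?thesis
  proof (rule that)
    show "0 < M" unfolding M_def by (intro sum_pos K) auto
    show "0 < 1 / r" "1 / r < 1" using r by auto
    fix n and v :: "real^'n"
    let ?f = "(*v) F ^^ n"
    have e: "norm (?f (axis j 1)) \<le> (\<Sum>k\<in>UNIV. K j k) * (1 / r) ^ n" for j
    proof -
      have "norm (?f (axis j 1)) \<le> (\<Sum>k\<in>UNIV. \<bar>?f (axis j 1) $ k\<bar>)" by (rule norm_le_l1_cart)
      also have "\<dots> \<le> (\<Sum>k\<in>UNIV. K j k * (1 / r) ^ n)"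
        using K(2)[where n = n] r
        by (intro sum_mono) (simp add: abs_mult power_divide field_simps)
      finally show ?thesis by (simp add: sum_distrib_right)
    qed
    have "v = (\<Sum>j\<in>UNIV. v $ j *\<^sub>R axis j 1)"
      using basis_expansion[of v] by (simp add: scalar_mult_eq_scaleR)
    then have "?f v = (\<Sum>j\<in>UNIV. v $ j *\<^sub>R ?f (axis j 1))"
      by (metis (mono_tags, lifting) linear_sum[OF lin] linear_scale[OF lin] sum.cong)
    also have "norm \<dots> \<le> (\<Sum>j\<in>UNIV. norm v * ((\<Sum>k\<in>UNIV. K j k) * (1 / r) ^ n))"
      by (rule order_trans[OF norm_sum], rule sum_mono)
        (use component_le_norm_cart e in \<open>auto intro!: mult_mono\<close>)
    also have "\<dots> = M * (1 / r) ^ n * norm v"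
      by (simp add: M_def sum_distrib_left sum_distrib_right mult_ac)
    finally show "norm (?f v) \<le> M * (1 / r) ^ n * norm v" .
  qed
qed

section \<open>The Riccati equation\<close>

text \<open>The left side, called \<open>W\<close>, is checked to be a right inverse. The decisive
  identity is \<open>H ** W = \<Gamma> ** S' ** H ** C\<close>, obtained from
  \<open>S ** S' = mat 1\<close> by isolating the \<open>\<Gamma>\<close> part of
  \<open>S\<close>.\<close>

lemma woodbury:
  fixes C :: "real^'d^'d" and H :: "real^'d^'k" and \<Gamma> :: "real^'k^'k"
  assumes "pos_def C" "pos_def \<Gamma>"
  shows "C - C ** transpose H ** matrix_inv (H ** C ** transpose H + \<Gamma>) ** H ** C
    = matrix_inv (matrix_inv C + transpose H ** matrix_inv \<Gamma> ** H)"
proof -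
  define S where "S = H ** C ** transpose H + \<Gamma>"
  define S' where "S' = matrix_inv S"
  define W where "W = C - C ** transpose H ** S' ** H ** C"
  have "pos_def S"
    unfolding S_def using pos_def_add[OF assms(2) pos_semidef_congruence[of C H]]
      pos_def_imp_pos_semidef[OF assms(1)] by (simp add: add.commute)
  then have "S ** S' = mat 1" unfolding S'_def by (intro matrix_inv_right pos_def_invertible)
  then have a: "H ** C ** transpose H ** S' = mat 1 - \<Gamma> ** S'"
    unfolding S_def by (simp add: matrix_add_rdistrib eq_diff_eq)
  have "H ** W = H ** C - (H ** C ** transpose H ** S') ** (H ** C)"
    by (simp add: W_def matrix_ring_simps)
  also have "\<dots> = \<Gamma> ** S' ** H ** C" unfolding a by (simp add: matrix_ring_simps)
  finally have HW: "H ** W = \<Gamma> ** S' ** H ** C" .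
  have inv: "matrix_inv C ** C = mat 1" "matrix_inv \<Gamma> ** \<Gamma> = mat 1"
    using assms by (simp_all add: matrix_inv_left pos_def_invertible)
  have "matrix_inv C ** W = mat 1 - transpose H ** S' ** H ** C"
    using inv by (simp add: W_def matrix_ring_simps)
  moreover have "transpose H ** matrix_inv \<Gamma> ** H ** W
      = transpose H ** (matrix_inv \<Gamma> ** \<Gamma>) ** S' ** H ** C"
    using HW by (metis matrix_mul_assoc)
  ultimately have "(matrix_inv C + transpose H ** matrix_inv \<Gamma> ** H) ** W = mat 1"
    by (simp add: matrix_add_rdistrib inv)
  from matrix_inv_unique(2)[OF this] show ?thesis by (simp add: W_def S'_def S_def)
qed

lemma funpow_transpose_inner:
  fixes F :: "real^'n^'n"
  shows "x \<bullet> ((*v) F ^^ n) y = (((*v) (transpose F)) ^^ n) x \<bullet> y"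
proof (induction n arbitrary: x)
  case (Suc n)
  have "x \<bullet> ((*v) F ^^ Suc n) y = (transpose F *v x) \<bullet> ((*v) F ^^ n) y"
    by (simp add: inner_matrix_vector_mult del: transpose_matrix_vector)
  also have "\<dots> = ((*v) (transpose F) ^^ n) (transpose F *v x) \<bullet> y" by (rule Suc)
  finally show ?case by (simp only: funpow_swap1 funpow.simps o_def)
qed simp

text \<open>By duality the squared norm of the transposed iterate is an inner product of
  \<open>v\<close> with an iterate of \<open>F\<close>. Detectability controls powers of the closed
  loop, while quadratic forms of the Riccati orbit evolve under its transpose.\<close>

lemma transpose_decay:
  fixes F :: "real^'n^'n"
  assumes "\<And>n v. norm (((*v) F ^^ n) v) \<le> M * q ^ n * norm v"
  shows "norm (((*v) (transpose F) ^^ n) v) \<le> M * q ^ n * norm v"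
proof (cases "((*v) (transpose F) ^^ n) v = 0")
  case True
  have "0 \<le> M * q ^ n * norm v" using assms[of n v] norm_ge_zero order_trans by blast
  with True show ?thesis by simp
next
  case False
  let ?w = "((*v) (transpose F) ^^ n) v"
  have "norm ?w * norm ?w = v \<bullet> ((*v) F ^^ n) ?w"
    by (simp add: funpow_transpose_inner power2_norm_eq_inner[symmetric] power2_eq_square
        del: transpose_matrix_vector)
  also have "\<dots> \<le> norm v * norm (((*v) F ^^ n) ?w)" by (rule norm_cauchy_schwarz)
  also have "\<dots> \<le> norm v * (M * q ^ n * norm ?w)" by (intro mult_left_mono assms norm_ge_zero)
  also have "\<dots> = (M * q ^ n * norm v) * norm ?w" by (simp add: mult_ac)
  finally show ?thesis using False by (simp del: transpose_matrix_vector)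
qed

section \<open>Algebra and order properties of the Riccati map\<close>

locale riccati =
  fixes A \<Sigma> :: "real^'d^'d" and H :: "real^'d^'k" and \<Gamma> :: "real^'k^'k"
  assumes Sigma: "pos_def \<Sigma>" and Gamma: "pos_def \<Gamma>"
begin

abbreviation "ricc \<equiv> ricc_d A H \<Sigma> \<Gamma>"
abbreviation "gain \<equiv> gain_d A H \<Gamma>"

definition innov :: "real^'d^'d \<Rightarrow> real^'k^'k" where
  "innov C = H ** C ** transpose H + \<Gamma>"

definition closed_loop :: "real^'d^'d \<Rightarrow> real^'d^'d" where
  "closed_loop C = A - gain C ** H"

lemma pos_def_innov: "pos_semidef C \<Longrightarrow> pos_def (innov C)"
  unfolding innov_def using pos_def_add[OF Gamma pos_semidef_congruence[of C H]]
  by (simp add: add.commute)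

lemma transpose_innov: "pos_semidef C \<Longrightarrow> transpose (innov C) = innov C"
  using pos_def_innov pos_defD(1) by blast

lemma gain_eq: "gain C = A ** C ** transpose H ** matrix_inv (innov C)"
  by (simp add: gain_d_def innov_def)

lemma gain_innov:
  assumes "pos_semidef C"
  shows "gain C ** innov C = A ** C ** transpose H"
proof -
  have "gain C ** innov C = A ** C ** transpose H ** (matrix_inv (innov C) ** innov C)"
    by (simp add: gain_eq matrix_mul_assoc)
  then show ?thesis using matrix_inv_left[OF pos_def_invertible[OF pos_def_innov[OF assms]]] by simp
qed

lemma innov_gain:
  assumes "pos_semidef C"
  shows "innov C ** transpose (gain C) = H ** C ** transpose A"
  using arg_cong[OF gain_innov[OF assms], of transpose] assms
  by (simp add: matrix_transpose_mul transpose_innov pos_semidefD(1) matrix_mul_assoc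
      del: transpose_matrix_vector)

lemma ricc_eq: "ricc C = A ** C ** transpose A + \<Sigma> - gain C ** H ** C ** transpose A"
  by (simp add: ricc_d_def gain_d_def)

text \<open>The correction term is symmetric and can show the gain on either side. The difference
  identity needs one form for each argument.\<close>

lemma ricc_eq':
  assumes "pos_semidef C"
  shows "ricc C = A ** C ** transpose A + \<Sigma> - A ** C ** transpose H ** transpose (gain C)"
proof -
  have "gain C ** H ** C ** transpose A = gain C ** (innov C ** transpose (gain C))"
    by (simp add: innov_gain[OF assms] matrix_mul_assoc)
  also have "\<dots> = A ** C ** transpose H ** transpose (gain C)"
    by (simp add: gain_innov[OF assms] matrix_mul_assoc)
  finally show ?thesis by (simp add: ricc_eq)
qed

text \<open>Completing the square in \<open>K\<close>: the Kalman gain is the optimal one.\<close>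

lemma ricc_joseph:
  assumes "pos_semidef C"
  shows "(A - K ** H) ** C ** transpose (A - K ** H) + K ** \<Gamma> ** transpose K + \<Sigma>
    = ricc C + (K - gain C) ** innov C ** transpose (K - gain C)"
proof -
  let ?G = "gain C"
  have "(K - ?G) ** innov C ** transpose (K - ?G)
      = K ** innov C ** transpose K - K ** (innov C ** transpose ?G)
        - (?G ** innov C) ** transpose K + (?G ** innov C) ** transpose ?G"
    by (simp add: matrix_ring_simps transpose_diff)
  also have "\<dots> = K ** innov C ** transpose K - K ** H ** C ** transpose A
        - A ** C ** transpose H ** transpose K + A ** C ** transpose H ** transpose ?G"
    by (simp add: gain_innov[OF assms] innov_gain[OF assms] matrix_mul_assoc)
  finally have E: "(K - ?G) ** innov C ** transpose (K - ?G)
      = K ** innov C ** transpose K - K ** H ** C ** transpose A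
        - A ** C ** transpose H ** transpose K + A ** C ** transpose H ** transpose ?G" .
  show ?thesis
    unfolding E by (simp add: ricc_eq'[OF assms] innov_def matrix_ring_simps transpose_diff matrix_transpose_mul)
qed

lemma ricc_closed_loop:
  assumes "pos_semidef C"
  shows "ricc C = closed_loop C ** C ** transpose (closed_loop C)
    + gain C ** \<Gamma> ** transpose (gain C) + \<Sigma>"
  using ricc_joseph[OF assms, of "gain C"] by (simp add: closed_loop_def)

text \<open>Expanding the product leaves two mixed terms. Rewriting each through the gain equation
  of its own covariance produces the same term
  \<open>gain C ** \<Gamma> ** transpose (gain D)\<close> twice, and it cancels.\<close>

lemma ricc_diff:
  assumes "pos_semidef C" "pos_semidef D"
  shows "ricc C - ricc D = closed_loop C ** (C - D) ** transpose (closed_loop D)"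
proof -
  let ?G = "gain C" and ?K = "gain D"
  have C: "A ** C ** transpose H ** transpose ?K
      = ?G ** H ** C ** transpose H ** transpose ?K + ?G ** \<Gamma> ** transpose ?K"
    using arg_cong[OF gain_innov[OF assms(1)], of "\<lambda>x. x ** transpose ?K"]
    by (simp add: innov_def matrix_ring_simps)
  have D: "?G ** H ** D ** transpose A
      = ?G ** H ** D ** transpose H ** transpose ?K + ?G ** \<Gamma> ** transpose ?K"
    using arg_cong[OF innov_gain[OF assms(2)], of "\<lambda>x. ?G ** x"]
    by (simp add: innov_def matrix_ring_simps)
  have "closed_loop C ** (C - D) ** transpose (closed_loop D)
      = A ** C ** transpose A - ?G ** H ** C ** transpose A
        - A ** C ** transpose H ** transpose ?K + ?G ** H ** C ** transpose H ** transpose ?K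
        - (A ** D ** transpose A - ?G ** H ** D ** transpose A
        - A ** D ** transpose H ** transpose ?K + ?G ** H ** D ** transpose H ** transpose ?K)"
    by (simp add: closed_loop_def matrix_ring_simps transpose_diff matrix_transpose_mul)
  then show ?thesis unfolding C D ricc_eq[of C] ricc_eq'[OF assms(2)] by simp
qed

lemma ricc_quadratic:
  assumes "pos_semidef C"
  shows "v \<bullet> (ricc C *v v) = (transpose (closed_loop C) *v v) \<bullet> (C *v (transpose (closed_loop C) *v v))
    + (transpose (gain C) *v v) \<bullet> (\<Gamma> *v (transpose (gain C) *v v)) + v \<bullet> (\<Sigma> *v v)"
  unfolding ricc_closed_loop[OF assms] matrix_vector_mult_add_rdistrib inner_add_right
    congruence_quadratic ..

lemma pos_def_ricc:
  assumes "pos_semidef C" shows "pos_def (ricc C)"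
proof -
  have "pos_semidef (closed_loop C ** C ** transpose (closed_loop C)
      + gain C ** \<Gamma> ** transpose (gain C))"
    using assms Gamma
    by (intro pos_semidef_add pos_semidef_congruence) (simp_all add: pos_def_imp_pos_semidef)
  from pos_def_add[OF Sigma this] show ?thesis
    by (simp add: ricc_closed_loop[OF assms] add_ac)
qed

lemma ricc_closed_loop_le:
  assumes "pos_semidef C"
  shows "(transpose (closed_loop C) *v v) \<bullet> (C *v (transpose (closed_loop C) *v v)) + v \<bullet> (\<Sigma> *v v)
    \<le> v \<bullet> (ricc C *v v)"
  unfolding ricc_quadratic[OF assms] using pos_semidefD(2)[OF pos_def_imp_pos_semidef[OF Gamma]]
  by (simp del: transpose_matrix_vector)

lemma ricc_ge_Sigma:
  assumes "pos_semidef C" shows "v \<bullet> (\<Sigma> *v v) \<le> v \<bullet> (ricc C *v v)"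
proof -
  have "0 \<le> (transpose (closed_loop C) *v v) \<bullet> (C *v (transpose (closed_loop C) *v v))"
    by (rule pos_semidefD(2)[OF assms])
  then show ?thesis using ricc_closed_loop_le[OF assms, of v] by linarith
qed

lemma ricc_le:
  assumes "pos_semidef C"
  shows "v \<bullet> (ricc C *v v) \<le> (transpose (A - K ** H) *v v) \<bullet> (C *v (transpose (A - K ** H) *v v))
    + v \<bullet> ((K ** \<Gamma> ** transpose K + \<Sigma>) *v v)"
proof -
  have "0 \<le> v \<bullet> (((K - gain C) ** innov C ** transpose (K - gain C)) *v v)"
    by (intro pos_semidefD(2) pos_semidef_congruence pos_def_imp_pos_semidef pos_def_innov assms)
  then have "v \<bullet> (ricc C *v v)
      \<le> v \<bullet> ((ricc C + (K - gain C) ** innov C ** transpose (K - gain C)) *v v)"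
    by (simp add: matrix_vector_mult_add_rdistrib inner_add_right)
  also have "\<dots> = v \<bullet> (((A - K ** H) ** C ** transpose (A - K ** H)
      + (K ** \<Gamma> ** transpose K + \<Sigma>)) *v v)"
    using ricc_joseph[OF assms, of K] by (simp add: add.assoc)
  also have "\<dots> = (transpose (A - K ** H) *v v) \<bullet> (C *v (transpose (A - K ** H) *v v))
    + v \<bullet> ((K ** \<Gamma> ** transpose K + \<Sigma>) *v v)"
    unfolding matrix_vector_mult_add_rdistrib[of "(A - K ** H) ** C ** transpose (A - K ** H)"]
      inner_add_right congruence_quadratic ..
  finally show ?thesis .
qed

section \<open>Orbits of the Riccati map and the stable covariance\<close>

lemma pos_semidef_ricc_iterate: "pos_semidef C \<Longrightarrow> pos_semidef ((ricc ^^ n) C)"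
  by (induction n) (simp_all add: pos_def_ricc pos_def_imp_pos_semidef)

lemma ricc_iterates_bounded:
  assumes "d_detectable H A" "pos_semidef C"
  obtains c where "0 < c" "\<And>n v. v \<bullet> ((ricc ^^ n) C *v v) \<le> c * (norm v)\<^sup>2"
proof -
  obtain K where K: "spec_radius (A - K ** H) < 1"
    using assms(1) by (auto simp: d_detectable_def)
  define T where "T = transpose (A - K ** H)"
  define Q where "Q = K ** \<Gamma> ** transpose K + \<Sigma>"
  define f where "f j v = ((*v) T ^^ j) v" for j v
  obtain M q where M: "0 < M" "0 < q" "q < 1" "\<And>n v. norm (f n v) \<le> M * q ^ n * norm v"
    using spec_radius_less_one_decay[OF K] transpose_decay unfolding f_def T_def by metis
  \<comment> \<open>The fixed-gain bound unrolled: the initial covariance is seen along the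
    \<open>n\<close>-th iterate of \<open>T\<close>, and each step adds a noise term seen along an
    earlier iterate.\<close>
  have step: "v \<bullet> ((ricc ^^ n) C *v v)
      \<le> f n v \<bullet> (C *v f n v) + (\<Sum>j<n. f j v \<bullet> (Q *v f j v))" for n v
  proof (induction n arbitrary: v)
    case (Suc n)
    have "v \<bullet> ((ricc ^^ Suc n) C *v v) \<le> (T *v v) \<bullet> ((ricc ^^ n) C *v (T *v v)) + v \<bullet> (Q *v v)"
      using ricc_le[OF pos_semidef_ricc_iterate[OF assms(2)], of v n K]
      by (simp only: T_def Q_def funpow.simps o_def)
    also have "\<dots> \<le> f n (T *v v) \<bullet> (C *v f n (T *v v))
        + (\<Sum>j<n. f j (T *v v) \<bullet> (Q *v f j (T *v v))) + v \<bullet> (Q *v v)"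
      using Suc[of "T *v v"] by simp
    also have "\<dots> = f (Suc n) v \<bullet> (C *v f (Suc n) v) + (\<Sum>j<Suc n. f j v \<bullet> (Q *v f j v))"
    proof -
      have "f j (T *v v) = f (Suc j) v" for j by (simp add: f_def funpow_swap1)
      moreover have "f 0 v = v" by (simp add: f_def)
      ultimately show ?thesis by (simp only: sum.lessThan_Suc_shift add_ac)
    qed
    finally show ?case .
  qed (simp add: f_def)
  obtain c0 where c0: "0 < c0" "\<And>v. \<bar>v \<bullet> (C *v v)\<bar> \<le> c0 * (norm v)\<^sup>2"
    using quadratic_upper_bound by blast
  obtain c1 where c1: "0 < c1" "\<And>v. \<bar>v \<bullet> (Q *v v)\<bar> \<le> c1 * (norm v)\<^sup>2"
    using quadratic_upper_bound by blast
  have q2: "0 \<le> q\<^sup>2" "q\<^sup>2 < 1" using M by (simp_all add: power_less_one_iff abs_square_less_1)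
  have f2: "(norm (f j v))\<^sup>2 \<le> M\<^sup>2 * (q\<^sup>2) ^ j * (norm v)\<^sup>2" for j v
    using power_mono[OF M(4)[of j v], of 2]
    by (simp add: power_mult_distrib power_mult[symmetric] mult.commute)
  have f2': "(norm (f j v))\<^sup>2 \<le> M\<^sup>2 * (norm v)\<^sup>2" for j v
  proof -
    have "M\<^sup>2 * (q\<^sup>2) ^ j * (norm v)\<^sup>2 \<le> M\<^sup>2 * 1 * (norm v)\<^sup>2"
      using M q2 by (intro mult_right_mono mult_left_mono power_le_one) auto
    then show ?thesis using f2[of j v] by simp
  qed
  \<comment> \<open>The first summand bounds the initial term; the second is the geometric series of
    the noise terms, of ratio \<open>q\<^sup>2\<close> because quadratic forms see the decay
    twice.\<close>
  define c where "c = c0 * M\<^sup>2 + c1 * M\<^sup>2 * (1 / (1 - q\<^sup>2))"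
  show ?thesis
  proof (rule that)
    show "0 < c" unfolding c_def using c0 c1 M q2 by (intro add_pos_pos mult_pos_pos) auto
    fix n and v :: "real^'d"
    have "f n v \<bullet> (C *v f n v) \<le> c0 * (M\<^sup>2 * (norm v)\<^sup>2)"
      using c0(2)[of "f n v"] mult_left_mono[OF f2'[of n v] less_imp_le[OF c0(1)]] by linarith
    moreover have "(\<Sum>j<n. f j v \<bullet> (Q *v f j v)) \<le> (\<Sum>j<n. c1 * (M\<^sup>2 * (q\<^sup>2) ^ j * (norm v)\<^sup>2))"
    proof (rule sum_mono)
      fix j
      show "f j v \<bullet> (Q *v f j v) \<le> c1 * (M\<^sup>2 * (q\<^sup>2) ^ j * (norm v)\<^sup>2)"
        using c1(2)[of "f j v"] mult_left_mono[OF f2[of j v] less_imp_le[OF c1(1)]] by linarith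
    qed
    moreover have "(\<Sum>j<n. c1 * (M\<^sup>2 * (q\<^sup>2) ^ j * (norm v)\<^sup>2))
        = c1 * M\<^sup>2 * (norm v)\<^sup>2 * (\<Sum>j<n. (q\<^sup>2) ^ j)"
      by (simp add: sum_distrib_left mult_ac)
    moreover have "(\<Sum>j<n. (q\<^sup>2) ^ j) \<le> 1 / (1 - q\<^sup>2)"
    proof -
      have "(\<Sum>j<n. (q\<^sup>2) ^ j) \<le> (\<Sum>j. (q\<^sup>2) ^ j)"
        using q2 by (intro sum_le_suminf summable_geometric) auto
      then show ?thesis using q2 by (simp add: suminf_geometric)
    qed
    then have "c1 * M\<^sup>2 * (norm v)\<^sup>2 * (\<Sum>j<n. (q\<^sup>2) ^ j) \<le> c1 * M\<^sup>2 * (norm v)\<^sup>2 * (1 / (1 - q\<^sup>2))"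
      using c1 by (intro mult_left_mono) auto
    ultimately have "v \<bullet> ((ricc ^^ n) C *v v)
        \<le> c0 * (M\<^sup>2 * (norm v)\<^sup>2) + c1 * M\<^sup>2 * (norm v)\<^sup>2 * (1 / (1 - q\<^sup>2))"
      using step[of v n] by linarith
    also have "\<dots> = c * (norm v)\<^sup>2" by (simp add: c_def algebra_simps)
    finally show "v \<bullet> ((ricc ^^ n) C *v v) \<le> c * (norm v)\<^sup>2" .
  qed
qed

text \<open>In the bilinear form of \<open>ricc_diff\<close> the left argument is moved by the
  closed loop of one orbit, the right argument by that of the other. Measuring each argument by its
  own covariance, every step gains a factor \<open>sqrt r\<close> on each side.\<close>

lemma ricc_contraction:
  assumes s: "0 < s" "\<And>v. s * (norm v)\<^sup>2 \<le> v \<bullet> (\<Sigma> *v v)"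
    and C: "pos_semidef C" "\<And>v. s * (norm v)\<^sup>2 \<le> v \<bullet> (C *v v)"
    and D: "pos_semidef D" "\<And>v. s * (norm v)\<^sup>2 \<le> v \<bullet> (D *v v)"
    and upper: "\<And>n v. v \<bullet> ((ricc ^^ n) C *v v) \<le> c * (norm v)\<^sup>2"
      "\<And>n v. v \<bullet> ((ricc ^^ n) D *v v) \<le> c * (norm v)\<^sup>2"
  obtains a r where "0 \<le> a" "0 \<le> r" "r < 1"
    "\<And>n u v. \<bar>u \<bullet> (((ricc ^^ n) C - (ricc ^^ n) D) *v v)\<bar> \<le> a * r ^ n * norm u * norm v"
proof -
  \<comment> \<open>As \<open>\<Sigma>\<close> is at least \<open>s\<close> and the Riccati image at
    most \<open>c\<close>, the noise accounts for at least the fraction \<open>s / c\<close> of the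
    image, and the propagated part for at most \<open>r\<close>.\<close>
  define r where "r = 1 - s / c"
  have "s * 1 \<le> c * 1"
  proof -
    obtain v :: "real^'d" where "norm v = 1" using vector_choose_size[of 1] by auto
    with C(2)[of v] upper(1)[of v 0] show ?thesis by simp
  qed
  then have "0 < c" "s \<le> c" using s(1) by linarith+
  then have r: "0 \<le> r" "r < 1" using s(1) by (simp_all add: r_def)
  have step: "(transpose (closed_loop E) *v v) \<bullet> (E *v (transpose (closed_loop E) *v v)) \<le> r * (v \<bullet> (ricc E *v v))"
    if "pos_semidef E" "v \<bullet> (ricc E *v v) \<le> c * (norm v)\<^sup>2" for E v
  proof -
    have "(s / c) * (v \<bullet> (ricc E *v v)) \<le> (s / c) * (c * (norm v)\<^sup>2)"
      using that(2) s(1) \<open>0 < c\<close> by (intro mult_left_mono) auto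
    then have "(s / c) * (v \<bullet> (ricc E *v v)) \<le> v \<bullet> (\<Sigma> *v v)"
      using s(2)[of v] \<open>0 < c\<close> by simp
    moreover have "r * (v \<bullet> (ricc E *v v)) = v \<bullet> (ricc E *v v) - (s / c) * (v \<bullet> (ricc E *v v))"
      unfolding r_def by (simp only: left_diff_distrib mult_1)
    ultimately show ?thesis using ricc_closed_loop_le[OF that(1), of v] by linarith
  qed
  define CC where "CC n = (ricc ^^ n) C" for n
  define DD where "DD n = (ricc ^^ n) D" for n
  have psd: "pos_semidef (CC n)" "pos_semidef (DD n)" for n
    using C(1) D(1) by (simp_all add: CC_def DD_def pos_semidef_ricc_iterate)
  have Suc_eq: "CC (Suc n) = ricc (CC n)" "DD (Suc n) = ricc (DD n)" for n
    by (simp_all add: CC_def DD_def)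
  have up: "v \<bullet> (CC n *v v) \<le> c * (norm v)\<^sup>2" "v \<bullet> (DD n *v v) \<le> c * (norm v)\<^sup>2" for n v
    using upper by (simp_all add: CC_def DD_def)
  obtain k where k: "0 < k" "\<And>v. norm ((C - D) *v v) \<le> norm v * k"
    using bounded_linear.pos_bounded[OF matrix_vector_mul_bounded_linear[of "C - D"]] by blast
  \<comment> \<open>\<open>k\<close> bounds the operator norm of \<open>C - D\<close>; division by
    \<open>s\<close> pays for replacing both Euclidean norms by the weighted ones.\<close>
  define a where "a = k / s"
  have a: "0 \<le> a" using k s by (simp add: a_def)
  have main: "\<bar>u \<bullet> ((CC n - DD n) *v v)\<bar> \<le> a * r ^ n * (sqrt (u \<bullet> (CC n *v u)) * sqrt (v \<bullet> (DD n *v v)))"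
    for n u v
  proof (induction n arbitrary: u v)
    case 0
    have le: "sqrt s * norm w \<le> sqrt (w \<bullet> (E *v w))" if "s * (norm w)\<^sup>2 \<le> w \<bullet> (E *v w)" for w E
      using real_sqrt_le_mono[OF that] by (simp add: real_sqrt_mult)
    have "\<bar>u \<bullet> ((C - D) *v v)\<bar> \<le> norm u * norm ((C - D) *v v)" by (rule Cauchy_Schwarz_ineq2)
    also have "\<dots> \<le> norm u * (norm v * k)" by (intro mult_left_mono k norm_ge_zero)
    also have "\<dots> = a * ((sqrt s * norm u) * (sqrt s * norm v))"
      using s(1) by (simp add: a_def mult_ac) (simp add: mult.assoc[symmetric])
    also have "\<dots> \<le> a * (sqrt (u \<bullet> (C *v u)) * sqrt (v \<bullet> (D *v v)))"
      using s(1) by (intro mult_left_mono[OF _ a] mult_mono le C(2) D(2))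
        (auto intro!: pos_semidefD(2)[OF C(1)] mult_nonneg_nonneg)
    finally show ?case by (simp add: CC_def DD_def)
  next
    case (Suc n)
    let ?u = "transpose (closed_loop (CC n)) *v u" and ?v = "transpose (closed_loop (DD n)) *v v"
    have "u \<bullet> ((CC (Suc n) - DD (Suc n)) *v v)
        = u \<bullet> (closed_loop (CC n) *v ((CC n - DD n) *v ?v))"
      unfolding Suc_eq ricc_diff[OF psd] by (simp only: matrix_vector_mul_assoc matrix_mul_assoc)
    also have "\<dots> = ?u \<bullet> ((CC n - DD n) *v ?v)" by (rule inner_matrix_vector_mult)
    finally have "\<bar>u \<bullet> ((CC (Suc n) - DD (Suc n)) *v v)\<bar> = \<bar>?u \<bullet> ((CC n - DD n) *v ?v)\<bar>" by simp
    also have "\<dots> \<le> a * r ^ n * (sqrt (?u \<bullet> (CC n *v ?u)) * sqrt (?v \<bullet> (DD n *v ?v)))" by (rule Suc)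
    also have "\<dots> \<le> a * r ^ n * (sqrt (r * (u \<bullet> (CC (Suc n) *v u))) * sqrt (r * (v \<bullet> (DD (Suc n) *v v))))"
    proof (intro mult_left_mono mult_mono)
      show "sqrt (?u \<bullet> (CC n *v ?u)) \<le> sqrt (r * (u \<bullet> (CC (Suc n) *v u)))"
        unfolding Suc_eq
        by (intro real_sqrt_le_mono step psd up(1)[where n = "Suc n", unfolded Suc_eq])
      show "sqrt (?v \<bullet> (DD n *v ?v)) \<le> sqrt (r * (v \<bullet> (DD (Suc n) *v v)))"
        unfolding Suc_eq
        by (intro real_sqrt_le_mono step psd up(2)[where n = "Suc n", unfolded Suc_eq])
      show "0 \<le> sqrt (r * (u \<bullet> (CC (Suc n) *v u)))"
        using r psd(1)[THEN pos_semidefD(2)] by simp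
      show "0 \<le> sqrt (?v \<bullet> (DD n *v ?v))" using psd(2)[THEN pos_semidefD(2)] by simp
      show "0 \<le> a * r ^ n" using a r by simp
    qed
    also have "\<dots> = a * r ^ Suc n * (sqrt (u \<bullet> (CC (Suc n) *v u)) * sqrt (v \<bullet> (DD (Suc n) *v v)))"
      using r by (simp add: real_sqrt_mult mult_ac)
    finally show ?case .
  qed
  show ?thesis
  proof (rule that)
    show "0 \<le> a * c" using a \<open>0 < c\<close> by simp
    show "0 \<le> r" "r < 1" by fact+
    fix n u v
    have sq: "sqrt (w \<bullet> (E *v w)) \<le> sqrt c * norm w" if "w \<bullet> (E *v w) \<le> c * (norm w)\<^sup>2" for w E
      using real_sqrt_le_mono[OF that] by (simp add: real_sqrt_mult)
    have "\<bar>u \<bullet> ((CC n - DD n) *v v)\<bar> \<le> a * r ^ n * (sqrt (u \<bullet> (CC n *v u)) * sqrt (v \<bullet> (DD n *v v)))"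
      by (rule main)
    also have "\<dots> \<le> a * r ^ n * ((sqrt c * norm u) * (sqrt c * norm v))"
      using a r \<open>0 < c\<close> psd(2)[THEN pos_semidefD(2)]
      by (intro mult_left_mono mult_mono sq up) auto
    also have "\<dots> = a * c * r ^ n * norm u * norm v"
      using \<open>0 < c\<close> by (simp add: mult_ac)
    finally show "\<bar>u \<bullet> (((ricc ^^ n) C - (ricc ^^ n) D) *v v)\<bar> \<le> a * c * r ^ n * norm u * norm v"
      by (simp add: CC_def DD_def)
  qed
qed

lemma stable_cov_ge_Sigma:
  assumes "is_stable_cov A H \<Sigma> \<Gamma> C"
  shows "v \<bullet> (\<Sigma> *v v) \<le> v \<bullet> (C *v v)" "pos_def C"
  using assms ricc_ge_Sigma[of C v] pos_def_ricc[of C] by (simp_all add: is_stable_cov_def)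

text \<open>Fixed points are constant orbits, so their difference must be bounded by a sequence
  tending to 0.\<close>

lemma stable_cov_unique:
  assumes C: "is_stable_cov A H \<Sigma> \<Gamma> C" and D: "is_stable_cov A H \<Sigma> \<Gamma> D"
  shows "C = D"
proof -
  obtain s where s: "0 < s" "\<And>v. s * (norm v)\<^sup>2 \<le> v \<bullet> (\<Sigma> *v v)"
    using pos_def_lower_bound[OF Sigma] by blast
  have fix_eq: "(ricc ^^ n) C = C" "(ricc ^^ n) D = D" for n
    using C D by (induction n) (simp_all add: is_stable_cov_def)
  obtain c where c: "0 < c" "\<And>v. \<bar>v \<bullet> (C *v v)\<bar> \<le> c * (norm v)\<^sup>2" using quadratic_upper_bound by blast
  obtain d where d: "0 < d" "\<And>v. \<bar>v \<bullet> (D *v v)\<bar> \<le> d * (norm v)\<^sup>2" using quadratic_upper_bound by blast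
  have up: "v \<bullet> ((ricc ^^ n) C *v v) \<le> max c d * (norm v)\<^sup>2"
    "v \<bullet> ((ricc ^^ n) D *v v) \<le> max c d * (norm v)\<^sup>2" for n v
    using c(2)[of v] d(2)[of v] mult_right_mono[of c "max c d" "(norm v)\<^sup>2"]
      mult_right_mono[of d "max c d" "(norm v)\<^sup>2"] unfolding fix_eq by auto
  have low: "s * (norm v)\<^sup>2 \<le> v \<bullet> (C *v v)" "s * (norm v)\<^sup>2 \<le> v \<bullet> (D *v v)" for v
    using s(2)[of v] stable_cov_ge_Sigma(1)[OF C, of v] stable_cov_ge_Sigma(1)[OF D, of v] by linarith+
  have psd: "pos_semidef C" "pos_semidef D" using C D by (simp_all add: is_stable_cov_def)
  obtain a r where ar: "0 \<le> a" "0 \<le> r" "r < 1"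
    "\<And>n u v. \<bar>u \<bullet> (((ricc ^^ n) C - (ricc ^^ n) D) *v v)\<bar> \<le> a * r ^ n * norm u * norm v"
    using ricc_contraction[OF s psd(1) low(1) psd(2) low(2) up] by blast
  have "u \<bullet> ((C - D) *v v) = 0" for u v
  proof -
    have "(\<lambda>n. r ^ n) \<longlonglongrightarrow> 0" using ar by (intro LIMSEQ_power_zero) simp
    then have "(\<lambda>n. a * r ^ n * norm u * norm v) \<longlonglongrightarrow> 0"
      by (intro tendsto_mult_left_zero tendsto_mult_right_zero)
    then have "\<bar>u \<bullet> ((C - D) *v v)\<bar> \<le> 0"
      using ar(4)[of u _ v] unfolding fix_eq by (intro LIMSEQ_le_const) auto
    then show ?thesis by simp
  qed
  then have "(C - D) *v v = 0" for v by (metis inner_eq_zero_iff)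
  then have "C *v v = D *v v" for v by (simp add: algebra_simps)
  then show ?thesis by (simp add: matrix_eq)
qed

text \<open>The orbits of \<open>\<Sigma>\<close> and of \<open>ricc \<Sigma>\<close> are one orbit
  shifted by one step. Their geometric closeness makes the increments summable, and the limit is a
  fixed point.\<close>

lemma stable_cov_exists:
  assumes "d_detectable H A"
  obtains L where "is_stable_cov A H \<Sigma> \<Gamma> L"
proof -
  obtain s where s: "0 < s" "\<And>v. s * (norm v)\<^sup>2 \<le> v \<bullet> (\<Sigma> *v v)"
    using pos_def_lower_bound[OF Sigma] by blast
  have psdS: "pos_semidef \<Sigma>" by (rule pos_def_imp_pos_semidef[OF Sigma])
  define CC where "CC n = (ricc ^^ n) \<Sigma>" for n
  have psd: "pos_semidef (CC n)" for n unfolding CC_def by (rule pos_semidef_ricc_iterate[OF psdS])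
  have low: "s * (norm v)\<^sup>2 \<le> v \<bullet> (CC n *v v)" for n v
  proof (cases n)
    case (Suc m)
    have "v \<bullet> (\<Sigma> *v v) \<le> v \<bullet> (CC n *v v)"
      using ricc_ge_Sigma[OF psd[of m], of v] by (simp add: Suc CC_def)
    with s(2)[of v] show ?thesis by linarith
  qed (simp add: CC_def s)
  obtain c where c: "0 < c" "\<And>n v. v \<bullet> (CC n *v v) \<le> c * (norm v)\<^sup>2"
    using ricc_iterates_bounded[OF assms psdS] unfolding CC_def by blast
  have shift: "(ricc ^^ n) (ricc \<Sigma>) = CC (Suc n)" for n by (simp add: CC_def funpow_swap1)
  have "pos_semidef (ricc \<Sigma>)" "\<And>v. s * (norm v)\<^sup>2 \<le> v \<bullet> (ricc \<Sigma> *v v)"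
    using psd[of 1] low[of _ 1] by (simp_all add: CC_def)
  moreover have "\<And>n v. v \<bullet> ((ricc ^^ n) (ricc \<Sigma>) *v v) \<le> c * (norm v)\<^sup>2"
    "\<And>n v. v \<bullet> ((ricc ^^ n) \<Sigma> *v v) \<le> c * (norm v)\<^sup>2"
    using c(2) by (simp_all only: shift) (simp add: CC_def)
  ultimately obtain a r where ar: "0 \<le> a" "0 \<le> r" "r < 1"
    "\<And>n u v. \<bar>u \<bullet> (((ricc ^^ n) (ricc \<Sigma>) - (ricc ^^ n) \<Sigma>) *v v)\<bar> \<le> a * r ^ n * norm u * norm v"
    using ricc_contraction[OF s _ _ psdS s(2)] by blast
  \<comment> \<open>Testing the bilinear form on coordinate vectors yields single matrix
    entries.\<close>
  have inc: "\<bar>CC (Suc n) $ i $ j - CC n $ i $ j\<bar> \<le> a * r ^ n" for n i j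
    using ar(4)[of "axis i 1" n "axis j 1"] unfolding shift
    by (simp add: CC_def[symmetric] inner_axis_axis matrix_vector_mul_component inner_axis inner_commute[of "axis _ _"])
  have "\<exists>l. (\<lambda>n. CC n $ i $ j) \<longlonglongrightarrow> l" for i j
  proof -
    have "summable (\<lambda>n. CC (Suc n) $ i $ j - CC n $ i $ j)"
      using ar inc[of _ i j]
      by (intro summable_comparison_test'[OF summable_mult[OF summable_geometric]]) auto
    then have "(\<lambda>n. \<Sum>k<n. CC (Suc k) $ i $ j - CC k $ i $ j)
        \<longlonglongrightarrow> suminf (\<lambda>n. CC (Suc n) $ i $ j - CC n $ i $ j)"
      by (rule summable_LIMSEQ)
    then have "(\<lambda>n. CC n $ i $ j - CC 0 $ i $ j)
        \<longlonglongrightarrow> suminf (\<lambda>n. CC (Suc n) $ i $ j - CC n $ i $ j)"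
      by (simp only: sum_lessThan_telescope[of "\<lambda>n. CC n $ i $ j"])
    from tendsto_add[OF this tendsto_const[of "CC 0 $ i $ j"]] show ?thesis by auto
  qed
  then obtain l where l: "\<And>i j. (\<lambda>n. CC n $ i $ j) \<longlonglongrightarrow> l i j" by metis
  define L where "L = (\<chi> i j. l i j)"
  have lim_ij: "(\<lambda>n. CC n $ i $ j) \<longlonglongrightarrow> L $ i $ j" for i j using l by (simp add: L_def)
  have lim: "(\<lambda>n. CC n *v v) \<longlonglongrightarrow> L *v v" for v
    by (rule vec_tendstoI) (simp only: matrix_vector_mult_def vec_lambda_beta,
        intro tendsto_intros lim_ij)
  have lim_q: "(\<lambda>n. u \<bullet> (CC n *v v)) \<longlonglongrightarrow> u \<bullet> (L *v v)" for u v
    by (intro tendsto_intros lim)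
  have "0 \<le> v \<bullet> (L *v v)" for v
    using lim_q[of v v] pos_semidefD(2)[OF psd] by (intro LIMSEQ_le_const[of _ _ 0]) auto
  moreover have "transpose L = L"
  proof -
    have "CC n $ j $ i = CC n $ i $ j" for n i j
      using arg_cong[OF pos_semidefD(1)[OF psd[of n]], of "\<lambda>M. M $ i $ j"] by (simp add: transpose_def)
    then have "L $ j $ i = L $ i $ j" for i j
      using lim_ij[of i j] lim_ij[of j i] LIMSEQ_unique by auto
    then show ?thesis by (simp add: transpose_def vec_eq_iff)
  qed
  ultimately have psdL: "pos_semidef L" by (simp add: pos_semidef_def)
  \<comment> \<open>Continuity of the Riccati map at \<open>L\<close> is taken from
    \<open>ricc_diff\<close> rather than from continuity of matrix inversion: the right factor is
    fixed by \<open>L\<close>, and the left closed loops are uniformly bounded.\<close>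
  have "u \<bullet> (ricc L *v v) = u \<bullet> (L *v v)" for u v
  proof (rule LIMSEQ_unique)
    show "(\<lambda>n. u \<bullet> (CC (Suc n) *v v)) \<longlonglongrightarrow> u \<bullet> (L *v v)"
      by (rule LIMSEQ_Suc[OF lim_q])
    let ?w = "transpose (closed_loop L) *v v"
    define e where "e n = norm (CC n *v ?w - L *v ?w)" for n
    have "e \<longlonglongrightarrow> 0" unfolding e_def using lim[of ?w] by (intro tendsto_norm_zero LIM_zero)
    then have e0: "(\<lambda>n. sqrt (c / s) * norm u * e n) \<longlonglongrightarrow> 0" by (rule tendsto_mult_right_zero)
    have "\<bar>u \<bullet> (CC (Suc n) *v v) - u \<bullet> (ricc L *v v)\<bar> \<le> sqrt (c / s) * norm u * e n" for n
    proof -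
      let ?u = "transpose (closed_loop (CC n)) *v u"
      have Suc_eq: "CC (Suc n) = ricc (CC n)" by (simp add: CC_def)
      have "u \<bullet> (CC (Suc n) *v v) - u \<bullet> (ricc L *v v) = u \<bullet> ((ricc (CC n) - ricc L) *v v)"
        by (simp add: Suc_eq matrix_vector_mult_diff_rdistrib inner_diff_right)
      also have "\<dots> = u \<bullet> (closed_loop (CC n) *v ((CC n - L) *v ?w))"
        unfolding ricc_diff[OF psd psdL] by (simp only: matrix_vector_mul_assoc matrix_mul_assoc)
      also have "\<dots> = ?u \<bullet> ((CC n - L) *v ?w)" by (rule inner_matrix_vector_mult)
      also have "\<dots> = ?u \<bullet> (CC n *v ?w - L *v ?w)" by (simp only: matrix_vector_mult_diff_rdistrib)
      finally have "\<bar>u \<bullet> (CC (Suc n) *v v) - u \<bullet> (ricc L *v v)\<bar> \<le> norm ?u * e n"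
        using Cauchy_Schwarz_ineq2 by (simp only: e_def)
      \<comment> \<open>The covariance before the step is at least \<open>s\<close> and the one
        after it at most \<open>c\<close>, which bounds the closed loop between them.\<close>
      moreover have "norm ?u \<le> sqrt (c / s) * norm u"
      proof -
        have "0 \<le> u \<bullet> (\<Sigma> *v u)" by (rule pos_semidefD(2)[OF psdS])
        then have "s * (norm ?u)\<^sup>2 \<le> c * (norm u)\<^sup>2"
          using low[of ?u n] ricc_closed_loop_le[OF psd[of n], of u] c(2)[of u "Suc n"]
          unfolding Suc_eq by linarith
        then have "(norm ?u)\<^sup>2 \<le> (c / s) * (norm u)\<^sup>2" using s(1) by (simp add: field_simps)
        from real_sqrt_le_mono[OF this] show ?thesis
          by (simp only: real_sqrt_mult real_sqrt_abs abs_norm_cancel)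
      qed
      then have "norm ?u * e n \<le> sqrt (c / s) * norm u * e n"
        by (rule mult_right_mono) (simp add: e_def)
      ultimately show ?thesis by linarith
    qed
    then have "(\<lambda>n. u \<bullet> (CC (Suc n) *v v) - u \<bullet> (ricc L *v v)) \<longlonglongrightarrow> 0"
      by (intro Lim_null_comparison[OF _ e0]) (simp add: eventually_sequentially)
    then show "(\<lambda>n. u \<bullet> (CC (Suc n) *v v)) \<longlonglongrightarrow> u \<bullet> (ricc L *v v)"
      by (rule LIM_zero_cancel)
  qed
  then have "ricc L *v v = L *v v" for v by (intro iffD1[OF vector_eq_ldot]) simp
  then have "ricc L = L" by (simp add: matrix_eq)
  with psdL that show ?thesis by (simp add: is_stable_cov_def)
qed

end

section \<open>The contraction rate\<close>

context riccati
begin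

definition rate_matrix :: "real^'d^'d \<Rightarrow> real^'d^'d" where
  "rate_matrix C =
    psd_sqrt C ** transpose H ** matrix_inv (innov C) ** H ** psd_sqrt C
     + matrix_inv (psd_sqrt C)
       ** matrix_inv (matrix_inv C + transpose H ** matrix_inv \<Gamma> ** H
                      + transpose A ** matrix_inv \<Sigma> ** A)
       ** matrix_inv (psd_sqrt C)"

abbreviation "beta \<equiv> beta_d A H \<Sigma> \<Gamma>"

lemma beta_eq: "beta C = lambda_min (rate_matrix C)"
  by (simp add: beta_d_def rate_matrix_def innov_def)

text \<open>The bracket is the analysis covariance; forecasting acts on it by \<open>A\<close>. This
  is the bridge from the closed loop to Woodbury's identity.\<close>

lemma closed_loop_mult:
  "closed_loop C ** C = A ** (C - C ** transpose H ** matrix_inv (innov C) ** H ** C)"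
  by (simp add: closed_loop_def gain_eq matrix_ring_simps)

lemma pos_def_information:
  assumes "pos_def C"
  shows "pos_def (matrix_inv C + transpose H ** matrix_inv \<Gamma> ** H)"
    "pos_def (matrix_inv C + transpose H ** matrix_inv \<Gamma> ** H + transpose A ** matrix_inv \<Sigma> ** A)"
proof -
  show *: "pos_def (matrix_inv C + transpose H ** matrix_inv \<Gamma> ** H)"
    by (intro pos_def_add pos_def_matrix_inv assms pos_semidef_congruence' pos_def_imp_pos_semidef Gamma)
  show "pos_def (matrix_inv C + transpose H ** matrix_inv \<Gamma> ** H + transpose A ** matrix_inv \<Sigma> ** A)"
    by (intro pos_def_add[OF *] pos_semidef_congruence' pos_def_imp_pos_semidef pos_def_matrix_inv Sigma)
qed

text \<open>
  Woodbury's identity is applied twice: to \<open>(C, H, \<Gamma>)\<close>, which identifies the analysis covariance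
  \<open>P\<close>, and to \<open>(P, A, \<Sigma>)\<close>.
\<close>

lemma rate_matrix_eq:
  assumes "pos_def C"
  shows "psd_sqrt C ** transpose (closed_loop C) ** matrix_inv (ricc C) ** closed_loop C ** psd_sqrt C
    = mat 1 - rate_matrix C"
proof -
  define R where "R = psd_sqrt C"
  define R' where "R' = matrix_inv R"
  define P where "P = C - C ** transpose H ** matrix_inv (innov C) ** H ** C"
  define J where "J = matrix_inv C + transpose H ** matrix_inv \<Gamma> ** H"
  define Z where "Z = matrix_inv (J + transpose A ** matrix_inv \<Sigma> ** A)"
  have psd: "pos_semidef C" by (rule pos_def_imp_pos_semidef[OF assms])
  have invR: "invertible R" unfolding R_def by (rule invertible_psd_sqrt[OF assms])
  have RR: "R ** R = C" unfolding R_def by (rule psd_sqrt_mult_self[OF psd])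
  have symR: "transpose R = R" unfolding R_def by (rule transpose_psd_sqrt[OF psd])
  have inv: "R ** R' = mat 1" "R' ** R = mat 1"
    unfolding R'_def by (simp_all add: matrix_inv_left matrix_inv_right invR)
  have symR': "transpose R' = R'" unfolding R'_def by (simp add: transpose_matrix_inv[OF invR] symR)
  have J: "pos_def J" unfolding J_def by (rule pos_def_information(1)[OF assms])
  have PJ: "P = matrix_inv J" unfolding P_def J_def innov_def by (rule woodbury[OF assms Gamma])
  have P: "pos_def P" unfolding PJ by (rule pos_def_matrix_inv[OF J])
  have ricc: "ricc C = A ** P ** transpose A + \<Sigma>"
    by (simp add: ricc_eq gain_eq P_def matrix_ring_simps)
  have PW: "P ** transpose A ** matrix_inv (ricc C) ** A ** P = P - Z"
    using woodbury[OF P Sigma, of A] unfolding ricc[symmetric] Z_def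
    by (simp add: PJ matrix_inv_matrix_inv pos_def_invertible J algebra_simps)
  have "closed_loop C ** R = closed_loop C ** C ** R'"
    by (simp add: RR[symmetric] matrix_mul_assoc[symmetric] inv)
  then have BR: "closed_loop C ** R = A ** P ** R'" by (simp add: closed_loop_mult P_def)
  then have RB: "R ** transpose (closed_loop C) = R' ** P ** transpose A"
  proof -
    have "R ** transpose (closed_loop C) = transpose (closed_loop C ** R)"
      by (simp add: matrix_transpose_mul symR)
    also have "\<dots> = R' ** P ** transpose A"
      unfolding BR by (simp add: matrix_transpose_mul symR' pos_defD(1)[OF P] matrix_mul_assoc)
    finally show ?thesis .
  qed
  have "R ** transpose (closed_loop C) ** matrix_inv (ricc C) ** closed_loop C ** R
      = (R ** transpose (closed_loop C)) ** matrix_inv (ricc C) ** (closed_loop C ** R)"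
    by (simp only: matrix_mul_assoc)
  also have "\<dots> = R' ** (P ** transpose A ** matrix_inv (ricc C) ** A ** P) ** R'"
    by (simp only: BR RB matrix_mul_assoc)
  also have "\<dots> = R' ** P ** R' - R' ** Z ** R'" unfolding PW by (simp add: matrix_ring_simps)
  also have "R' ** P ** R' = mat 1 - R ** transpose H ** matrix_inv (innov C) ** H ** R"
  proof -
    have R'C: "R' ** C = R" by (simp add: RR[symmetric] matrix_mul_assoc inv)
    have CR': "C ** R' = R" by (simp add: RR[symmetric] matrix_mul_assoc[symmetric] inv)
    have "R' ** P ** R' = (R' ** C) ** R' - (R' ** C) ** transpose H ** matrix_inv (innov C) ** H ** (C ** R')"
      by (simp add: P_def matrix_ring_simps)
    then show ?thesis unfolding R'C CR' by (simp add: inv)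
  qed
  finally show ?thesis
    by (simp add: rate_matrix_def R_def[symmetric] R'_def[symmetric] Z_def J_def)
qed

lemma rate_matrix_quadratic:
  assumes "pos_def C"
  defines "R \<equiv> psd_sqrt C"
  shows "(closed_loop C *v (R *v x)) \<bullet> (matrix_inv (ricc C) *v (closed_loop C *v (R *v x)))
    = (norm x)\<^sup>2 - x \<bullet> (rate_matrix C *v x)"
proof -
  let ?B = "closed_loop C ** R"
  have R: "transpose R = R"
    unfolding R_def by (rule transpose_psd_sqrt[OF pos_def_imp_pos_semidef[OF assms(1)]])
  have "(closed_loop C *v (R *v x)) \<bullet> (matrix_inv (ricc C) *v (closed_loop C *v (R *v x)))
      = x \<bullet> ((transpose ?B ** matrix_inv (ricc C) ** ?B) *v x)"
    using congruence_quadratic[of x "transpose ?B" "matrix_inv (ricc C)"]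
    by (simp add: matrix_vector_mul_assoc del: transpose_matrix_vector)
  also have "transpose ?B ** matrix_inv (ricc C) ** ?B = mat 1 - rate_matrix C"
    using rate_matrix_eq[OF assms(1)]
    by (simp add: matrix_transpose_mul R matrix_mul_assoc R_def[symmetric] del: transpose_matrix_vector)
  finally show ?thesis
    by (simp add: matrix_vector_mult_diff_rdistrib inner_diff_right power2_norm_eq_inner)
qed

text \<open>The first summand of the rate matrix is only semidefinite in general, as
  \<open>H\<close> may have a kernel. Strict positivity and the lower estimate come from the second
  summand.\<close>

lemma
  assumes "pos_def C"
  shows pos_def_rate_matrix: "pos_def (rate_matrix C)"
    and rate_matrix_ge: "(matrix_inv (psd_sqrt C) *v v) \<bullet> (matrix_inv (matrix_inv C
        + transpose H ** matrix_inv \<Gamma> ** H + transpose A ** matrix_inv \<Sigma> ** A) *v (matrix_inv (psd_sqrt C) *v v))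
      \<le> v \<bullet> (rate_matrix C *v v)"
proof -
  let ?R = "psd_sqrt C" and ?R' = "matrix_inv (psd_sqrt C)"
  let ?Z = "matrix_inv (matrix_inv C + transpose H ** matrix_inv \<Gamma> ** H + transpose A ** matrix_inv \<Sigma> ** A)"
  have psd: "pos_semidef C" by (rule pos_def_imp_pos_semidef[OF assms])
  have "pos_semidef (transpose (H ** ?R) ** matrix_inv (innov C) ** (H ** ?R))"
    by (intro pos_semidef_congruence' pos_def_imp_pos_semidef pos_def_matrix_inv pos_def_innov psd)
  then have 1: "pos_semidef (?R ** transpose H ** matrix_inv (innov C) ** H ** ?R)"
    by (simp add: matrix_transpose_mul transpose_psd_sqrt[OF psd] matrix_mul_assoc
        del: transpose_matrix_vector)
  have "pos_def (?R' ** ?Z ** transpose ?R')"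
    by (intro pos_def_congruence pos_def_matrix_inv pos_def_information assms
        invertible_matrix_inv invertible_psd_sqrt)
  from pos_def_add[OF this 1] show "pos_def (rate_matrix C)"
    by (simp add: rate_matrix_def psd_sqrt_inv_facts(1)[OF assms] add.commute)
  have "v \<bullet> ((?R' ** ?Z ** transpose ?R') *v v) \<le> v \<bullet> (rate_matrix C *v v)"
    using pos_semidefD(2)[OF 1, of v]
    by (simp add: rate_matrix_def psd_sqrt_inv_facts(1)[OF assms] matrix_vector_mult_add_rdistrib
        inner_add_right)
  then show "(?R' *v v) \<bullet> (?Z *v (?R' *v v)) \<le> v \<bullet> (rate_matrix C *v v)"
    using congruence_quadratic[of v ?R' ?Z] by (simp only: psd_sqrt_inv_facts(1)[OF assms])
qed

lemma beta_pos: "pos_def C \<Longrightarrow> 0 < beta C"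
  unfolding beta_eq by (intro lambda_min_pos pos_def_rate_matrix)

text \<open>At an eigenvector for \<open>beta C\<close> the nonnegative form of
  \<open>rate_matrix_quadratic\<close> equals \<open>1 - beta C\<close> times the squared norm. The
  contraction factor must be nonnegative for its square root to be used with
  \<open>W2\<close>.\<close>

lemma beta_le_1:
  assumes "pos_def C" shows "beta C \<le> 1"
proof -
  obtain x where x: "x \<noteq> 0" "rate_matrix C *v x = beta C *\<^sub>R x"
    unfolding beta_eq using lambda_min_symmetric(1)[OF pos_defD(1)[OF pos_def_rate_matrix[OF assms]]]
    by blast
  have "0 \<le> (norm x)\<^sup>2 - x \<bullet> (rate_matrix C *v x)"
    unfolding rate_matrix_quadratic[OF assms, symmetric]
    by (intro pos_semidefD(2) pos_def_imp_pos_semidef pos_def_matrix_inv pos_def_ricc assms)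
  also have "\<dots> = (1 - beta C) * (norm x)\<^sup>2"
    by (simp add: x(2) power2_norm_eq_inner algebra_simps)
  finally show ?thesis using x(1) by (simp add: zero_le_mult_iff)
qed

lemma closed_loop_contraction:
  assumes "pos_def C"
  shows "weighted_norm_sq (ricc C) (closed_loop C *v v) \<le> (1 - beta C) * weighted_norm_sq C v"
proof -
  define x where "x = matrix_inv (psd_sqrt C) *v v"
  have v: "psd_sqrt C *v x = v"
    unfolding x_def by (rule matrix_vector_inv(1)[OF invertible_psd_sqrt[OF assms]])
  have "weighted_norm_sq (ricc C) (closed_loop C *v v) = (norm x)\<^sup>2 - x \<bullet> (rate_matrix C *v x)"
    using rate_matrix_quadratic[OF assms, of x] unfolding v by (simp add: weighted_norm_sq_def)
  also have "\<dots> \<le> (norm x)\<^sup>2 - beta C * (norm x)\<^sup>2"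
    unfolding beta_eq
    using lambda_min_symmetric(2)[OF pos_defD(1)[OF pos_def_rate_matrix[OF assms]]] by simp
  also have "\<dots> = (1 - beta C) * (norm x)\<^sup>2" by (simp add: algebra_simps)
  also have "(norm x)\<^sup>2 = weighted_norm_sq C v"
    by (simp add: x_def weighted_norm_sq_def psd_sqrt_inv_facts(2)[OF assms])
  finally show ?thesis .
qed

text \<open>The upper bound on \<open>C\<close> makes \<open>C\<close> to the power -1/2 expand by
  at least \<open>1 / sqrt c\<close>, and the lower bound on \<open>C\<close> bounds the matrix
  inverted in the second summand of the rate matrix.\<close>

lemma beta_lower_bound:
  assumes "0 < s" "0 < c"
  obtains b where "0 < b" "b \<le> 1"
    "\<And>C. pos_def C \<Longrightarrow> (\<And>v. s * (norm v)\<^sup>2 \<le> v \<bullet> (C *v v)) \<Longrightarrow>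
      (\<And>v. v \<bullet> (C *v v) \<le> c * (norm v)\<^sup>2) \<Longrightarrow> b \<le> beta C"
proof -
  obtain h where h: "0 < h" "\<And>v. \<bar>v \<bullet> ((transpose H ** matrix_inv \<Gamma> ** H) *v v)\<bar> \<le> h * (norm v)\<^sup>2"
    using quadratic_upper_bound by blast
  obtain a where a: "0 < a" "\<And>v. \<bar>v \<bullet> ((transpose A ** matrix_inv \<Sigma> ** A) *v v)\<bar> \<le> a * (norm v)\<^sup>2"
    using quadratic_upper_bound by blast
  \<comment> \<open>One bound for each summand of the inverted matrix: \<open>C\<close> inverse, the
    observation term and the signal term.\<close>
  define m where "m = 1 / s + h + a"
  have m: "0 < m" using assms h a by (simp add: m_def add_pos_pos)
  have "1 / (m * c) \<le> beta C" if C: "pos_def C" "\<And>v. s * (norm v)\<^sup>2 \<le> v \<bullet> (C *v v)"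
    "\<And>v. v \<bullet> (C *v v) \<le> c * (norm v)\<^sup>2" for C
    unfolding beta_eq
  proof (rule lambda_min_ge)
    show "transpose (rate_matrix C) = rate_matrix C"
      by (rule pos_defD(1)[OF pos_def_rate_matrix[OF C(1)]])
    let ?T = "matrix_inv C + transpose H ** matrix_inv \<Gamma> ** H + transpose A ** matrix_inv \<Sigma> ** A"
    have T: "v \<bullet> (?T *v v) \<le> m * (norm v)\<^sup>2" for v
    proof -
      have "v \<bullet> (matrix_inv C *v v) \<le> (norm v)\<^sup>2 / s"
        by (rule matrix_inv_quadratic_le[OF C(1,2) assms(1)])
      moreover have "m * (norm v)\<^sup>2 = (norm v)\<^sup>2 / s + h * (norm v)\<^sup>2 + a * (norm v)\<^sup>2"
        by (simp add: m_def algebra_simps)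
      ultimately show ?thesis
        using h(2)[of v] a(2)[of v]
        unfolding matrix_vector_mult_add_rdistrib inner_add_right by linarith
    qed
    fix v
    let ?u = "matrix_inv (psd_sqrt C) *v v"
    have "(norm v)\<^sup>2 / c \<le> (norm ?u)\<^sup>2"
      unfolding psd_sqrt_inv_facts(2)[OF C(1)]
      by (rule matrix_inv_quadratic_ge[OF C(1,3) assms(2)])
    then have "(norm v)\<^sup>2 / c / m \<le> (norm ?u)\<^sup>2 / m"
      using m by (intro divide_right_mono) auto
    also have "\<dots> \<le> ?u \<bullet> (matrix_inv ?T *v ?u)"
      by (rule matrix_inv_quadratic_ge[OF pos_def_information(2)[OF C(1)] T m])
    also have "\<dots> \<le> v \<bullet> (rate_matrix C *v v)" by (rule rate_matrix_ge[OF C(1)])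
    finally show "1 / (m * c) * (norm v)\<^sup>2 \<le> v \<bullet> (rate_matrix C *v v)" by (simp add: mult.commute)
  qed
  moreover have "0 < 1 / (m * c)" using m assms by simp
  \<comment> \<open>The cap at 1 keeps \<open>1 - b\<close> nonnegative for the geometric
    iteration.\<close>
  ultimately show ?thesis using that[of "min 1 (1 / (m * c))"] by (simp add: min_le_iff_disj)
qed

text \<open>
  With \<open>N = R\<^sup>-\<^sup>1 B R\<close> for \<open>R = psd_sqrt C\<close> and the closed loop matrix \<open>B\<close>, the two matrices are
  \<open>I - N\<^sup>T N\<close> and \<open>I - N N\<^sup>T\<close>; they have the same eigenvalues because \<open>N\<close> is invertible.
\<close>

lemma beta_stable_cov:
  assumes A: "invertible A" and C: "is_stable_cov A H \<Sigma> \<Gamma> C"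
  shows "beta C = lambda_min (matrix_inv (psd_sqrt C)
    ** (\<Sigma> + gain C ** \<Gamma> ** transpose (gain C)) ** matrix_inv (psd_sqrt C))"
proof -
  define R where "R = psd_sqrt C"
  define R' where "R' = matrix_inv R"
  define B where "B = closed_loop C"
  define N where "N = R' ** B ** R"
  have pd: "pos_def C" by (rule stable_cov_ge_Sigma(2)[OF C])
  have psd: "pos_semidef C" and fix_eq: "ricc C = C" using C by (simp_all add: is_stable_cov_def)
  have invR: "invertible R" unfolding R_def by (rule invertible_psd_sqrt[OF pd])
  have RR: "R ** R = C" unfolding R_def by (rule psd_sqrt_mult_self[OF psd])
  have symR: "transpose R = R" unfolding R_def by (rule transpose_psd_sqrt[OF psd])
  have inv: "R ** R' = mat 1" "R' ** R = mat 1"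
    unfolding R'_def by (simp_all add: matrix_inv_left matrix_inv_right invR)
  have symR': "transpose R' = R'" unfolding R'_def R_def by (rule psd_sqrt_inv_facts(1)[OF pd])
  have R'R': "R' ** R' = matrix_inv C"
  proof -
    have "C ** (R' ** R') = R ** (R ** R') ** R'" by (simp add: RR matrix_mul_assoc)
    then have "C ** (R' ** R') = mat 1" by (simp add: inv)
    then show ?thesis by (metis matrix_inv_unique(2))
  qed
  have "transpose N ** N = R ** transpose B ** (R' ** R') ** B ** R"
    by (simp add: N_def matrix_transpose_mul symR symR' matrix_mul_assoc del: transpose_matrix_vector)
  then have NN: "rate_matrix C = mat 1 - transpose N ** N"
    using rate_matrix_eq[OF pd] by (simp add: R'R' fix_eq R_def B_def)
  have "N ** transpose N = R' ** (B ** C ** transpose B) ** R'"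
    by (simp add: N_def RR[symmetric] matrix_transpose_mul symR symR' matrix_mul_assoc
        del: transpose_matrix_vector)
  also have "B ** C ** transpose B = C - (\<Sigma> + gain C ** \<Gamma> ** transpose (gain C))"
    using ricc_closed_loop[OF psd] by (simp add: fix_eq B_def algebra_simps)
  also have "R' ** \<dots> ** R' = R' ** (R ** R) ** R'
      - R' ** (\<Sigma> + gain C ** \<Gamma> ** transpose (gain C)) ** R'"
    unfolding RR by (simp add: matrix_diff_ldistrib matrix_diff_rdistrib)
  also have "R' ** (R ** R) ** R' = mat 1" by (simp add: matrix_mul_assoc inv)
  finally have NNt: "R' ** (\<Sigma> + gain C ** \<Gamma> ** transpose (gain C)) ** R' = mat 1 - N ** transpose N"
    by (simp add: algebra_simps)
  \<comment> \<open>Invertibility of \<open>A\<close> enters here: it passes to the closed loop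
    because the analysis covariance is invertible.\<close>
  have "B ** C = A ** matrix_inv (matrix_inv C + transpose H ** matrix_inv \<Gamma> ** H)"
    unfolding B_def closed_loop_mult innov_def woodbury[OF pd Gamma] ..
  then have "invertible (B ** C)"
    using A pos_def_invertible[OF pos_def_information(1)[OF pd]]
    by (simp add: invertible_mult invertible_matrix_inv)
  then have "invertible (B ** C ** matrix_inv C)"
    by (rule invertible_mult[OF _ invertible_matrix_inv[OF pos_def_invertible[OF pd]]])
  moreover have "B ** C ** matrix_inv C = B"
    by (simp add: matrix_mul_assoc[symmetric] matrix_inv_right[OF pos_def_invertible[OF pd]])
  ultimately have "invertible B" by simp
  then have invN: "invertible N"
    unfolding N_def R'_def by (intro invertible_mult invertible_matrix_inv invR)
  \<comment> \<open>\<open>K\<close> intertwines the two matrices and carries eigenvectors over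
    without killing them. Using it for \<open>N\<close> and for its transpose gives both inclusions
    of the spectra.\<close>
  have eig: "\<exists>v. v \<noteq> 0 \<and> (mat 1 - K ** transpose K) *v v = l *\<^sub>R v"
    if "invertible K" "v \<noteq> 0" "(mat 1 - transpose K ** K) *v v = l *\<^sub>R v" for K :: "real^'d^'d" and l v
  proof (intro exI[of _ "K *v v"] conjI)
    show "K *v v \<noteq> 0" using that(1,2) matrix_vector_inv(2)[of K v] by auto
    have "(mat 1 - K ** transpose K) ** K = K ** (mat 1 - transpose K ** K)"
      by (simp add: matrix_ring_simps)
    then have "(mat 1 - K ** transpose K) *v (K *v v) = K *v ((mat 1 - transpose K ** K) *v v)"
      by (simp only: matrix_vector_mul_assoc)
    then show "(mat 1 - K ** transpose K) *v (K *v v) = l *\<^sub>R (K *v v)"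
      by (simp add: that(3) matrix_vector_mult_scaleR)
  qed
  have "{l. \<exists>v. v \<noteq> 0 \<and> rate_matrix C *v v = l *\<^sub>R v}
      = {l. \<exists>v. v \<noteq> 0 \<and> (mat 1 - N ** transpose N) *v v = l *\<^sub>R v}"
    unfolding NN using eig[OF invN] eig[OF transpose_invertible[OF invN]] by auto
  then show ?thesis
    unfolding beta_eq R_def[symmetric] R'_def[symmetric] NNt lambda_min_def by simp
qed

end

section \<open>Gaussian moments and covariances\<close>

text \<open>A majorant independent of \<open>t\<close> and integrable whenever exponential moments
  exist, for use in dominated convergence.\<close>

lemma second_difference_exp_bound:
  fixes y t :: real
  assumes "0 < t" "t \<le> 1"
  shows "\<bar>(exp (t * y) + exp (- (t * y)) - 2) / t\<^sup>2\<bar> \<le> 2 * (exp (2 * y) + exp (- (2 * y)))"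
proof -
  \<comment> \<open>The doubled argument makes the expression a perfect square, which settles both
    its sign and its quadratic bound.\<close>
  have pos: "0 \<le> exp (2 * a) + exp (- (2 * a)) - 2 \<and>
      exp (2 * a) + exp (- (2 * a)) - 2 \<le> 4 * a\<^sup>2 * exp (2 * a)" if "0 \<le> a" for a :: real
  proof -
    have eq: "exp (2 * a) + exp (- (2 * a)) - 2 = (exp a - exp (- a))\<^sup>2"
      using exp_double[of a] exp_double[of "- a"] exp_minus_inverse[of a]
      by (simp add: power2_diff mult.assoc)
    have "exp a - exp (- a) = exp a * (1 - exp (- (2 * a)))"
      by (simp add: algebra_simps mult_exp_exp)
    also have "\<dots> \<le> exp a * (2 * a)"
      using exp_ge_add_one_self[of "- (2 * a)"] by (intro mult_left_mono) auto
    finally have "(exp a - exp (- a))\<^sup>2 \<le> (exp a * (2 * a))\<^sup>2"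
      using that by (intro power_mono) auto
    also have "\<dots> = 4 * a\<^sup>2 * exp (2 * a)"
      by (simp add: power_mult_distrib exp_double)
    finally show ?thesis unfolding eq by simp
  qed
  define z where "z = \<bar>t * y\<bar>"
  have sym: "exp (t * y) + exp (- (t * y)) = exp z + exp (- z)"
    unfolding z_def by (simp add: abs_if)
  have z: "0 \<le> z / 2" by (simp add: z_def)
  have "\<bar>(exp (t * y) + exp (- (t * y)) - 2) / t\<^sup>2\<bar> = (exp z + exp (- z) - 2) / t\<^sup>2"
    using pos[OF z] by (simp add: sym)
  also have "\<dots> \<le> z\<^sup>2 * exp z / t\<^sup>2"
    using pos[OF z] by (intro divide_right_mono) (simp_all add: power_divide)
  also have "\<dots> = y\<^sup>2 * exp z"
    using assms(1) by (simp add: z_def power_mult_distrib)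
  also have "\<dots> \<le> y\<^sup>2 * exp \<bar>y\<bar>"
    using assms mult_right_mono[of t 1 "\<bar>y\<bar>"] by (intro mult_left_mono) (auto simp: z_def abs_mult)
  also have "\<dots> \<le> (2 * exp \<bar>y\<bar>) * exp \<bar>y\<bar>"
    using exp_lower_Taylor_quadratic[of "\<bar>y\<bar>"] by (intro mult_right_mono) auto
  also have "\<dots> = 2 * exp (2 * \<bar>y\<bar>)" by (simp add: mult_exp_exp)
  also have "\<dots> \<le> 2 * (exp (2 * y) + exp (- (2 * y)))" by (simp add: abs_if)
  finally show ?thesis .
qed

lemma second_difference_exp_tendsto:
  fixes y :: real
  defines "t \<equiv> \<lambda>n. 1 / real (Suc n)"
  shows "(\<lambda>n. (exp (t n * y) + exp (- (t n * y)) - 2) / (t n)\<^sup>2) \<longlonglongrightarrow> y\<^sup>2"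
  unfolding t_def by real_asymp (simp add: power2_eq_square)

lemma gaussian_second_difference_tendsto:
  fixes q :: real
  defines "t \<equiv> \<lambda>n. 1 / real (Suc n)"
  shows "(\<lambda>n. (2 * exp ((t n)\<^sup>2 * q / 2) - 2) / (t n)\<^sup>2) \<longlonglongrightarrow> q"
  unfolding t_def by real_asymp

text \<open>The second moment is the second derivative of the moment generating function at 0,
  computed here as a limit of symmetric difference quotients.\<close>

lemma (in prob_space) gaussian_mgf_imp_second_moment:
  fixes Y :: "'a \<Rightarrow> real"
  assumes [measurable]: "Y \<in> borel_measurable M"
    and mgf: "\<And>t. integrable M (\<lambda>x. exp (t * Y x))" "\<And>t. (\<integral>x. exp (t * Y x) \<partial>M) = exp (t\<^sup>2 * q / 2)"
  shows "integrable M (\<lambda>x. (Y x)\<^sup>2)" "(\<integral>x. (Y x)\<^sup>2 \<partial>M) = q"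
proof -
  define t where "t n = 1 / real (Suc n)" for n
  define f where "f n x = (exp (t n * Y x) + exp (- (t n * Y x)) - 2) / (t n)\<^sup>2" for n x
  have mgf': "integrable M (\<lambda>x. exp (- (s * Y x)))" "(\<integral>x. exp (- (s * Y x)) \<partial>M) = exp (s\<^sup>2 * q / 2)" for s
    using mgf[of "- s"] by simp_all
  have [measurable]: "f n \<in> borel_measurable M" for n unfolding f_def by measurable
  have dom: "AE x in M. norm (f n x) \<le> 2 * (exp (2 * Y x) + exp (- (2 * Y x)))" for n
    unfolding f_def using second_difference_exp_bound[of "t n"] by (auto simp: t_def)
  have lim: "AE x in M. (\<lambda>n. f n x) \<longlonglongrightarrow> (Y x)\<^sup>2"
    unfolding f_def t_def using second_difference_exp_tendsto by auto
  have int: "integrable M (\<lambda>x. 2 * (exp (2 * Y x) + exp (- (2 * Y x))))"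
    using mgf mgf' by auto
  show "integrable M (\<lambda>x. (Y x)\<^sup>2)"
    by (rule integrable_dominated_convergence[OF _ _ int lim dom]) auto
  have "(\<lambda>n. \<integral>x. f n x \<partial>M) \<longlonglongrightarrow> (\<integral>x. (Y x)\<^sup>2 \<partial>M)"
    by (rule integral_dominated_convergence[OF _ _ int lim dom]) auto
  moreover have "(\<integral>x. f n x \<partial>M) = (2 * exp ((t n)\<^sup>2 * q / 2) - 2) / (t n)\<^sup>2" for n
    unfolding f_def using mgf[of "t n"] mgf'[of "t n"] by (simp add: prob_space)
  ultimately have "(\<lambda>n. (2 * exp ((t n)\<^sup>2 * q / 2) - 2) / (t n)\<^sup>2) \<longlonglongrightarrow> (\<integral>x. (Y x)\<^sup>2 \<partial>M)" by simp
  moreover have "(\<lambda>n. (2 * exp ((t n)\<^sup>2 * q / 2) - 2) / (t n)\<^sup>2) \<longlonglongrightarrow> q"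
    unfolding t_def by (rule gaussian_second_difference_tendsto)
  ultimately show "(\<integral>x. (Y x)\<^sup>2 \<partial>M) = q" by (rule LIMSEQ_unique)
qed

section \<open>Second moments and covariances of measures\<close>

lemma abs_mult_le_sum_squares: "\<bar>a * b\<bar> \<le> a\<^sup>2 + b\<^sup>2" for a b :: real
proof -
  have "2 * (\<bar>a\<bar> * \<bar>b\<bar>) \<le> a\<^sup>2 + b\<^sup>2" using sum_squares_bound[of "\<bar>a\<bar>" "\<bar>b\<bar>"] by simp
  moreover have "0 \<le> \<bar>a\<bar> * \<bar>b\<bar>" by simp
  ultimately show ?thesis unfolding abs_mult by linarith
qed

definition mean :: "(real^'n) measure \<Rightarrow> real^'n" where
  "mean \<mu> = (\<chi> i. \<integral>z. z $ i \<partial>\<mu>)"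

lemma P2D:
  assumes "\<mu> \<in> P2"
  shows "prob_space \<mu>" "sets \<mu> = sets borel" "integrable \<mu> (\<lambda>x. (norm x)\<^sup>2)"
  using assms by (auto simp: P2_def)

lemma P2_integrable_sq:
  assumes "\<mu> \<in> P2" shows "integrable \<mu> (\<lambda>x. (v \<bullet> x + a)\<^sup>2)"
proof -
  interpret prob_space \<mu> by (rule P2D[OF assms])
  have [measurable_cong]: "sets \<mu> = sets borel" by (rule P2D[OF assms])
  show ?thesis
  proof (rule Bochner_Integration.integrable_bound)
    show "integrable \<mu> (\<lambda>x. 2 * (norm v)\<^sup>2 * (norm x)\<^sup>2 + 2 * a\<^sup>2)"
      using P2D(3)[OF assms] by auto
    have "(v \<bullet> x + a)\<^sup>2 \<le> 2 * (norm v)\<^sup>2 * (norm x)\<^sup>2 + 2 * a\<^sup>2" for x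
    proof -
      have "(v \<bullet> x + a)\<^sup>2 \<le> 2 * (v \<bullet> x)\<^sup>2 + 2 * a\<^sup>2"
        using sum_squares_ge_zero[of "v \<bullet> x - a" 0] by (simp add: power2_eq_square algebra_simps)
      also have "(v \<bullet> x)\<^sup>2 \<le> (norm v)\<^sup>2 * (norm x)\<^sup>2"
        using power_mono[OF Cauchy_Schwarz_ineq2[of v x], of 2] by (simp add: power_mult_distrib)
      finally show ?thesis by simp
    qed
    then show "AE x in \<mu>. norm ((v \<bullet> x + a)\<^sup>2) \<le> norm (2 * (norm v)\<^sup>2 * (norm x)\<^sup>2 + 2 * a\<^sup>2)"
      by (intro AE_I2) (smt (verit) norm_of_real real_norm_def zero_le_power2)
  qed measurable
qed

lemma P2_integrable_affine:
  assumes "\<mu> \<in> P2" shows "integrable \<mu> (\<lambda>x. v \<bullet> x + a)"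
proof -
  interpret prob_space \<mu> by (rule P2D[OF assms])
  have [measurable_cong]: "sets \<mu> = sets borel" by (rule P2D[OF assms])
  show ?thesis
    by (rule square_integrable_imp_integrable[OF _ P2_integrable_sq[OF assms]]) measurable
qed

lemma P2_integrable_inner:
  assumes "\<mu> \<in> P2" shows "integrable \<mu> (\<lambda>x. v \<bullet> x)"
  using P2_integrable_affine[OF assms, of v 0] by simp

lemma P2_integrable_component:
  assumes "\<mu> \<in> P2" shows "integrable \<mu> (\<lambda>x. x $ i)"
  using P2_integrable_inner[OF assms, of "axis i 1"] by (simp add: inner_axis inner_commute)

lemma integral_inner_mean:
  assumes "\<mu> \<in> P2" shows "(\<integral>x. v \<bullet> x \<partial>\<mu>) = v \<bullet> mean \<mu>"
  by (simp add: inner_vec_def mean_def P2_integrable_component[OF assms])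

lemma P2I:
  fixes \<mu> :: "(real^'n) measure"
  assumes "prob_space \<mu>" "sets \<mu> = sets borel" "\<And>v. integrable \<mu> (\<lambda>x. (v \<bullet> x)\<^sup>2)"
  shows "\<mu> \<in> P2"
proof -
  have "integrable \<mu> (\<lambda>x. \<Sum>i\<in>UNIV. (x $ i)\<^sup>2)"
    using assms(3)[of "axis _ 1"] by (auto simp: inner_axis inner_commute[of "axis _ _"])
  then have "integrable \<mu> (\<lambda>x. (norm x)\<^sup>2)"
    by (simp add: norm_vec_def L2_set_def sum_nonneg)
  with assms show ?thesis by (simp add: P2_def)
qed

lemma transpose_Cov: "transpose (Cov \<mu>) = Cov \<mu>"
  by (simp add: transpose_def Cov_def vec_eq_iff mult.commute)

text \<open>The form of the covariance matrix at \<open>v\<close> is the variance of the projection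
  to \<open>v\<close>; all covariance computations are thereby reduced to real random
  variables.\<close>

lemma Cov_quadratic:
  fixes \<mu> :: "(real^'n) measure"
  assumes "\<mu> \<in> P2"
  shows "v \<bullet> (Cov \<mu> *v v) = (\<integral>x. (v \<bullet> (x - mean \<mu>))\<^sup>2 \<partial>\<mu>)"
proof -
  have [measurable_cong]: "sets \<mu> = sets borel" by (rule P2D[OF assms])
  have int: "integrable \<mu> (\<lambda>x. (x $ i - mean \<mu> $ i) * (x $ j - mean \<mu> $ j))" for i j
  proof (rule Bochner_Integration.integrable_bound)
    have "integrable \<mu> (\<lambda>x. (x $ i - mean \<mu> $ i)\<^sup>2)" for i
      using P2_integrable_sq[OF assms, of "axis i 1" "- mean \<mu> $ i"]
      by (simp add: inner_axis inner_commute[of "axis _ _"])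
    then show "integrable \<mu> (\<lambda>x. (x $ i - mean \<mu> $ i)\<^sup>2 + (x $ j - mean \<mu> $ j)\<^sup>2)" by auto
    show "AE x in \<mu>. norm ((x $ i - mean \<mu> $ i) * (x $ j - mean \<mu> $ j))
        \<le> norm ((x $ i - mean \<mu> $ i)\<^sup>2 + (x $ j - mean \<mu> $ j)\<^sup>2)"
      by (intro AE_I2) (simp add: abs_mult_le_sum_squares del: abs_mult)
  qed measurable
  have "(\<integral>x. (v \<bullet> (x - mean \<mu>))\<^sup>2 \<partial>\<mu>)
      = (\<integral>x. (\<Sum>i\<in>UNIV. \<Sum>j\<in>UNIV. v $ i * v $ j * ((x $ i - mean \<mu> $ i) * (x $ j - mean \<mu> $ j))) \<partial>\<mu>)"
    by (simp add: power2_eq_square inner_vec_def sum_product mult_ac)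
  also have "\<dots> = (\<Sum>i\<in>UNIV. \<Sum>j\<in>UNIV. v $ i * v $ j * (\<integral>x. (x $ i - mean \<mu> $ i) * (x $ j - mean \<mu> $ j) \<partial>\<mu>))"
    using int by simp
  also have "\<dots> = v \<bullet> (Cov \<mu> *v v)"
    by (simp add: inner_vec_def matrix_vector_mult_def Cov_def mean_def sum_distrib_left mult_ac)
  finally show ?thesis by simp
qed

lemma pos_semidef_Cov: "\<mu> \<in> P2 \<Longrightarrow> pos_semidef (Cov \<mu>)"
  unfolding pos_semidef_def by (simp add: transpose_Cov Cov_quadratic)

lemma Cov_eqI:
  assumes "\<mu> \<in> P2" "transpose S = S" "\<And>v. (\<integral>x. (v \<bullet> (x - mean \<mu>))\<^sup>2 \<partial>\<mu>) = v \<bullet> (S *v v)"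
  shows "Cov \<mu> = S"
  by (rule symmetric_eqI[OF transpose_Cov assms(2)]) (simp add: Cov_quadratic[OF assms(1)] assms(3))

text \<open>Normalisation is not part of the definition. The lemmas below take it as a hypothesis,
  which a random variable with this density supplies.\<close>

definition gaussian_law :: "real^'n^'n \<Rightarrow> (real^'n) measure" where
  "gaussian_law S = density lborel (gaussian_density S)"

lemma lborel_distr_uminus_euclidean: "distr lborel borel uminus = (lborel :: 'a::euclidean_space measure)"
  by (subst lborel_affine[of "-1" 0]) (auto simp: density_1 one_ennreal_def[symmetric])

lemma gaussian_density_measurable[measurable]: "gaussian_density S \<in> borel_measurable borel"
proof -
  have "(\<lambda>x. x \<bullet> (matrix_inv S *v x)) \<in> borel_measurable borel"
    by (intro borel_measurable_continuous_onI continuous_intros linear_continuous_on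
        matrix_vector_mul_bounded_linear)
  then show ?thesis unfolding gaussian_density_def by measurable
qed

lemma prob_space_distributed_law:
  assumes "prob_space M" "distributed M lborel X (gaussian_density S)"
  shows "law M X = gaussian_law S" "X \<in> borel_measurable M" "prob_space (gaussian_law S)"
proof -
  interpret prob_space M by fact
  show X: "X \<in> borel_measurable M" using distributed_measurable[OF assms(2)] by simp
  have "law M X = distr M lborel X" by (rule distr_cong) simp_all
  then show L: "law M X = gaussian_law S"
    using distributed_distr_eq_density[OF assms(2)] by (simp add: gaussian_law_def)
  show "prob_space (gaussian_law S)" unfolding L[symmetric] by (rule prob_space_distr[OF X])
qed

text \<open>
  The normalisation of the density determines the moment generating function, by translation
  invariance of the Lebesgue measure: \<open>p (S v + x) = p x exp (- v \<bullet> x) exp (- v \<bullet> S v / 2)\<close>.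
\<close>

lemma gaussian_law_mgf:
  fixes S :: "real^'n^'n"
  assumes S: "pos_def S" and prob: "prob_space (gaussian_law S)"
  shows "has_bochner_integral (gaussian_law S) (\<lambda>x. exp (- (v \<bullet> x))) (exp (v \<bullet> (S *v v) / 2))"
proof -
  have sym: "transpose (matrix_inv S) = matrix_inv S" by (rule pos_defD(1)[OF pos_def_matrix_inv[OF S]])
  define u where "u = S *v v"
  have Qu: "matrix_inv S *v u = v"
    unfolding u_def by (rule matrix_vector_inv(2)[OF pos_def_invertible[OF S]])
  have uQ: "u \<bullet> (matrix_inv S *v x) = v \<bullet> x" for x
    using inner_matrix_vector_mult[of u "matrix_inv S" x] unfolding sym Qu .
  have shift: "gaussian_density S (u + x)
      = gaussian_density S x * ennreal (exp (- (v \<bullet> x))) * ennreal (exp (- (v \<bullet> (S *v v)) / 2))" for x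
  proof -
    have "- ((u + x) \<bullet> (matrix_inv S *v (u + x))) / 2
        = - (x \<bullet> (matrix_inv S *v x)) / 2 + - (v \<bullet> x) + - (v \<bullet> (S *v v)) / 2"
      by (simp add: matrix_vector_right_distrib inner_add_left inner_add_right Qu uQ inner_commute[of x v])
        (simp add: u_def inner_commute field_simps)
    then have "exp (- ((u + x) \<bullet> (matrix_inv S *v (u + x))) / 2)
        = exp (- (x \<bullet> (matrix_inv S *v x)) / 2) * exp (- (v \<bullet> x)) * exp (- (v \<bullet> (S *v v)) / 2)"
      by (simp only: exp_add)
    then show ?thesis
      unfolding gaussian_density_def by (simp add: ennreal_mult''[symmetric])
  qed
  have one: "(\<integral>\<^sup>+x. gaussian_density S x \<partial>lborel) = 1"
    using prob_space.emeasure_space_1[OF prob] by (simp add: gaussian_law_def emeasure_density)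
  have "1 = (\<integral>\<^sup>+x. gaussian_density S x \<partial>distr lborel borel ((+) u))"
    by (simp add: lborel_distr_plus one)
  also have "\<dots> = (\<integral>\<^sup>+x. gaussian_density S x * ennreal (exp (- (v \<bullet> x))) * ennreal (exp (- (v \<bullet> (S *v v)) / 2)) \<partial>lborel)"
    by (simp add: nn_integral_distr shift)
  also have "\<dots> = (\<integral>\<^sup>+x. ennreal (exp (- (v \<bullet> x))) \<partial>gaussian_law S) * ennreal (exp (- (v \<bullet> (S *v v)) / 2))"
    by (simp add: nn_integral_multc gaussian_law_def nn_integral_density)
  finally have norm: "1 = (\<integral>\<^sup>+x. ennreal (exp (- (v \<bullet> x))) \<partial>gaussian_law S) * ennreal (exp (- (v \<bullet> (S *v v)) / 2))" .
  have "ennreal (exp (v \<bullet> (S *v v) / 2))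
      = (\<integral>\<^sup>+x. ennreal (exp (- (v \<bullet> x))) \<partial>gaussian_law S) * (ennreal (exp (- (v \<bullet> (S *v v)) / 2)) * ennreal (exp (v \<bullet> (S *v v) / 2)))"
    using arg_cong[OF norm, of "\<lambda>z. z * ennreal (exp (v \<bullet> (S *v v) / 2))"]
    by (simp only: mult.assoc mult_1_left)
  also have "ennreal (exp (- (v \<bullet> (S *v v)) / 2)) * ennreal (exp (v \<bullet> (S *v v) / 2)) = 1"
    by (simp add: ennreal_mult''[symmetric] mult_exp_exp)
  finally show ?thesis
    by (intro has_bochner_integral_nn_integral) (auto simp: gaussian_law_def)
qed

lemma gaussian_law_P2:
  fixes S :: "real^'n^'n"
  assumes S: "pos_def S" and prob: "prob_space (gaussian_law S)"
  shows "gaussian_law S \<in> P2" "mean (gaussian_law S) = 0" "Cov (gaussian_law S) = S"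
proof -
  interpret prob_space "gaussian_law S" by fact
  have sets[measurable_cong]: "sets (gaussian_law S) = sets borel" by (simp add: gaussian_law_def)
  have "has_bochner_integral (gaussian_law S) (\<lambda>x. exp (- (c * (v \<bullet> x)))) (exp (c\<^sup>2 * (v \<bullet> (S *v v)) / 2))"
    for c v
    using gaussian_law_mgf[OF S prob, of "c *\<^sub>R v"]
    by (simp add: matrix_vector_mult_scaleR power2_eq_square mult.assoc)
  from this[of "- _"] have mgf: "integrable (gaussian_law S) (\<lambda>x. exp (t * (v \<bullet> x)))"
    "(\<integral>x. exp (t * (v \<bullet> x)) \<partial>gaussian_law S) = exp (t\<^sup>2 * (v \<bullet> (S *v v)) / 2)" for t v
    by (simp_all add: has_bochner_integral_iff)
  have sq: "integrable (gaussian_law S) (\<lambda>x. (v \<bullet> x)\<^sup>2)"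
    "(\<integral>x. (v \<bullet> x)\<^sup>2 \<partial>gaussian_law S) = v \<bullet> (S *v v)" for v
    by (rule gaussian_mgf_imp_second_moment[OF _ mgf]; measurable)+
  show P2: "gaussian_law S \<in> P2" by (rule P2I[OF prob sets sq(1)])
  \<comment> \<open>The density is even, so reflecting Lebesgue measure shows that the integral
    equals its own negative.\<close>
  have "v \<bullet> mean (gaussian_law S) = 0" for v
  proof -
    define p where "p x = enn2real (gaussian_density S x)" for x
    have "matrix_inv S *v (- x) = - (matrix_inv S *v x)" for x
      using matrix_vector_mult_scaleR[of "matrix_inv S" "-1" x] by simp
    then have p: "gaussian_density S x = ennreal (p x)" "p (- x) = p x" for x
      by (simp_all add: p_def gaussian_density_def ennreal_enn2real)
    have [measurable]: "p \<in> borel_measurable borel" unfolding p_def by measurable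
    have L: "gaussian_law S = density lborel (\<lambda>x. ennreal (p x))"
      unfolding gaussian_law_def by (rule arg_cong[where f = "density lborel"]) (rule ext, rule p(1))
    have "(\<integral>x. v \<bullet> x \<partial>gaussian_law S) = (\<integral>x. p x *\<^sub>R (v \<bullet> x) \<partial>lborel)"
      unfolding L by (rule integral_density) (auto simp: p_def)
    also have "\<dots> = (\<integral>x. p x *\<^sub>R (v \<bullet> x) \<partial>distr lborel borel uminus)"
      by (simp only: lborel_distr_uminus_euclidean)
    also have "\<dots> = (\<integral>x. - (p x *\<^sub>R (v \<bullet> x)) \<partial>lborel)"
      by (subst integral_distr) (auto simp: p)
    also have "\<dots> = - (\<integral>x. p x *\<^sub>R (v \<bullet> x) \<partial>lborel)" by (rule integral_minus)
    also have "(\<integral>x. p x *\<^sub>R (v \<bullet> x) \<partial>lborel) = (\<integral>x. v \<bullet> x \<partial>gaussian_law S)"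
      unfolding L by (rule integral_density[symmetric]) (auto simp: p_def)
    finally show ?thesis using integral_inner_mean[OF P2, of v] by simp
  qed
  then show mean: "mean (gaussian_law S) = 0" by (metis inner_eq_zero_iff)
  show "Cov (gaussian_law S) = S"
    by (rule Cov_eqI[OF P2 pos_defD(1)[OF S]]) (simp add: mean sq)
qed

section \<open>Affine images with independent noise\<close>

text \<open>One filter step at the level of laws: the product measure encodes independence of state
  and noise, so no common probability space is required.\<close>

definition affine_law :: "real^'m^'n \<Rightarrow> real^'n \<Rightarrow> (real^'m) measure \<Rightarrow> (real^'n) measure \<Rightarrow> (real^'n) measure" where
  "affine_law B c \<pi> N = distr (\<pi> \<Otimes>\<^sub>M N) borel (\<lambda>(x, w). B *v x + w + c)"

lemma matrix_vector_mult_measurable[measurable]: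
  fixes B :: "real^'m^'n"
  assumes [measurable]: "f \<in> borel_measurable M"
  shows "(\<lambda>x. B *v f x) \<in> borel_measurable M"
  by (rule borel_measurable_continuous_on[OF _ assms])
    (intro linear_continuous_on matrix_vector_mul_bounded_linear)

lemma distr_pair_snd:
  assumes "prob_space M" "prob_space N"
  shows "distr (M \<Otimes>\<^sub>M N) N snd = N"
proof -
  interpret M: prob_space M by fact
  interpret N: prob_space N by fact
  interpret pair_prob_space M N ..
  have "N = distr (N \<Otimes>\<^sub>M M) N fst" by (simp add: M.distr_pair_fst)
  also have "N \<Otimes>\<^sub>M M = distr (M \<Otimes>\<^sub>M N) (N \<Otimes>\<^sub>M M) (\<lambda>(x, y). (y, x))"
    by (rule pair_sigma_finite.distr_pair_swap) (unfold_locales)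
  also have "distr \<dots> N fst = distr (M \<Otimes>\<^sub>M N) N snd"
    by (subst distr_distr) (auto intro!: distr_cong)
  finally show ?thesis by simp
qed

lemma integral_pair_fst:
  fixes f :: "'a \<Rightarrow> real"
  assumes "prob_space M" "prob_space N" "f \<in> borel_measurable M"
  shows "integrable (M \<Otimes>\<^sub>M N) (\<lambda>p. f (fst p)) \<longleftrightarrow> integrable M f"
    "(\<integral>p. f (fst p) \<partial>(M \<Otimes>\<^sub>M N)) = (\<integral>x. f x \<partial>M)"
  using integrable_distr_eq[of fst "M \<Otimes>\<^sub>M N" M f] integral_distr[of fst "M \<Otimes>\<^sub>M N" M f]
    prob_space.distr_pair_fst[OF assms(2), of M] assms(3) by auto

lemma integral_pair_snd:
  fixes f :: "'b \<Rightarrow> real"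
  assumes "prob_space M" "prob_space N" "f \<in> borel_measurable N"
  shows "integrable (M \<Otimes>\<^sub>M N) (\<lambda>p. f (snd p)) \<longleftrightarrow> integrable N f"
    "(\<integral>p. f (snd p) \<partial>(M \<Otimes>\<^sub>M N)) = (\<integral>x. f x \<partial>N)"
  using integrable_distr_eq[of snd "M \<Otimes>\<^sub>M N" N f] integral_distr[of snd "M \<Otimes>\<^sub>M N" N f]
    distr_pair_snd[OF assms(1,2)] assms(3) by auto

lemma integral_pair_sum_sq:
  fixes f :: "'a \<Rightarrow> real" and g :: "'b \<Rightarrow> real"
  assumes M: "prob_space M" and N: "prob_space N"
    and f[measurable]: "f \<in> borel_measurable M" and g[measurable]: "g \<in> borel_measurable N"
    and int: "integrable M (\<lambda>x. (f x)\<^sup>2)" "integrable N (\<lambda>y. (g y)\<^sup>2)"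
  shows "integrable (M \<Otimes>\<^sub>M N) (\<lambda>p. (f (fst p) + g (snd p))\<^sup>2)"
    and "(\<integral>y. g y \<partial>N) = 0 \<Longrightarrow>
      (\<integral>p. (f (fst p) + g (snd p))\<^sup>2 \<partial>(M \<Otimes>\<^sub>M N)) = (\<integral>x. (f x)\<^sup>2 \<partial>M) + (\<integral>y. (g y)\<^sup>2 \<partial>N)"
proof -
  interpret M: prob_space M by fact
  interpret N: prob_space N by fact
  interpret P: pair_sigma_finite M N ..
  note fst_int = integral_pair_fst[OF M N, of "\<lambda>x. (f x)\<^sup>2", simplified]
  note snd_int = integral_pair_snd[OF M N, of "\<lambda>y. (g y)\<^sup>2", simplified]
  have i1: "integrable (M \<Otimes>\<^sub>M N) (\<lambda>p. (f (fst p))\<^sup>2)" "integrable (M \<Otimes>\<^sub>M N) (\<lambda>p. (g (snd p))\<^sup>2)"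
    using int fst_int snd_int by auto
  have prod: "integrable (M \<Otimes>\<^sub>M N) (\<lambda>p. f (fst p) * g (snd p))"
  proof (rule Bochner_Integration.integrable_bound)
    show "integrable (M \<Otimes>\<^sub>M N) (\<lambda>p. (f (fst p))\<^sup>2 + (g (snd p))\<^sup>2)" using i1 by auto
    show "AE p in M \<Otimes>\<^sub>M N. norm (f (fst p) * g (snd p)) \<le> norm ((f (fst p))\<^sup>2 + (g (snd p))\<^sup>2)"
      by (intro AE_I2) (simp add: abs_mult_le_sum_squares del: abs_mult)
  qed measurable
  have eq: "(f (fst p) + g (snd p))\<^sup>2 = (f (fst p))\<^sup>2 + (g (snd p))\<^sup>2 + 2 * (f (fst p) * g (snd p))" for p
    by (simp add: power2_sum)
  show "integrable (M \<Otimes>\<^sub>M N) (\<lambda>p. (f (fst p) + g (snd p))\<^sup>2)"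
    unfolding eq using i1 prod by auto
  assume g0: "(\<integral>y. g y \<partial>N) = 0"
  \<comment> \<open>Integrating the second coordinate first kills the cross term, since
    \<open>g\<close> is centred.\<close>
  have "(\<integral>p. f (fst p) * g (snd p) \<partial>(M \<Otimes>\<^sub>M N)) = 0"
    using P.integral_fst'[OF prod] g0 by simp
  then show "(\<integral>p. (f (fst p) + g (snd p))\<^sup>2 \<partial>(M \<Otimes>\<^sub>M N)) = (\<integral>x. (f x)\<^sup>2 \<partial>M) + (\<integral>y. (g y)\<^sup>2 \<partial>N)"
    unfolding eq using i1 prod fst_int(2) snd_int(2) by simp
qed

text \<open>The projection to \<open>v\<close> splits into independent parts: the projection of the
  state to \<open>transpose B *v v\<close> and that of the noise to \<open>v\<close>. After
  centring, their variances add.\<close>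

lemma affine_law_P2:
  fixes B :: "real^'m^'n"
  assumes pi: "\<pi> \<in> P2" and N: "N \<in> P2"
  shows "affine_law B c \<pi> N \<in> P2"
    and "Cov (affine_law B c \<pi> N) = B ** Cov \<pi> ** transpose B + Cov N"
proof -
  interpret M: prob_space \<pi> by (rule P2D[OF pi])
  interpret N: prob_space N by (rule P2D[OF N])
  interpret P: pair_prob_space \<pi> N ..
  let ?\<rho> = "affine_law B c \<pi> N"
  have [measurable_cong]: "sets \<pi> = sets borel" "sets N = sets borel"
    using P2D[OF pi] P2D[OF N] by auto
  have map[measurable]: "(\<lambda>(x, w). B *v x + w + c) \<in> borel_measurable (\<pi> \<Otimes>\<^sub>M N)" by measurable
  have prob: "prob_space ?\<rho>" unfolding affine_law_def by (rule P.prob_space_distr[OF map])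
  have sets: "sets ?\<rho> = sets borel" by (simp add: affine_law_def)
  \<comment> \<open>The added 0 gives both brackets the affine shape expected by
    \<open>P2_integrable_sq\<close>.\<close>
  have split: "v \<bullet> (B *v x + w + c) + a = ((transpose B *v v) \<bullet> x + (v \<bullet> c + a)) + (v \<bullet> w + 0)" for v x w a
    by (simp add: inner_add_right inner_matrix_vector_mult del: transpose_matrix_vector)
  have integral_eq: "(\<integral>z. f z \<partial>?\<rho>) = (\<integral>p. f (B *v fst p + snd p + c) \<partial>(\<pi> \<Otimes>\<^sub>M N))"
    "integrable ?\<rho> f \<longleftrightarrow> integrable (\<pi> \<Otimes>\<^sub>M N) (\<lambda>p. f (B *v fst p + snd p + c))"
    if [measurable]: "f \<in> borel_measurable borel" for f :: "real^'n \<Rightarrow> real"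
    unfolding affine_law_def using integral_distr[OF map that] integrable_distr_eq[OF map that]
    by (simp_all add: case_prod_unfold)
  show P2: "?\<rho> \<in> P2"
  proof (rule P2I[OF prob sets])
    fix v
    have "integrable (\<pi> \<Otimes>\<^sub>M N) (\<lambda>p. (((transpose B *v v) \<bullet> fst p + (v \<bullet> c + 0)) + (v \<bullet> snd p + 0))\<^sup>2)"
      by (rule integral_pair_sum_sq(1)[OF M.prob_space_axioms N.prob_space_axioms _ _
            P2_integrable_sq[OF pi] P2_integrable_sq[OF N]]) measurable
    then show "integrable ?\<rho> (\<lambda>x. (v \<bullet> x)\<^sup>2)"
      unfolding split[symmetric] by (simp add: integral_eq)
  qed
  have mean: "v \<bullet> mean ?\<rho> = (transpose B *v v) \<bullet> mean \<pi> + v \<bullet> c + v \<bullet> mean N" for v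
  proof -
    have "v \<bullet> mean ?\<rho> = (\<integral>p. v \<bullet> (B *v fst p + snd p + c) + 0 \<partial>(\<pi> \<Otimes>\<^sub>M N))"
      by (simp add: integral_inner_mean[OF P2, symmetric] integral_eq)
    also have "\<dots> = (\<integral>p. ((transpose B *v v) \<bullet> fst p + (v \<bullet> c + 0)) + (v \<bullet> snd p + 0) \<partial>(\<pi> \<Otimes>\<^sub>M N))"
      unfolding split ..
    also have "\<dots> = (\<integral>p. (transpose B *v v) \<bullet> fst p + (v \<bullet> c + 0) \<partial>(\<pi> \<Otimes>\<^sub>M N)) + (\<integral>p. v \<bullet> snd p + 0 \<partial>(\<pi> \<Otimes>\<^sub>M N))"
      using integral_pair_fst(1)[OF M.prob_space_axioms N.prob_space_axioms, of "\<lambda>x. (transpose B *v v) \<bullet> x + (v \<bullet> c + 0)"]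
        integral_pair_snd(1)[OF M.prob_space_axioms N.prob_space_axioms, of "\<lambda>x. v \<bullet> x + 0"]
        P2_integrable_affine[OF pi] P2_integrable_inner[OF N]
      by (intro Bochner_Integration.integral_add) auto
    also have "\<dots> = (\<integral>x. (transpose B *v v) \<bullet> x + (v \<bullet> c + 0) \<partial>\<pi>) + (\<integral>w. v \<bullet> w + 0 \<partial>N)"
      by (intro arg_cong2[of _ _ _ _ "(+)"] integral_pair_fst(2) integral_pair_snd(2)
          M.prob_space_axioms N.prob_space_axioms) measurable
    also have "\<dots> = (transpose B *v v) \<bullet> mean \<pi> + v \<bullet> c + v \<bullet> mean N"
      using P2_integrable_inner[OF pi] integral_inner_mean[OF pi] integral_inner_mean[OF N]
      by (simp add: M.prob_space del: transpose_matrix_vector)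
    finally show ?thesis .
  qed
  show "Cov ?\<rho> = B ** Cov \<pi> ** transpose B + Cov N"
  proof (rule Cov_eqI[OF P2])
    show "transpose (B ** Cov \<pi> ** transpose B + Cov N) = B ** Cov \<pi> ** transpose B + Cov N"
      by (simp add: transpose_add matrix_transpose_mul transpose_Cov matrix_mul_assoc)
    fix v
    let ?u = "transpose B *v v"
    have centre: "v \<bullet> (B *v x + w + c - mean ?\<rho>)
        = (?u \<bullet> x + - (?u \<bullet> mean \<pi>)) + (v \<bullet> w + - (v \<bullet> mean N))" for x w
      by (simp add: inner_diff_right inner_add_right mean inner_matrix_vector_mult
          del: transpose_matrix_vector)
    have "(\<integral>x. (v \<bullet> (x - mean ?\<rho>))\<^sup>2 \<partial>?\<rho>) = (\<integral>p. ((?u \<bullet> fst p + - (?u \<bullet> mean \<pi>))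
        + (v \<bullet> snd p + - (v \<bullet> mean N)))\<^sup>2 \<partial>(\<pi> \<Otimes>\<^sub>M N))"
      unfolding centre[symmetric] by (subst integral_eq(1)) auto
    also have "\<dots> = (\<integral>x. (?u \<bullet> x + - (?u \<bullet> mean \<pi>))\<^sup>2 \<partial>\<pi>) + (\<integral>w. (v \<bullet> w + - (v \<bullet> mean N))\<^sup>2 \<partial>N)"
    proof (rule integral_pair_sum_sq(2)[OF M.prob_space_axioms N.prob_space_axioms _ _
            P2_integrable_sq[OF pi] P2_integrable_sq[OF N]])
      show "(\<integral>w. v \<bullet> w + - (v \<bullet> mean N) \<partial>N) = 0"
        using P2_integrable_inner[OF N] integral_inner_mean[OF N, of v] by (simp add: N.prob_space)
    qed measurable
    also have "\<dots> = ?u \<bullet> (Cov \<pi> *v ?u) + v \<bullet> (Cov N *v v)"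
      unfolding Cov_quadratic[OF pi] Cov_quadratic[OF N] by (simp add: inner_diff_right)
    also have "\<dots> = v \<bullet> ((B ** Cov \<pi> ** transpose B + Cov N) *v v)"
      unfolding matrix_vector_mult_add_rdistrib inner_add_right congruence_quadratic ..
    finally show "(\<integral>x. (v \<bullet> (x - mean ?\<rho>))\<^sup>2 \<partial>?\<rho>) = v \<bullet> ((B ** Cov \<pi> ** transpose B + Cov N) *v v)" .
  qed
qed

text \<open>Both measures agree on rectangles by independence, and rectangles determine a
  sigma-finite product measure.\<close>

lemma (in prob_space) indep_set_imp_distr_pair:
  fixes X :: "'a \<Rightarrow> 'b::second_countable_topology" and W :: "'a \<Rightarrow> 'c::second_countable_topology"
  assumes X[measurable]: "X \<in> borel_measurable M" and W[measurable]: "W \<in> borel_measurable M"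
    and indep: "indep_set (generated_events M X) (generated_events M W)"
  shows "distr M borel X \<Otimes>\<^sub>M distr M borel W = distr M (borel \<Otimes>\<^sub>M borel) (\<lambda>\<omega>. (X \<omega>, W \<omega>))"
proof -
  interpret X: prob_space "distr M borel X" by (rule prob_space_distr[OF X])
  interpret W: prob_space "distr M borel W" by (rule prob_space_distr[OF W])
  show ?thesis
  proof (rule pair_measure_eqI)
    fix A B assume "A \<in> sets (distr M borel X)" "B \<in> sets (distr M borel W)"
    then have [measurable]: "A \<in> sets borel" "B \<in> sets borel" by auto
    have "prob ((X -` A \<inter> space M) \<inter> (W -` B \<inter> space M)) = prob (X -` A \<inter> space M) * prob (W -` B \<inter> space M)"
      by (rule indep_setD[OF indep]) (auto simp: generated_events_def)
    moreover have "(X -` A \<inter> space M) \<inter> (W -` B \<inter> space M) = (\<lambda>\<omega>. (X \<omega>, W \<omega>)) -` (A \<times> B) \<inter> space M"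
      by auto
    ultimately show "emeasure (distr M borel X) A * emeasure (distr M borel W) B
        = emeasure (distr M (borel \<Otimes>\<^sub>M borel) (\<lambda>\<omega>. (X \<omega>, W \<omega>))) (A \<times> B)"
      by (simp add: emeasure_distr emeasure_eq_measure ennreal_mult''[symmetric])
  qed (simp_all add: X.sigma_finite_measure_axioms W.sigma_finite_measure_axioms)
qed

lemma (in prob_space) indep_affine_law:
  fixes X :: "'a \<Rightarrow> real^'m" and W :: "'a \<Rightarrow> real^'n" and B :: "real^'m^'n"
  assumes X[measurable]: "X \<in> borel_measurable M" and W[measurable]: "W \<in> borel_measurable M"
    and indep: "indep_set (generated_events M X) (generated_events M W)"
  shows "law M (\<lambda>\<omega>. B *v X \<omega> + W \<omega> + c) = affine_law B c (law M X) (law M W)"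
proof -
  have "affine_law B c (law M X) (law M W)
      = distr (distr M (borel \<Otimes>\<^sub>M borel) (\<lambda>\<omega>. (X \<omega>, W \<omega>))) borel (\<lambda>(x, w). B *v x + w + c)"
    unfolding affine_law_def by (simp only: indep_set_imp_distr_pair[OF assms])
  also have "\<dots> = law M (\<lambda>\<omega>. B *v X \<omega> + W \<omega> + c)"
    by (subst distr_distr) (auto simp: o_def)
  finally show ?thesis by simp
qed

section \<open>Couplings and the weighted Wasserstein distance\<close>

lemma weighted_norm_sq_nonneg: "pos_def S \<Longrightarrow> 0 \<le> weighted_norm_sq S v"
  unfolding weighted_norm_sq_def by (intro pos_semidefD(2) pos_def_imp_pos_semidef pos_def_matrix_inv)

lemma weighted_norm_sq_measurable[measurable]:
  assumes [measurable]: "f \<in> borel_measurable M"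
  shows "(\<lambda>x. weighted_norm_sq S (f x)) \<in> borel_measurable M"
  unfolding weighted_norm_sq_def by measurable

lemma couplingsD:
  assumes "\<gamma> \<in> couplings \<mu> \<nu>"
  shows "prob_space \<gamma>" "sets \<gamma> = sets (borel \<Otimes>\<^sub>M borel)" "distr \<gamma> borel fst = \<mu>" "distr \<gamma> borel snd = \<nu>"
  using assms by (auto simp: couplings_def)

text \<open>Witnessed by the product measure. Lower bounds for the real infimum in \<open>W2\<close>
  require a nonempty set.\<close>

lemma couplings_nonempty:
  assumes "\<mu> \<in> P2" "\<nu> \<in> P2" shows "couplings \<mu> \<nu> \<noteq> {}"
proof -
  interpret M: prob_space \<mu> by (rule P2D[OF assms(1)])
  interpret N: prob_space \<nu> by (rule P2D[OF assms(2)])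
  interpret P: pair_prob_space \<mu> \<nu> ..
  have s: "sets \<mu> = sets borel" "sets \<nu> = sets borel" using assms by (simp_all add: P2D)
  have "distr (\<mu> \<Otimes>\<^sub>M \<nu>) borel fst = distr (\<mu> \<Otimes>\<^sub>M \<nu>) \<mu> fst" by (rule distr_cong) (simp_all add: s)
  moreover have "distr (\<mu> \<Otimes>\<^sub>M \<nu>) borel snd = distr (\<mu> \<Otimes>\<^sub>M \<nu>) \<nu> snd" by (rule distr_cong) (simp_all add: s)
  ultimately have "\<mu> \<Otimes>\<^sub>M \<nu> \<in> couplings \<mu> \<nu>"
    by (simp add: couplings_def P.prob_space_axioms N.distr_pair_fst
        distr_pair_snd[OF M.prob_space_axioms N.prob_space_axioms] sets_pair_measure_cong[OF s])
  then show ?thesis by blast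
qed

lemma W2_nonneg:
  assumes "\<mu> \<in> P2" "\<nu> \<in> P2" "pos_def S" shows "0 \<le> W2 \<mu> \<nu> S"
  unfolding W2_def using couplings_nonempty[OF assms(1,2)]
  by (intro cINF_greatest) (auto intro!: Bochner_Integration.integral_nonneg weighted_norm_sq_nonneg[OF assms(3)])

lemma W2_le:
  assumes "pos_def S" "\<gamma> \<in> couplings \<mu> \<nu>"
  shows "W2 \<mu> \<nu> S \<le> sqrt (\<integral>(x, y). weighted_norm_sq S (x - y) \<partial>\<gamma>)"
  unfolding W2_def
  by (rule cINF_lower[OF _ assms(2)])
    (auto intro!: bdd_belowI[of _ 0] Bochner_Integration.integral_nonneg weighted_norm_sq_nonneg[OF assms(1)])

text \<open>The Bochner integral of a non-integrable cost would be 0, so integrability has to be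
  secured before costs are compared.\<close>

lemma coupling_cost_integrable:
  assumes P2: "\<mu> \<in> P2" "\<nu> \<in> P2" and gamma: "\<gamma> \<in> couplings \<mu> \<nu>"
  shows "integrable \<gamma> (\<lambda>p. weighted_norm_sq S (fst p - snd p))"
proof -
  have [measurable_cong]: "sets \<gamma> = sets (borel \<Otimes>\<^sub>M borel)" by (rule couplingsD[OF gamma])
  obtain c where c: "0 < c" "\<And>v. \<bar>v \<bullet> (matrix_inv S *v v)\<bar> \<le> c * (norm v)\<^sup>2"
    using quadratic_upper_bound by blast
  have "integrable \<gamma> (\<lambda>p. (norm (fst p))\<^sup>2)" "integrable \<gamma> (\<lambda>p. (norm (snd p))\<^sup>2)"
    using P2D(3)[OF P2(1)] P2D(3)[OF P2(2)] unfolding couplingsD(3,4)[OF gamma, symmetric]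
    by (subst (asm) (1 2) integrable_distr_eq; auto)+
  then have "integrable \<gamma> (\<lambda>p. c * (2 * (norm (fst p))\<^sup>2 + 2 * (norm (snd p))\<^sup>2))" by auto
  then show ?thesis
  proof (rule Bochner_Integration.integrable_bound)
    have "\<bar>weighted_norm_sq S (x - y)\<bar> \<le> c * (2 * (norm x)\<^sup>2 + 2 * (norm y)\<^sup>2)" for x y
    proof -
      have "(norm (x - y))\<^sup>2 \<le> (norm x + norm y)\<^sup>2"
        by (intro power_mono norm_triangle_ineq4) simp
      also have "\<dots> \<le> 2 * (norm x)\<^sup>2 + 2 * (norm y)\<^sup>2"
        using sum_squares_bound[of "norm x" "norm y"] by (simp add: power2_sum)
      finally have le: "(norm (x - y))\<^sup>2 \<le> 2 * (norm x)\<^sup>2 + 2 * (norm y)\<^sup>2" .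
      show ?thesis
        unfolding weighted_norm_sq_def
        by (rule order_trans[OF c(2) mult_left_mono[OF le less_imp_le[OF c(1)]]])
    qed
    then show "AE p in \<gamma>. norm (weighted_norm_sq S (fst p - snd p))
        \<le> norm (c * (2 * (norm (fst p))\<^sup>2 + 2 * (norm (snd p))\<^sup>2))"
      by (intro AE_I2) (simp only: real_norm_def order_trans[OF _ abs_ge_self])
  qed measurable
qed

text \<open>The new coupling is the image of \<open>\<gamma>\<close> and one independent noise
  variable used for both components; noise and shift drop out of the difference.\<close>

lemma synchronous_coupling:
  fixes B :: "real^'m^'n"
  assumes P2: "\<pi> \<in> P2" "\<pi>' \<in> P2" "N \<in> P2" and gamma: "\<gamma> \<in> couplings \<pi> \<pi>'"
  obtains \<gamma>' where "\<gamma>' \<in> couplings (affine_law B c \<pi> N) (affine_law B c \<pi>' N)"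
    "(\<integral>(x, y). weighted_norm_sq S (x - y) \<partial>\<gamma>') = (\<integral>(x, y). weighted_norm_sq S (B *v (x - y)) \<partial>\<gamma>)"
proof -
  interpret G: prob_space \<gamma> by (rule couplingsD[OF gamma])
  interpret N: prob_space N by (rule P2D[OF P2(3)])
  interpret P: pair_prob_space \<gamma> N ..
  have [measurable_cong]: "sets \<gamma> = sets (borel \<Otimes>\<^sub>M borel)" by (rule couplingsD[OF gamma])
  have [measurable_cong]: "sets N = sets borel" by (rule P2D[OF P2(3)])
  define T where "T p = (B *v fst (fst p) + snd p + c, B *v snd (fst p) + snd p + c)" for p :: "((real^'m) \<times> (real^'m)) \<times> (real^'n)"
  have T[measurable]: "T \<in> \<gamma> \<Otimes>\<^sub>M N \<rightarrow>\<^sub>M borel \<Otimes>\<^sub>M borel" unfolding T_def by measurable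
  define \<gamma>' where "\<gamma>' = distr (\<gamma> \<Otimes>\<^sub>M N) (borel \<Otimes>\<^sub>M borel) T"
  have marginal: "distr (\<gamma> \<Otimes>\<^sub>M N) borel (\<lambda>p. B *v f (fst p) + snd p + c) = affine_law B c (distr \<gamma> borel f) N"
    if [measurable]: "f \<in> borel_measurable \<gamma>" for f
  proof -
    have "distr \<gamma> borel f \<Otimes>\<^sub>M distr N N (\<lambda>x. x)
        = distr (\<gamma> \<Otimes>\<^sub>M N) (borel \<Otimes>\<^sub>M N) (\<lambda>(x, y). (f x, y))"
      by (rule pair_measure_distr) (simp_all add: N.sigma_finite_measure_axioms)
    then show ?thesis
      unfolding affine_law_def distr_id by (simp add: distr_distr o_def case_prod_unfold)
  qed
  have "\<gamma>' \<in> couplings (affine_law B c \<pi> N) (affine_law B c \<pi>' N)"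
    unfolding couplings_def
    using marginal[of fst] marginal[of snd] couplingsD[OF gamma] P.prob_space_distr[OF T]
    by (simp add: \<gamma>'_def distr_distr o_def T_def)
  moreover have "(\<integral>(x, y). weighted_norm_sq S (x - y) \<partial>\<gamma>') = (\<integral>(x, y). weighted_norm_sq S (B *v (x - y)) \<partial>\<gamma>)"
  proof -
    have "(\<integral>(x, y). weighted_norm_sq S (x - y) \<partial>\<gamma>')
        = (\<integral>p. weighted_norm_sq S (B *v (fst (fst p) - snd (fst p))) \<partial>(\<gamma> \<Otimes>\<^sub>M N))"
      unfolding \<gamma>'_def
      by (subst integral_distr[OF T]) (auto simp: T_def matrix_vector_mult_diff_distrib)
    also have "\<dots> = (\<integral>q. weighted_norm_sq S (B *v (fst q - snd q)) \<partial>\<gamma>)"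
      by (rule integral_pair_fst(2)[OF G.prob_space_axioms N.prob_space_axioms]) measurable
    finally show ?thesis by (simp add: case_prod_unfold)
  qed
  ultimately show ?thesis by (rule that)
qed

lemma W2_affine_law_contraction:
  fixes B :: "real^'m^'n"
  assumes P2: "\<pi> \<in> P2" "\<pi>' \<in> P2" "N \<in> P2" and S: "pos_def S" "pos_def S'"
    and k: "0 \<le> k" "\<And>v. weighted_norm_sq S' (B *v v) \<le> k * weighted_norm_sq S v"
  shows "(W2 (affine_law B c \<pi> N) (affine_law B c \<pi>' N) S')\<^sup>2 \<le> k * (W2 \<pi> \<pi>' S)\<^sup>2"
proof -
  let ?W = "W2 (affine_law B c \<pi> N) (affine_law B c \<pi>' N) S'"
  have le: "?W \<le> sqrt k * sqrt (\<integral>(x, y). weighted_norm_sq S (x - y) \<partial>\<gamma>)"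
    if gamma: "\<gamma> \<in> couplings \<pi> \<pi>'" for \<gamma>
  proof -
    have [measurable_cong]: "sets \<gamma> = sets (borel \<Otimes>\<^sub>M borel)" by (rule couplingsD[OF gamma])
    obtain \<gamma>' where g': "\<gamma>' \<in> couplings (affine_law B c \<pi> N) (affine_law B c \<pi>' N)"
      "(\<integral>(x, y). weighted_norm_sq S' (x - y) \<partial>\<gamma>') = (\<integral>(x, y). weighted_norm_sq S' (B *v (x - y)) \<partial>\<gamma>)"
      by (rule synchronous_coupling[OF P2 gamma])
    have int: "integrable \<gamma> (\<lambda>p. k * weighted_norm_sq S (fst p - snd p))"
      using coupling_cost_integrable[OF P2(1,2) gamma] by auto
    have "(\<integral>p. weighted_norm_sq S' (B *v (fst p - snd p)) \<partial>\<gamma>) \<le> (\<integral>p. k * weighted_norm_sq S (fst p - snd p) \<partial>\<gamma>)"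
    proof (rule integral_mono_AE[OF _ int])
      show "integrable \<gamma> (\<lambda>p. weighted_norm_sq S' (B *v (fst p - snd p)))"
        by (rule Bochner_Integration.integrable_bound[OF int])
          (use k weighted_norm_sq_nonneg[OF S(2)] weighted_norm_sq_nonneg[OF S(1)] in \<open>auto simp: abs_mult\<close>)
    qed (use k in auto)
    then have "(\<integral>(x, y). weighted_norm_sq S' (x - y) \<partial>\<gamma>') \<le> k * (\<integral>(x, y). weighted_norm_sq S (x - y) \<partial>\<gamma>)"
      unfolding g'(2) by (simp add: case_prod_unfold)
    then have "sqrt (\<integral>(x, y). weighted_norm_sq S' (x - y) \<partial>\<gamma>') \<le> sqrt k * sqrt (\<integral>(x, y). weighted_norm_sq S (x - y) \<partial>\<gamma>)"
      unfolding real_sqrt_mult[symmetric] by (rule real_sqrt_le_mono)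
    then show ?thesis using W2_le[OF S(2) g'(1)] by linarith
  qed
  have "?W \<le> sqrt k * W2 \<pi> \<pi>' S"
  \<comment> \<open>The infimum is reached by dividing by \<open>sqrt k\<close>. For
    \<open>k = 0\<close> a single coupling already gives the bound.\<close>
  proof (cases "k = 0")
    case True
    obtain \<gamma> where "\<gamma> \<in> couplings \<pi> \<pi>'" using couplings_nonempty[OF P2(1,2)] by blast
    from le[OF this] True show ?thesis by simp
  next
    case False
    then have "0 < sqrt k" using k by simp
    then have "?W / sqrt k \<le> W2 \<pi> \<pi>' S"
      unfolding W2_def[of \<pi> \<pi>'] using couplings_nonempty[OF P2(1,2)] le
      by (intro cINF_greatest) (auto simp: field_simps)
    with \<open>0 < sqrt k\<close> show ?thesis by (simp add: field_simps)
  qed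
  moreover have "0 \<le> ?W" by (intro W2_nonneg affine_law_P2 P2 S)
  ultimately have "?W\<^sup>2 \<le> (sqrt k * W2 \<pi> \<pi>' S)\<^sup>2" by (rule power_mono)
  then show ?thesis using k by (simp add: power_mult_distrib)
qed

section \<open>The filter\<close>

lemma Int_stable_generated_events: "Int_stable (generated_events M Z)"
proof (rule Int_stableI)
  fix a b assume "a \<in> generated_events M Z" "b \<in> generated_events M Z"
  then obtain A B where "A \<in> sets borel" "B \<in> sets borel" "a = Z -` A \<inter> space M" "b = Z -` B \<inter> space M"
    by (auto simp: generated_events_def)
  then have "a \<inter> b = Z -` (A \<inter> B) \<inter> space M" "A \<inter> B \<in> sets borel" by auto
  then show "a \<inter> b \<in> generated_events M Z" unfolding generated_events_def by blast
qed

context mfenkf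
begin

text \<open>The information carried by a set of drivers. Independence of two variables then reduces
  to disjointness of the index sets they depend on.\<close>

definition drivers_sigma :: "driver set \<Rightarrow> 'w measure" where
  "drivers_sigma I = sigma (space M) (\<Union>i\<in>I. driver_events M (X 0) \<xi> \<eta> i)"

lemma driver_events_subset: "driver_events M (X 0) \<xi> \<eta> i \<subseteq> events"
  using independent by (auto simp: indep_sets_def)

lemma space_drivers_sigma[simp]: "space (drivers_sigma I) = space M"
  and sets_drivers_sigma: "sets (drivers_sigma I)
    = sigma_sets (space M) (\<Union>i\<in>I. driver_events M (X 0) \<xi> \<eta> i)"
proof -
  have "(\<Union>i\<in>I. driver_events M (X 0) \<xi> \<eta> i) \<subseteq> Pow (space M)"
    using driver_events_subset sets.space_closed by blast
  then show "space (drivers_sigma I) = space M" "sets (drivers_sigma I)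
      = sigma_sets (space M) (\<Union>i\<in>I. driver_events M (X 0) \<xi> \<eta> i)"
    by (simp_all add: drivers_sigma_def)
qed

lemma driver_measurable:
  fixes Z :: "'w \<Rightarrow> 'b::topological_space"
  assumes "i \<in> I" "driver_events M (X 0) \<xi> \<eta> i = generated_events M Z"
  shows "Z \<in> borel_measurable (drivers_sigma I)"
proof (rule measurableI)
  fix B :: "'b set" assume "B \<in> sets borel"
  then have "Z -` B \<inter> space M \<in> driver_events M (X 0) \<xi> \<eta> i"
    unfolding assms(2) generated_events_def by blast
  then show "Z -` B \<inter> space (drivers_sigma I) \<in> sets (drivers_sigma I)"
    using assms(1) by (auto simp: sets_drivers_sigma)
qed simp

lemma drivers_sigma_mono:
  assumes "I \<subseteq> J" "Z \<in> borel_measurable (drivers_sigma I)"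
  shows "Z \<in> borel_measurable (drivers_sigma J)"
proof -
  have "sets (drivers_sigma I) \<subseteq> sets (drivers_sigma J)"
    unfolding sets_drivers_sigma using assms(1) by (intro sigma_sets_mono') auto
  then show ?thesis using assms(2) by (auto simp: measurable_def)
qed

lemma drivers_sigma_measurable:
  assumes "Z \<in> borel_measurable (drivers_sigma I)" shows "Z \<in> borel_measurable M"
proof -
  have "sets (drivers_sigma I) \<subseteq> events"
    unfolding sets_drivers_sigma using driver_events_subset by (intro sets.sigma_sets_subset) auto
  then show ?thesis using assms by (auto simp: measurable_def)
qed

text \<open>Joint independence of intersection-stable families passes to the sigma-algebras
  generated by disjoint groups of them.\<close>

lemma drivers_indep:
  assumes "I \<inter> J = {}" and Z: "Z \<in> borel_measurable (drivers_sigma I)" "W \<in> borel_measurable (drivers_sigma J)"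
  shows "indep_set (generated_events M Z) (generated_events M W)"
proof -
  have stable: "Int_stable (driver_events M (X 0) \<xi> \<eta> i)" for i
    by (cases i) (simp_all add: Int_stable_generated_events)
  have "indep_sets (\<lambda>b. sigma_sets (space M) (\<Union>i\<in>case_bool I J b. driver_events M (X 0) \<xi> \<eta> i)) UNIV"
    using assms(1)
    by (intro indep_sets_collect_sigma stable indep_sets_mono_index[OF _ independent])
      (auto simp: disjoint_family_on_def split: bool.split)
  moreover have "generated_events M Z \<subseteq> sets (drivers_sigma I)" "generated_events M W \<subseteq> sets (drivers_sigma J)"
    using measurable_sets[OF Z(1)] measurable_sets[OF Z(2)] by (auto simp: generated_events_def)
  ultimately show ?thesis
    unfolding indep_set_def sets_drivers_sigma
    by (elim indep_sets_mono_sets) (auto split: bool.split)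
qed

text \<open>\<open>Signal i\<close> and \<open>Observation i\<close> stand for the noises with index
  \<open>Suc i\<close>, so these are the drivers of \<open>X n\<close>: the initial value and both
  noises with indices 1 to \<open>n\<close>.\<close>

definition past :: "nat \<Rightarrow> driver set" where
  "past n = insert Initial (Signal ` {..<n} \<union> Observation ` {..<n})"

lemma state_measurable:
  "X n \<in> borel_measurable (drivers_sigma (past n))"
  "Xh (Suc n) \<in> borel_measurable (drivers_sigma (insert (Signal n) (past n)))"
proof -
  have Xh: "Xh (Suc n) \<in> borel_measurable (drivers_sigma (insert (Signal n) (past n)))"
    if "X n \<in> borel_measurable (drivers_sigma (past n))" for n
  proof -
    let ?S = "drivers_sigma (insert (Signal n) (past n))"
    have [measurable]: "X n \<in> borel_measurable ?S" by (rule drivers_sigma_mono[OF _ that]) auto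
    have [measurable]: "\<xi> (Suc n) \<in> borel_measurable ?S"
      by (rule driver_measurable[of "Signal n"]) simp_all
    have "(\<lambda>\<omega>. A *v X n \<omega> + \<xi> (Suc n) \<omega>) \<in> borel_measurable ?S" by measurable
    then show ?thesis by (subst measurable_cong[OF forecast]) simp_all
  qed
  show X: "X n \<in> borel_measurable (drivers_sigma (past n))"
  proof (induction n)
    case 0
    show ?case by (rule driver_measurable[of Initial]) (simp_all add: past_def)
  next
    case (Suc n)
    let ?S = "drivers_sigma (past (Suc n))"
    have "insert (Signal n) (past n) \<subseteq> past (Suc n)" by (auto simp: past_def)
    from drivers_sigma_mono[OF this Xh[OF Suc]] have [measurable]: "Xh (Suc n) \<in> borel_measurable ?S" .
    have [measurable]: "\<eta> (Suc n) \<in> borel_measurable ?S"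
      by (rule driver_measurable[of "Observation n"]) (simp_all add: past_def)
    show ?case by (subst measurable_cong[OF analysis]) (simp, measurable)
  qed
  show "Xh (Suc n) \<in> borel_measurable (drivers_sigma (insert (Signal n) (past n)))" by (rule Xh[OF X])
qed

lemma noise_laws:
  assumes "n \<ge> 1"
  shows "law M (\<xi> n) = gaussian_law \<Sigma>" "law M (\<eta> n) = gaussian_law \<Gamma>"
    "\<xi> n \<in> borel_measurable M" "\<eta> n \<in> borel_measurable M"
    "prob_space (gaussian_law \<Sigma>)" "prob_space (gaussian_law \<Gamma>)"
  using prob_space_distributed_law[OF prob_space_axioms signal_noise[OF assms]]
    prob_space_distributed_law[OF prob_space_axioms observation_noise[OF assms]] by simp_all

lemma first_forecast_law: "law M (Xh 1) = affine_law A 0 \<mu> (gaussian_law \<Sigma>)"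
proof -
  have m: "X 0 \<in> borel_measurable (drivers_sigma {Initial})"
    "\<xi> 1 \<in> borel_measurable (drivers_sigma {Signal 0})"
    by (auto intro: driver_measurable[of Initial] driver_measurable[of "Signal 0"])
  have "law M (Xh 1) = law M (\<lambda>\<omega>. A *v X 0 \<omega> + \<xi> 1 \<omega> + 0)"
    using forecast[of _ 0] by (intro distr_cong) simp_all
  also have "\<dots> = affine_law A 0 (law M (X 0)) (law M (\<xi> 1))"
    by (rule indep_affine_law[OF init_measurable noise_laws(3)[OF order_refl] drivers_indep[OF _ m]]) simp
  finally show ?thesis using init_law noise_laws(1)[of 1] by simp
qed

end

section \<open>Forecast laws, their covariances and their contraction\<close>

context riccati
begin

text \<open>The total noise between consecutive forecasts: the observation noise fed back through
  the gain plus the next signal noise.\<close>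

definition noise_law :: "real^'d^'d \<Rightarrow> (real^'d) measure" where
  "noise_law C = affine_law (- gain C) 0 (gaussian_law \<Gamma>) (gaussian_law \<Sigma>)"

lemma noise_law_P2:
  assumes "prob_space (gaussian_law \<Sigma>)" "prob_space (gaussian_law \<Gamma>)"
  shows "noise_law C \<in> P2" "Cov (noise_law C) = gain C ** \<Gamma> ** transpose (gain C) + \<Sigma>"
proof -
  note S = gaussian_law_P2[OF Sigma assms(1)] and G = gaussian_law_P2[OF Gamma assms(2)]
  show "noise_law C \<in> P2" unfolding noise_law_def by (rule affine_law_P2(1)[OF G(1) S(1)])
  have "(- gain C) ** \<Gamma> ** transpose (- gain C) = gain C ** \<Gamma> ** transpose (gain C)"
    using matrix_diff_rdistrib[of 0 "gain C" \<Gamma>] matrix_diff_rdistrib[of 0 "gain C ** \<Gamma>" "transpose (- gain C)"]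
      matrix_diff_ldistrib[of "gain C ** \<Gamma>" 0 "transpose (gain C)"] transpose_diff[of 0 "gain C"]
    by (simp add: transpose_def matrix_matrix_mult_def vec_eq_iff sum_negf)
  then show "Cov (noise_law C) = gain C ** \<Gamma> ** transpose (gain C) + \<Sigma>"
    unfolding noise_law_def affine_law_P2(2)[OF G(1) S(1)] S(3) G(3) by simp
qed

text \<open>Eliminating the analysis variable gives an affine recursion between forecasts. The
  forecast at time \<open>n\<close> depends on neither the observation noise at \<open>n\<close> nor
  the next signal noise, hence is independent of their combination \<open>W\<close>.\<close>

lemma forecast_law_step:
  assumes filter: "mfenkf A H \<Sigma> \<Gamma> \<mu> y M \<xi> \<eta> X Xh" and "n \<ge> 1"
  defines "C \<equiv> Cov (law M (Xh n))"
  shows "law M (Xh (Suc n)) = affine_law (closed_loop C) (gain C *v y n) (law M (Xh n)) (noise_law C)"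
proof -
  interpret mfenkf A H \<Sigma> \<Gamma> \<mu> y M \<xi> \<eta> X Xh by (rule filter)
  obtain m where n: "n = Suc m" using assms(2) by (cases n) auto
  define W where "W \<omega> = (- gain C) *v \<eta> n \<omega> + \<xi> (Suc n) \<omega> + 0" for \<omega>
  have eta: "\<eta> n \<in> borel_measurable (drivers_sigma {Observation m})"
    unfolding n by (rule driver_measurable[of "Observation m"]) simp_all
  have xi: "\<xi> (Suc n) \<in> borel_measurable (drivers_sigma {Signal n})"
    by (rule driver_measurable[of "Signal n"]) simp_all
  have W: "W \<in> borel_measurable (drivers_sigma {Observation m, Signal n})"
  proof -
    have [measurable]: "\<eta> n \<in> borel_measurable (drivers_sigma {Observation m, Signal n})"
      "\<xi> (Suc n) \<in> borel_measurable (drivers_sigma {Observation m, Signal n})"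
      by (rule drivers_sigma_mono[OF _ eta] drivers_sigma_mono[OF _ xi]; simp)+
    show ?thesis unfolding W_def by measurable
  qed
  have Xh: "Xh n \<in> borel_measurable (drivers_sigma (insert (Signal m) (past m)))"
    unfolding n by (rule state_measurable)
  have law_W: "law M W = noise_law C"
    unfolding W_def noise_law_def
    using indep_affine_law[OF drivers_sigma_measurable[OF eta] drivers_sigma_measurable[OF xi]
        drivers_indep[OF _ eta xi], of "- gain C" 0] noise_laws(1)[of "Suc n"] noise_laws(2)[OF assms(2)]
    by simp
  have "Xh (Suc n) \<omega> = closed_loop C *v Xh n \<omega> + W \<omega> + gain C *v y n" if "\<omega> \<in> space M" for \<omega>
  proof -
    let ?G = "C ** transpose H ** matrix_inv (innov C)"
    have "X n \<omega> = Xh n \<omega> - ?G *v (H *v Xh n \<omega> + \<eta> n \<omega> - y n)"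
      using analysis[OF that, of m] unfolding n[symmetric] C_def[symmetric] innov_def[symmetric] .
    then have "A *v X n \<omega> = A *v Xh n \<omega> - gain C *v (H *v Xh n \<omega> + \<eta> n \<omega> - y n)"
      by (simp add: gain_eq matrix_vector_mult_diff_distrib matrix_vector_mul_assoc matrix_mul_assoc)
    then show ?thesis
      using matrix_vector_mult_diff_rdistrib[of 0 "gain C" "\<eta> n \<omega>"]
      by (simp add: forecast[OF that] W_def closed_loop_def matrix_vector_mult_diff_distrib
          matrix_vector_mult_diff_rdistrib matrix_vector_right_distrib matrix_vector_mul_assoc algebra_simps)
  qed
  then have "law M (Xh (Suc n)) = law M (\<lambda>\<omega>. closed_loop C *v Xh n \<omega> + W \<omega> + gain C *v y n)"
    by (intro distr_cong) simp_all
  also have "\<dots> = affine_law (closed_loop C) (gain C *v y n) (law M (Xh n)) (law M W)"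
    by (rule indep_affine_law[OF drivers_sigma_measurable[OF Xh] drivers_sigma_measurable[OF W]
          drivers_indep[OF _ Xh W]]) (auto simp: n past_def)
  finally show ?thesis unfolding law_W .
qed

text \<open>The first forecast involves no gain, so Riccati steps start from index 1. Truncated
  subtraction gives index 0 the same value, which lets the bounds below hold for every
  \<open>n\<close>.\<close>

definition forecast_cov :: "real^'d^'d \<Rightarrow> nat \<Rightarrow> real^'d^'d" where
  "forecast_cov C0 n = (ricc ^^ (n - 1)) (A ** C0 ** transpose A + \<Sigma>)"

lemma forecast_cov_Suc: "n \<ge> 1 \<Longrightarrow> forecast_cov C0 (Suc n) = ricc (forecast_cov C0 n)"
  by (cases n) (simp_all add: forecast_cov_def)

lemma pos_def_forecast_cov_1: "pos_semidef C0 \<Longrightarrow> pos_def (A ** C0 ** transpose A + \<Sigma>)"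
  using pos_def_add[OF Sigma pos_semidef_congruence[of C0 A]] by (simp add: add.commute)

lemma forecast_cov_props:
  assumes "pos_semidef C0"
  shows "pos_def (forecast_cov C0 n)" "v \<bullet> (\<Sigma> *v v) \<le> v \<bullet> (forecast_cov C0 n *v v)"
proof -
  have psd: "pos_semidef ((ricc ^^ k) (A ** C0 ** transpose A + \<Sigma>))" for k
    by (intro pos_semidef_ricc_iterate pos_def_imp_pos_semidef pos_def_forecast_cov_1 assms)
  have 1: "v \<bullet> (\<Sigma> *v v) \<le> v \<bullet> ((A ** C0 ** transpose A + \<Sigma>) *v v)"
    using pos_semidefD(2)[OF pos_semidef_congruence[OF assms, of A], of v]
    by (simp add: matrix_vector_mult_add_rdistrib inner_add_right)
  show "pos_def (forecast_cov C0 n)"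
    unfolding forecast_cov_def
    using pos_def_ricc[OF psd] pos_def_forecast_cov_1[OF assms] by (cases "n - 1") simp_all
  show "v \<bullet> (\<Sigma> *v v) \<le> v \<bullet> (forecast_cov C0 n *v v)"
    unfolding forecast_cov_def using ricc_ge_Sigma[OF psd] 1 by (cases "n - 1") simp_all
qed

text \<open>The covariance of an affine step with \<open>noise_law\<close> is exactly the
  closed-loop form of the Riccati map, and the observations enter only the shift.\<close>

lemma forecast_law_Cov:
  assumes filter: "mfenkf A H \<Sigma> \<Gamma> \<mu> y M \<xi> \<eta> X Xh" and mu: "\<mu> \<in> P2" and "n \<ge> 1"
  shows "law M (Xh n) \<in> P2 \<and> Cov (law M (Xh n)) = forecast_cov (Cov \<mu>) n"
  using assms(3)
proof (induction n rule: nat_induct_at_least)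
  interpret mfenkf A H \<Sigma> \<Gamma> \<mu> y M \<xi> \<eta> X Xh by (rule filter)
  have prob: "prob_space (gaussian_law \<Sigma>)" "prob_space (gaussian_law \<Gamma>)" using noise_laws[of 1] by simp_all
  {
    case base
    show ?case
      unfolding first_forecast_law
      using affine_law_P2[OF mu gaussian_law_P2(1)[OF Sigma prob(1)]] gaussian_law_P2(3)[OF Sigma prob(1)]
      by (simp add: forecast_cov_def)
  next
    case (Suc n)
    then show ?case
      unfolding forecast_law_step[OF filter Suc(1)]
      using affine_law_P2[OF conjunct1[OF Suc(2)] noise_law_P2(1)[OF prob]] noise_law_P2(2)[OF prob]
        ricc_closed_loop[OF pos_def_imp_pos_semidef[OF forecast_cov_props(1)[OF pos_semidef_Cov[OF mu]]]]
      by (simp add: forecast_cov_Suc add.assoc)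
  }
qed

text \<open>Equal covariances and a common observation make both laws images under the same
  \<open>affine_law\<close> step, so the matrix inequality \<open>closed_loop_contraction\<close>
  transfers to \<open>W2\<close>.\<close>

lemma forecast_W2_contraction:
  assumes filters: "mfenkf A H \<Sigma> \<Gamma> \<mu> y M \<xi> \<eta> X Xh" "mfenkf A H \<Sigma> \<Gamma> \<nu> y M' \<xi>' \<eta>' X' Xh'"
    and P2: "\<mu> \<in> P2" "\<nu> \<in> P2" and Cov: "Cov \<nu> = Cov \<mu>" and n: "n \<ge> 1"
  defines "C \<equiv> forecast_cov (Cov \<mu>)"
  shows "(W2 (law M (Xh (Suc n))) (law M' (Xh' (Suc n))) (C (Suc n)))\<^sup>2
    \<le> (1 - beta (C n)) * (W2 (law M (Xh n)) (law M' (Xh' n)) (C n))\<^sup>2"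
proof -
  interpret mfenkf A H \<Sigma> \<Gamma> \<mu> y M \<xi> \<eta> X Xh by (rule filters(1))
  note laws = forecast_law_Cov[OF filters(1) P2(1) n] forecast_law_Cov[OF filters(2) P2(2) n]
  have pd: "pos_def (C k)" for k
    unfolding C_def by (rule forecast_cov_props(1)[OF pos_semidef_Cov[OF P2(1)]])
  have step: "law M (Xh (Suc n)) = affine_law (closed_loop (C n)) (gain (C n) *v y n) (law M (Xh n)) (noise_law (C n))"
    "law M' (Xh' (Suc n)) = affine_law (closed_loop (C n)) (gain (C n) *v y n) (law M' (Xh' n)) (noise_law (C n))"
    using forecast_law_step[OF filters(1) n] forecast_law_step[OF filters(2) n] laws
    by (simp_all add: C_def Cov)
  have noise: "noise_law (C n) \<in> P2" using noise_laws[of 1] by (intro noise_law_P2(1)) simp_all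
  have "C (Suc n) = ricc (C n)" using forecast_cov_Suc[OF n] by (simp add: C_def)
  then show ?thesis
    unfolding step using laws beta_le_1[OF pd] closed_loop_contraction[OF pd] pd[of n] pd[of "Suc n"]
    by (intro W2_affine_law_contraction[OF _ _ noise]) auto
qed

text \<open>The lower bound on the covariances is that of \<open>\<Sigma>\<close>; the upper bound
  comes from detectability and depends on \<open>C0\<close>, and so does \<open>b\<close>.\<close>

lemma beta_forecast_cov_lower_bound:
  assumes "d_detectable H A" "pos_semidef C0"
  obtains b where "0 < b" "b \<le> 1" "\<And>n. b \<le> beta (forecast_cov C0 n)"
proof -
  obtain s where s: "0 < s" "\<And>v. s * (norm v)\<^sup>2 \<le> v \<bullet> (\<Sigma> *v v)"
    using pos_def_lower_bound[OF Sigma] by blast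
  obtain c where c: "0 < c"
    "\<And>n v. v \<bullet> ((ricc ^^ n) (A ** C0 ** transpose A + \<Sigma>) *v v) \<le> c * (norm v)\<^sup>2"
    by (rule ricc_iterates_bounded[OF assms(1) pos_def_imp_pos_semidef[OF pos_def_forecast_cov_1[OF assms(2)]]])
      blast
  obtain b where b: "0 < b" "b \<le> 1"
    "\<And>C. pos_def C \<Longrightarrow> (\<And>v. s * (norm v)\<^sup>2 \<le> v \<bullet> (C *v v)) \<Longrightarrow>
      (\<And>v. v \<bullet> (C *v v) \<le> c * (norm v)\<^sup>2) \<Longrightarrow> b \<le> beta C"
    using beta_lower_bound[OF s(1) c(1)] by blast
  have "b \<le> beta (forecast_cov C0 n)" for n
  proof (rule b(3))
    show "pos_def (forecast_cov C0 n)" by (rule forecast_cov_props(1)[OF assms(2)])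
    show "s * (norm v)\<^sup>2 \<le> v \<bullet> (forecast_cov C0 n *v v)" for v
      by (rule order_trans[OF s(2) forecast_cov_props(2)[OF assms(2)]])
    show "v \<bullet> (forecast_cov C0 n *v v) \<le> c * (norm v)\<^sup>2" for v
      unfolding forecast_cov_def by (rule c(2))
  qed
  with b(1,2) show ?thesis by (rule that)
qed

lemma forecast_W2_geometric:
  assumes filters: "mfenkf A H \<Sigma> \<Gamma> \<mu> y M \<xi> \<eta> X Xh" "mfenkf A H \<Sigma> \<Gamma> \<nu> y M' \<xi>' \<eta>' X' Xh'"
    and P2: "\<mu> \<in> P2" "\<nu> \<in> P2" and Cov: "Cov \<nu> = Cov \<mu>"
    and b: "b \<le> 1" "\<And>n. b \<le> beta (forecast_cov (Cov \<mu>) n)"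
  defines "C \<equiv> forecast_cov (Cov \<mu>)"
  shows "(W2 (law M (Xh (Suc n))) (law M' (Xh' (Suc n))) (C (Suc n)))\<^sup>2
    \<le> (1 - b) ^ n * (W2 (law M (Xh 1)) (law M' (Xh' 1)) (C 1))\<^sup>2"
proof (induction n)
  case (Suc n)
  let ?W = "\<lambda>n. (W2 (law M (Xh n)) (law M' (Xh' n)) (C n))\<^sup>2"
  have "?W (Suc (Suc n)) \<le> (1 - beta (C (Suc n))) * ?W (Suc n)"
    unfolding C_def by (rule forecast_W2_contraction[OF filters P2 Cov]) simp
  also have "\<dots> \<le> (1 - b) * ?W (Suc n)"
    using b(2)[of "Suc n"] by (intro mult_right_mono) (auto simp: C_def)
  also have "\<dots> \<le> (1 - b) * ((1 - b) ^ n * ?W 1)"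
    using b(1) by (intro mult_left_mono Suc) simp
  finally show ?case by (simp add: mult.assoc)
qed simp

end

theorem theorem3p10:
  fixes A \<Sigma> :: "real^'d^'d" and H :: "real^'d^'k" and \<Gamma> :: "real^'k^'k"
  assumes "d_detectable H A" and "invertible A" and "pos_def \<Sigma>" and "pos_def \<Gamma>"
  shows
    "(\<forall>C. pos_def C \<longrightarrow> 0 < beta_d A H \<Sigma> \<Gamma> C) \<and>
     (\<exists>!C. is_stable_cov A H \<Sigma> \<Gamma> C) \<and>
     pos_def (stable_cov A H \<Sigma> \<Gamma>) \<and>
     beta_d A H \<Sigma> \<Gamma> (stable_cov A H \<Sigma> \<Gamma>) =
       lambda_min (matrix_inv (psd_sqrt (stable_cov A H \<Sigma> \<Gamma>))
         ** (\<Sigma> + gain_d A H \<Gamma> (stable_cov A H \<Sigma> \<Gamma>) ** \<Gamma>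
                  ** transpose (gain_d A H \<Gamma> (stable_cov A H \<Sigma> \<Gamma>)))
         ** matrix_inv (psd_sqrt (stable_cov A H \<Sigma> \<Gamma>))) \<and>
     (\<forall>C0 :: real^'d^'d. \<exists>Chat :: nat \<Rightarrow> real^'d^'d. \<exists>\<beta>0 > 0.
        \<forall>\<mu> \<in> P2. \<forall>\<nu> \<in> P2. Cov \<mu> = C0 \<longrightarrow> Cov \<nu> = C0 \<longrightarrow>
          (\<forall>(y :: nat \<Rightarrow> real^'k)
             (M :: 'w measure) \<xi> \<eta> X Xh
             (M' :: 'v measure) \<xi>' \<eta>' X' Xh'.
             mfenkf A H \<Sigma> \<Gamma> \<mu> y M \<xi> \<eta> X Xh \<longrightarrow>
             mfenkf A H \<Sigma> \<Gamma> \<nu> y M' \<xi>' \<eta>' X' Xh' \<longrightarrow>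
             (\<forall>n \<ge> 1.
                Cov (law M (Xh n)) = Chat n \<and>
                Cov (law M' (Xh' n)) = Chat n \<and>
                (W2 (law M (Xh (n + 1))) (law M' (Xh' (n + 1))) (Chat (n + 1)))\<^sup>2
                  \<le> (1 - beta_d A H \<Sigma> \<Gamma> (Chat n))
                     * (W2 (law M (Xh n)) (law M' (Xh' n)) (Chat n))\<^sup>2 \<and>
                \<beta>0 \<le> beta_d A H \<Sigma> \<Gamma> (Chat n) \<and>
                (W2 (law M (Xh (n + 1))) (law M' (Xh' (n + 1))) (Chat (n + 1)))\<^sup>2
                  \<le> (1 - \<beta>0) ^ n
                     * (W2 (law M (Xh 1)) (law M' (Xh' 1)) (Chat 1))\<^sup>2)))"
proof (intro conjI)
  interpret riccati A \<Sigma> H \<Gamma> by unfold_locales (fact assms)+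
  show "\<forall>C. pos_def C \<longrightarrow> 0 < beta C" using beta_pos by blast
  show ex1: "\<exists>!C. is_stable_cov A H \<Sigma> \<Gamma> C"
    using stable_cov_exists[OF assms(1)] stable_cov_unique by metis
  have stable: "is_stable_cov A H \<Sigma> \<Gamma> (stable_cov A H \<Sigma> \<Gamma>)"
    unfolding stable_cov_def by (rule theI'[OF ex1])
  show "pos_def (stable_cov A H \<Sigma> \<Gamma>)" by (rule stable_cov_ge_Sigma(2)[OF stable])
  show "beta (stable_cov A H \<Sigma> \<Gamma>) =
       lambda_min (matrix_inv (psd_sqrt (stable_cov A H \<Sigma> \<Gamma>))
         ** (\<Sigma> + gain (stable_cov A H \<Sigma> \<Gamma>) ** \<Gamma> ** transpose (gain (stable_cov A H \<Sigma> \<Gamma>)))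
         ** matrix_inv (psd_sqrt (stable_cov A H \<Sigma> \<Gamma>)))"
    by (rule beta_stable_cov[OF assms(2) stable])
  show "\<forall>C0 :: real^'d^'d. \<exists>Chat :: nat \<Rightarrow> real^'d^'d. \<exists>\<beta>0 > 0.
        \<forall>\<mu> \<in> P2. \<forall>\<nu> \<in> P2. Cov \<mu> = C0 \<longrightarrow> Cov \<nu> = C0 \<longrightarrow>
          (\<forall>(y :: nat \<Rightarrow> real^'k)
             (M :: 'w measure) \<xi> \<eta> X Xh
             (M' :: 'v measure) \<xi>' \<eta>' X' Xh'.
             mfenkf A H \<Sigma> \<Gamma> \<mu> y M \<xi> \<eta> X Xh \<longrightarrow>
             mfenkf A H \<Sigma> \<Gamma> \<nu> y M' \<xi>' \<eta>' X' Xh' \<longrightarrow>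
             (\<forall>n \<ge> 1.
                Cov (law M (Xh n)) = Chat n \<and>
                Cov (law M' (Xh' n)) = Chat n \<and>
                (W2 (law M (Xh (n + 1))) (law M' (Xh' (n + 1))) (Chat (n + 1)))\<^sup>2
                  \<le> (1 - beta (Chat n)) * (W2 (law M (Xh n)) (law M' (Xh' n)) (Chat n))\<^sup>2 \<and>
                \<beta>0 \<le> beta (Chat n) \<and>
                (W2 (law M (Xh (n + 1))) (law M' (Xh' (n + 1))) (Chat (n + 1)))\<^sup>2
                  \<le> (1 - \<beta>0) ^ n * (W2 (law M (Xh 1)) (law M' (Xh' 1)) (Chat 1))\<^sup>2))"
    (is "\<forall>C0. ?Q C0")
  proof
    fix C0 :: "real^'d^'d"
    \<comment> \<open>The rate is fixed before the measures are known. If \<open>C0\<close> is not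
      positive semidefinite, no measure in \<open>P2\<close> has this covariance and the placeholder
      1 serves.\<close>
    obtain b where b: "0 < b" "b \<le> 1" "\<And>n. pos_semidef C0 \<Longrightarrow> b \<le> beta (forecast_cov C0 n)"
    proof (cases "pos_semidef C0")
      case True
      then obtain c where "0 < c" "c \<le> 1" "\<And>n. c \<le> beta (forecast_cov C0 n)"
        by (rule beta_forecast_cov_lower_bound[OF assms(1)]) (rule that)
      then show thesis by (rule that)
    next
      case False
      then show thesis using that[of 1] by simp
    qed
    have psd: "pos_semidef C0" if "\<mu> \<in> P2" "Cov \<mu> = C0" for \<mu>
      using pos_semidef_Cov[OF that(1)] that(2) by simp
    show "?Q C0"
    proof (rule exI[of _ "forecast_cov C0"], rule exI[of _ b], intro conjI ballI allI impI, goal_cases)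
      case 1
      show ?case by (rule b(1))
    next
      case (2 \<mu> \<nu> y M \<xi> \<eta> X Xh M' \<xi>' \<eta>' X' Xh' n)
      then show ?case using forecast_law_Cov[OF 2(5) 2(1) 2(7)] by simp
    next
      case (3 \<mu> \<nu> y M \<xi> \<eta> X Xh M' \<xi>' \<eta>' X' Xh' n)
      then show ?case using forecast_law_Cov[OF 3(6) 3(2) 3(7)] by simp
    next
      case (4 \<mu> \<nu> y M \<xi> \<eta> X Xh M' \<xi>' \<eta>' X' Xh' n)
      then show ?case using forecast_W2_contraction[OF 4(5,6) 4(1,2) _ 4(7)] by simp
    next
      case (5 \<mu> \<nu> y M \<xi> \<eta> X Xh M' \<xi>' \<eta>' X' Xh' n)
      then show ?case using b(3) psd by blast
    next
      case (6 \<mu> \<nu> y M \<xi> \<eta> X Xh M' \<xi>' \<eta>' X' Xh' n)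
      then show ?case
        using forecast_W2_geometric[OF 6(5,6) 6(1,2) _ b(2), of n] b(3)[OF psd[OF 6(1) 6(3)]] by simp
    qed
  qed
qed

end
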